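(* Let $n=4$. The ideal $\mathfrak{b}$ of the ring $\mathbb{Q}[S_{ijk}:0\le i<j<k\le 4]$ consisting of all elements $b$ such that $bW$ is integral over this ring is the principal ideal generated by the element $$Q=\prod_{0\le i<j\le 4}\left(2S_{ijk}S_{ijl}+2S_{ijl}S_{ijm}+2S_{ijm}S_{ijk}-S_{ijk}^2-S_{ijl}^2-S_{ijm}^2\right)$$ $$=\prod_{0\le i<j\le 4}(A_{ijk}+A_{ijl}+A_{ijm})(-A_{ijk}+A_{ijl}+A_{ijm})(A_{ijk}-A_{ijl}+A_{ijm})(A_{ijk}+A_{ijl}-A_{ijm}),$$ where in each factor $k,l,m$ are the three elements of $\{0,1,2,3,4\}$ distinct from $i$ and $j$.
   Context: Let $\ell_{ij}=\ell_{ji}$, $0\le i<j\le 4$, be $10$ independent variables over $\mathbb{Q}$ (the edge lengths of a $4$-simplex with vertices $p_0,\dots,p_4$), put $s_{ij}=\ell_{ij}^2$, and let $\mathbb{F}$ be the algebraic closure of $\mathbb{Q}(\ell_{ij})$. For pairwise distinct $i,j,k$ (order irrelevant) put $$S_{ijk}=\tfrac1{16}\left(2s_{ij}s_{jk}+2s_{jk}s_{ki}+2s_{ki}s_{ij}-s_{ij}^2-s_{jk}^2-s_{ki}^2\right),\qquad A_{ijk}=\sqrt{S_{ijk}}\in\mathbb{F}.$$ The $10$ elements $S_{ijk}$ are algebraically independent over $\mathbb{Q}$, so $\mathbb{Q}[S_{ijk}]\subset\mathbb{F}$ is a polynomial ring in $10$ variables. $W$ is the square of the volume of the simplex, given by the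 Cayley--Menger formula $$W=\frac{-1}{2^4(4!)^2}\det M,$$ where $M$ is the symmetric $6\times 6$ matrix with rows and columns indexed by $*,0,1,2,3,4$, with $M_{**}=0$, $M_{*i}=M_{i*}=1$, $M_{ii}=0$, $M_{ij}=s_{ij}$ for $i\ne j$. *)

theory Defs
  imports
    "HOL-Algebra.Algebra"
    "HOL-Algebra.Algebraic_Closure_Type"
    "HOL-Library.Poly_Mapping"
    "HOL-Library.Nat_Bijection"
    "Jordan_Normal_Form.Determinant"
begin

text \<open>
  The vertices of the simplex are the natural numbers \<open>0, \<dots>, 4\<close>.  The ten variables
  \<open>\<ell>\<^sub>i\<^sub>j\<close> are indexed by the edges \<open>(i, j)\<close> with \<open>i < j\<close>.
\<close>

typedef edge = "{(i :: nat, j :: nat). i < j \<and> j \<le> 4}"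
  by (rule exI[of _ "(0, 1)"]) simp

text \<open>
  The order on edges has no meaning here.  The library needs some linear order on the variables
  to show that polynomials with coefficients in an integral domain form an integral domain.
\<close>

instantiation edge :: linorder
begin

definition less_eq_edge :: "edge \<Rightarrow> edge \<Rightarrow> bool" where
  "e \<le> f \<longleftrightarrow> prod_encode (Rep_edge e) \<le> prod_encode (Rep_edge f)"

definition less_edge :: "edge \<Rightarrow> edge \<Rightarrow> bool" where
  "e < f \<longleftrightarrow> prod_encode (Rep_edge e) < prod_encode (Rep_edge f)"

instance
  by standard
    (auto simp: less_eq_edge_def less_edge_def prod_encode_eq Rep_edge_inject)

end

instance fract :: ("{idom, ring_char_0}") field_char_0
proof
  have of_nat_fract: "(of_nat n :: 'a fract) = to_fract (of_nat n)" for n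
    by (induction n) simp_all
  show "inj (of_nat :: nat \<Rightarrow> 'a fract)"
    by (rule injI) (simp add: of_nat_fract)
qed

text \<open>
  \<open>edge \<Rightarrow>\<^sub>0 nat\<close> is the type of monomials, \<open>(edge \<Rightarrow>\<^sub>0 nat) \<Rightarrow>\<^sub>0 rat\<close> the polynomial ring
  \<open>\<rat>[\<ell>\<^sub>i\<^sub>j]\<close>, and \<open>lfield\<close> the algebraic closure of its field of fractions.
\<close>

type_synonym lfield = "((edge \<Rightarrow>\<^sub>0 nat) \<Rightarrow>\<^sub>0 rat) fract alg_closure"

definition edge_length :: "nat \<Rightarrow> nat \<Rightarrow> lfield" where
  "edge_length i j =
     to_ac (to_fract (Poly_Mapping.single
       (Poly_Mapping.single (Abs_edge (min i j, max i j)) 1) 1))"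

definition sq_length :: "nat \<Rightarrow> nat \<Rightarrow> lfield" where
  "sq_length i j = (edge_length i j)\<^sup>2"

definition S :: "nat \<Rightarrow> nat \<Rightarrow> nat \<Rightarrow> lfield" where
  "S i j k = 1 / 16 *
     (2 * sq_length i j * sq_length j k + 2 * sq_length j k * sq_length k i + 2 * sq_length k i * sq_length i j
      - (sq_length i j)\<^sup>2 - (sq_length j k)\<^sup>2 - (sq_length k i)\<^sup>2)"

text \<open>Index \<open>0\<close> plays the role of \<open>*\<close>, and index \<open>i + 1\<close> that of the vertex \<open>i\<close>.\<close>

definition cayley_menger :: "lfield mat" where
  "cayley_menger =
     mat 6 6 (\<lambda>(a, b). if a = b then 0 else if a = 0 \<or> b = 0 then 1 else sq_length (a - 1) (b - 1))"

definition W :: lfield where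
  "W = - 1 / (2 ^ 4 * (fact 4)\<^sup>2) * det cayley_menger"

text \<open>The subring \<open>\<rat>[S\<^sub>i\<^sub>j\<^sub>k]\<close> of \<open>lfield\<close>.\<close>

definition area_ring :: "lfield ring" where
  "area_ring = ring_of_type_algebra
     \<lparr>carrier := generate_ring ring_of_type_algebra
        (\<rat> \<union> {S i j k | i j k. i < j \<and> j < k \<and> k \<le> 4})\<rparr>"

text \<open>
  This is the library's \<^const>\<open>algebraic_int\<close> with \<open>\<int>\<close> replaced by an arbitrary set of coefficients.
\<close>

definition integral_over :: "'a :: field set \<Rightarrow> 'a \<Rightarrow> bool" where
  "integral_over R x \<longleftrightarrow>
     (\<exists>p. Polynomial.lead_coeff p = 1 \<and> (\<forall>i. Polynomial.coeff p i \<in> R) \<and> poly p x = 0)"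

definition denominator_ideal :: "lfield set" where
  "denominator_ideal =
     {b \<in> carrier area_ring. integral_over (carrier area_ring) (b * W)}"

text \<open>
  Each edge \<open>i < j\<close> occurs in exactly one tuple, because the other three vertices
  \<open>k\<close>, \<open>l\<close>, \<open>m\<close> are listed in increasing order.
\<close>

definition edge_splits :: "(nat \<times> nat \<times> nat \<times> nat \<times> nat) set" where
  "edge_splits =
     {(i, j, k, l, m). i < j \<and> k < l \<and> l < m \<and> {i, j, k, l, m} = {0, 1, 2, 3, 4}}"

definition Q :: lfield where
  "Q = (\<Prod>(i, j, k, l, m)\<in>edge_splits.
          2 * S i j k * S i j l + 2 * S i j l * S i j m + 2 * S i j m * S i j k
          - (S i j k)\<^sup>2 - (S i j l)\<^sup>2 - (S i j m)\<^sup>2)"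

end

theory Submission
  imports Defs
begin

text \<open>
  Let \<open>R\<close> be the ring generated by the squared areas.  Two things are to be shown: \<open>Q W\<close> is integral over
  \<open>R\<close>, and \<open>Q\<close> divides every \<open>b\<close> in \<open>R\<close> for which \<open>b W\<close> is integral.

  An element of a field is integral over a subring \<open>R\<close> as soon as it lies in all valuation
  rings that contain \<open>R\<close>.  Let \<open>V\<close> be one of them, and call an element finite if it lies in \<open>V\<close>.  All squared areas
  are finite; suppose that \<open>W\<close> is not.  Take an edge \<open>po\<close> of largest squared length \<open>\<sigma>\<close>, project the other
  three vertices orthogonally to it, and let \<open>N\<close> be \<open>\<sigma>\<close> times the Gram matrix of the projections.  The diagonal
  of \<open>N\<close> consists of multiples of squared areas, and \<open>576 W = det N / \<sigma>\<^sup>2\<close>, so that some entry off the diagonal is infinite.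
  The areas of the triangles that do not contain \<open>po\<close> leave little room for this.  Two of the five vertices must
  be so close together that the three areas on the edge between them are in the proportion
  \<open>r : s : r + s\<close>, up to a small error.  The factor of \<open>Q\<close> that belongs to this edge vanishes on such triples,
  and the error is small enough for this factor to compensate \<open>W\<close>; the other factors are finite.  The estimates are
  in \<open>vol_bounded\<close>, and \<open>some_edge_bounds_volume\<close> translates them into lengths.

  As to divisibility, an equation of integral dependence for \<open>b W\<close> is an identity in the ten edge lengths, so it
  holds for every choice of ten numbers as edge lengths.  The lemma \<open>degenerating_family\<close> provides, for every
  edge \<open>pq\<close>, simplices depending on a parameter \<open>t\<close> whose ten squared areas are polynomials in \<open>t\<close> while \<open>W\<close> has a
  double pole at \<open>t = 0\<close>.  Then \<open>b\<close> has to vanish at the limit of the areas.  These limits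
  fill a dense part of the hypersurface on which the factor of \<open>Q\<close> belonging to \<open>pq\<close> is zero.  Since this factor
  generates a prime ideal, it divides \<open>b\<close>; and since no factor of \<open>Q\<close> vanishes identically on the
  hypersurface of another one, their product divides \<open>b\<close> as well.
\<close>

section \<open>Integrality and valuation rings\<close>

locale unital_subring =
  fixes B :: "'a :: field set"
  assumes one_mem [simp]: "1 \<in> B"
    and diff_mem [simp]: "x \<in> B \<Longrightarrow> y \<in> B \<Longrightarrow> x - y \<in> B"
    and mult_mem [simp]: "x \<in> B \<Longrightarrow> y \<in> B \<Longrightarrow> x * y \<in> B"
begin

lemma zero_mem [simp]: "0 \<in> B"
  using diff_mem[of 1 1] by simp

lemma uminus_mem [simp]: "x \<in> B \<Longrightarrow> - x \<in> B"
  using diff_mem[of 0 x] by simp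

lemma add_mem [simp]: "x \<in> B \<Longrightarrow> y \<in> B \<Longrightarrow> x + y \<in> B"
  using diff_mem[of x "- y"] by simp

lemma power_mem [simp]: "x \<in> B \<Longrightarrow> x ^ n \<in> B"
  by (induction n) simp_all

lemma sum_mem: "(\<And>i. i \<in> I \<Longrightarrow> f i \<in> B) \<Longrightarrow> sum f I \<in> B"
  by (induction I rule: infinite_finite_induct) simp_all

lemma prod_mem: "(\<And>i. i \<in> I \<Longrightarrow> f i \<in> B) \<Longrightarrow> prod f I \<in> B"
  by (induction I rule: infinite_finite_induct) simp_all

definition polys :: "'a poly set" where
  "polys = {p. \<forall>i. coeff p i \<in> B}"

lemma coeff_mem: "p \<in> polys \<Longrightarrow> coeff p i \<in> B"
  by (simp add: polys_def)

lemma polys_diff [simp]: "p \<in> polys \<Longrightarrow> q \<in> polys \<Longrightarrow> p - q \<in> polys"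
  by (simp add: polys_def)

lemma polys_add [simp]: "p \<in> polys \<Longrightarrow> q \<in> polys \<Longrightarrow> p + q \<in> polys"
  by (simp add: polys_def)

lemma polys_mult [simp]: "p \<in> polys \<Longrightarrow> q \<in> polys \<Longrightarrow> p * q \<in> polys"
  by (auto simp: polys_def coeff_mult intro!: sum_mem)

lemma polys_smult [simp]: "c \<in> B \<Longrightarrow> p \<in> polys \<Longrightarrow> smult c p \<in> polys"
  by (simp add: polys_def)

lemma polys_monom [simp]: "c \<in> B \<Longrightarrow> monom c n \<in> polys"
  by (simp add: polys_def)

lemma polys_reflect [simp]: "p \<in> polys \<Longrightarrow> reflect_poly p \<in> polys"
  by (simp add: polys_def coeff_reflect_poly)

lemma polys_pCons_iff [simp]: "pCons c p \<in> polys \<longleftrightarrow> c \<in> B \<and> p \<in> polys"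
  by (force simp: polys_def coeff_pCons split: nat.splits)

lemma polys_zero [simp]: "0 \<in> polys"
  by (simp add: polys_def)

lemma poly_mem: "p \<in> polys \<Longrightarrow> x \<in> B \<Longrightarrow> poly p x \<in> B"
  by (induction p) auto

definition adjoin :: "'a \<Rightarrow> 'a set" where
  "adjoin y = {poly p y | p. p \<in> polys}"

lemma adjoinI: "p \<in> polys \<Longrightarrow> poly p y \<in> adjoin y"
  by (auto simp: adjoin_def)

lemma unital_subring_adjoin: "unital_subring (adjoin y)"
proof
  show "1 \<in> adjoin y"
    using adjoinI[of "[:1:]" y] by simp
next
  fix a b assume "a \<in> adjoin y" "b \<in> adjoin y"
  then obtain p q where "p \<in> polys" "q \<in> polys" "a = poly p y" "b = poly q y"
    by (auto simp: adjoin_def)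
  then show "a - b \<in> adjoin y" "a * b \<in> adjoin y"
    using adjoinI[of "p - q" y] adjoinI[of "p * q" y] by simp_all
qed

lemma subset_adjoin: "B \<subseteq> adjoin y"
proof
  fix b assume "b \<in> B"
  then show "b \<in> adjoin y"
    using adjoinI[of "[:b:]" y] by simp
qed

lemma generator_mem_adjoin: "y \<in> adjoin y"
  using adjoinI[of "[:0, 1:]" y] by simp

text \<open>
  Multiplying a relation \<open>x = a\<^sub>0 + a\<^sub>1 x\<inverse> + \<dots> + a\<^sub>n x\<inverse>\<^sup>n\<close> by \<open>x\<^sup>n\<close> gives a monic equation for \<open>x\<close>.
\<close>

lemma integral_over_if_mem_adjoin_inverse:
  assumes "x \<in> adjoin (inverse x)"
  shows "integral_over B x"
proof (cases "x = 0")
  case True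
  then show ?thesis
    unfolding integral_over_def
    by (intro exI[of _ "[:0, 1:]"]) (auto simp: coeff_pCons split: nat.splits)
next
  case False
  obtain p where p: "p \<in> polys" "x = poly p (inverse x)"
    using assms by (auto simp: adjoin_def)
  define n where "n = degree p"
  define q where "q = monom 1 (Suc n) - reflect_poly p"
  have deg: "degree (reflect_poly p) < Suc n"
    using degree_reflect_poly_le[of p] by (simp add: n_def)
  have "degree q = Suc n"
    using degree_add_eq_left[of "- reflect_poly p" "monom 1 (Suc n)"] deg
    by (simp add: q_def degree_monom_eq)
  moreover have "coeff (reflect_poly p) (Suc n) = 0"
    using deg by (rule coeff_eq_0)
  ultimately have "lead_coeff q = 1"
    by (simp add: q_def)
  moreover have "poly q x = 0"
    using p False by (simp add: q_def poly_monom poly_reflect_poly_nz n_def)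
  moreover have "q \<in> polys"
    using p by (simp add: q_def)
  ultimately show ?thesis
    unfolding integral_over_def by (intro exI[of _ q]) (simp add: coeff_mem)
qed

end

locale valuation_ring = unital_subring V for V :: "'a :: field set" +
  assumes inverse_mem: "x \<notin> V \<Longrightarrow> inverse x \<in> V"

text \<open>
  A subring that contains \<open>x\<inverse>\<close> and is maximal among those that do not contain \<open>x\<close>.  The element
  \<open>z = x\<inverse>\<close> lies in its Jacobson radical, which is what the argument of Chevalley needs.
\<close>

locale subring_maximal_avoiding = unital_subring V for V :: "'a :: field set" +
  fixes x :: 'a
  assumes avoids: "x \<notin> V" and inverse_x_mem: "inverse x \<in> V"
    and maximal: "\<And>C. unital_subring C \<Longrightarrow> V \<subseteq> C \<Longrightarrow> x \<notin> C \<Longrightarrow> C = V"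
begin

lemma x_nz: "x \<noteq> 0"
  using avoids by auto

lemma mem_adjoin_if_notin:
  assumes "y \<notin> V"
  shows "x \<in> adjoin y"
  using maximal[OF unital_subring_adjoin subset_adjoin, of y] generator_mem_adjoin[of y] assms
  by blast

lemma one_minus_unit:
  assumes b: "b \<in> V"
  shows "inverse (1 - inverse x * b) \<in> V" "1 - inverse x * b \<noteq> 0"
proof -
  define u where "u = 1 - inverse x * b"
  show nz: "1 - inverse x * b \<noteq> 0"
    using avoids b x_nz by (auto simp: field_simps)
  have u: "u \<in> V"
    using b inverse_x_mem by (simp add: u_def)
  show "inverse (1 - inverse x * b) \<in> V"
  proof (rule ccontr)
    assume "\<not> ?thesis"
    then obtain p where p: "p \<in> polys" "x = poly p (inverse u)"
      using mem_adjoin_if_notin[of "inverse u"] by (auto simp: adjoin_def u_def)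
    have "u ^ degree p * x \<in> V"
      using p nz poly_reflect_poly_nz[of u p] poly_mem[of "reflect_poly p" u] u
      by (simp add: u_def)
    \<comment> \<open>Modulo \<open>x\<inverse>\<close> all powers of \<open>u\<close> are \<open>1\<close>, so \<open>x u\<^sup>n \<in> V\<close> would put \<open>x\<close> itself into \<open>V\<close>.\<close>
    moreover have "\<exists>c\<in>V. u ^ n = 1 - inverse x * c" for n
    proof (induction n)
      case 0
      then show ?case by (intro bexI[of _ 0]) simp_all
    next
      case (Suc n)
      then obtain c where c: "c \<in> V" "u ^ n = 1 - inverse x * c"
        by auto
      have "u ^ Suc n = (1 - inverse x * b) * (1 - inverse x * c)"
        by (simp only: c power_Suc) (simp add: u_def)
      also have "\<dots> = 1 - inverse x * (c + b - inverse x * b * c)"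
        by (simp add: algebra_simps)
      finally have "u ^ Suc n = 1 - inverse x * (c + b - inverse x * b * c)" .
      moreover have "c + b - inverse x * b * c \<in> V"
        using b c inverse_x_mem by simp
      ultimately show ?case by blast
    qed
    then obtain c where "c \<in> V" "u ^ degree p = 1 - inverse x * c"
      by blast
    then have "u ^ degree p * x = x - c"
      using x_nz by (simp only:) (simp add: left_diff_distrib)
    ultimately have "(x - c) + c \<in> V"
      using \<open>c \<in> V\<close> by (intro add_mem) simp_all
    then show False
      using avoids by simp
  qed
qed

text \<open>
  Multiplied by \<open>z = x\<inverse>\<close>, the relation in \<open>y\<inverse>\<close> becomes an equation for \<open>1\<close> whose constant term \<open>z b\<close> can
  be moved to the left, because \<open>1 - z b\<close> is a unit.  It thus expresses \<open>y\<^sup>n\<close>, where \<open>n\<close> is the degree of \<open>p\<close>, through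
  lower powers and removes the leading term of \<open>p\<close>.
\<close>

lemma lower_degree_relation:
  assumes y: "y \<noteq> 0" and p: "p \<in> polys" "x = poly p y"
    and q: "q \<in> polys" "x = poly q (inverse y)" and le: "degree q \<le> degree p"
  shows "\<exists>p'\<in>polys. x = poly p' y \<and> degree p' < degree p"
proof -
  define n where "n = degree p"
  obtain b q' where q_eq: "q = pCons b q'"
    by (cases q)
  have b: "b \<in> V" and q': "q' \<in> polys"
    using q by (auto simp: q_eq)
  have "q' \<noteq> 0"
    using q b avoids by (auto simp: q_eq)
  define m where "m = degree q'"
  have m: "m < n"
    using le \<open>q' \<noteq> 0\<close> by (simp add: q_eq m_def n_def)
  define w where "w = inverse (1 - inverse x * b)"
  have w: "w \<in> V" "w * (1 - inverse x * b) = 1"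
    using one_minus_unit[OF b] by (simp_all add: w_def)
  define r where "r = monom 1 (n - 1 - m) * reflect_poly q'"
  have "x = b + inverse y * poly q' (inverse y)"
    using q by (simp add: q_eq)
  then have "x * (1 - inverse x * b) = inverse y * poly q' (inverse y)"
    using x_nz by (simp add: right_diff_distrib mult.assoc[symmetric])
  then have "inverse x * (x * (1 - inverse x * b)) = inverse x * (inverse y * poly q' (inverse y))"
    by simp
  then have "1 - inverse x * b = inverse x * (inverse y * poly q' (inverse y))"
    using x_nz by (simp only: mult.assoc[symmetric]) simp
  then have one: "1 = w * inverse x * (inverse y * poly q' (inverse y))"
    using w(2) by (simp only: mult.assoc)
  have pr: "poly r y = y ^ (n - 1) * poly q' (inverse y)"
    using y m by (simp add: r_def poly_monom poly_reflect_poly_nz m_def[symmetric] power_add[symmetric]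
        mult.assoc[symmetric])
  have "y ^ n = y * y ^ (n - 1)"
    using m by (cases n) simp_all
  also have "\<dots> = y * y ^ (n - 1) * (w * inverse x * (inverse y * poly q' (inverse y)))"
    using one by simp
  also have "\<dots> = y * inverse y * (w * inverse x * poly r y)"
    by (simp only: pr mult_ac)
  finally have yn: "y ^ n = w * inverse x * poly r y"
    using y by simp
  define p' where "p' = p - monom (lead_coeff p) n + smult (lead_coeff p * (w * inverse x)) r"
  have "poly p' y = poly p y"
    by (simp add: p'_def poly_monom yn)
  moreover have "p' \<in> polys"
    using p q' w inverse_x_mem by (simp add: p'_def r_def coeff_mem)
  moreover have "degree p' \<le> n - 1"
    unfolding p'_def
  proof (intro degree_add_le)
    show "degree (p - monom (lead_coeff p) n) \<le> n - 1"
    proof (intro degree_le allI impI)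
      fix i assume "n - 1 < i"
      then show "coeff (p - monom (lead_coeff p) n) i = 0"
        using m by (cases "i = n") (auto simp: n_def intro: coeff_eq_0)
    qed
    have "degree r \<le> (n - 1 - m) + m"
      unfolding r_def m_def
      by (intro order.trans[OF degree_mult_le] add_mono degree_monom_le degree_reflect_poly_le)
    then show "degree (smult (lead_coeff p * (w * inverse x)) r) \<le> n - 1"
      using m by (intro order.trans[OF degree_smult_le]) simp
  qed
  ultimately show ?thesis
    using p m by (intro bexI[of _ p']) (auto simp: n_def)
qed

lemma no_two_relations:
  assumes "y \<noteq> 0" "p \<in> polys" "x = poly p y" "q \<in> polys" "x = poly q (inverse y)"
  shows False
  using assms
proof (induction "degree p + degree q" arbitrary: p q y rule: less_induct)
  case less
  show ?case
  proof (cases "degree q \<le> degree p")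
    case True
    then obtain p' where "p' \<in> polys" "x = poly p' y" "degree p' < degree p"
      using lower_degree_relation[of y p q] less.prems by blast
    then show False
      using less.hyps[of p' q y] less.prems by auto
  next
    case False
    then obtain q' where "q' \<in> polys" "x = poly q' (inverse y)" "degree q' < degree q"
      using lower_degree_relation[of "inverse y" q p] less.prems by auto
    then show False
      using less.hyps[of p q' y] less.prems by auto
  qed
qed

lemma valuation_ring: "valuation_ring V"
proof
  fix y assume y: "y \<notin> V"
  show "inverse y \<in> V"
  proof (rule ccontr)
    assume "inverse y \<notin> V"
    then obtain p q where "p \<in> polys" "x = poly p y" "q \<in> polys" "x = poly q (inverse y)"
      using mem_adjoin_if_notin[of y] mem_adjoin_if_notin[of "inverse y"] y
      unfolding adjoin_def by blast
    moreover have "y \<noteq> 0"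
      using y by auto
    ultimately show False
      by (rule no_two_relations[of y p q, rotated])
  qed
qed

end

text \<open>
  If \<open>x\<close> is not integral over \<open>R\<close>, then \<open>x\<close> is not in \<open>R[x\<inverse>]\<close>.  A subring that is maximal
  among those containing \<open>R[x\<inverse>]\<close> but not \<open>x\<close> exists by the lemma of Zorn, and it is a valuation ring.
\<close>

theorem integral_over_if_in_all_valuation_rings:
  fixes x :: "'a :: field"
  assumes R: "unital_subring R"
    and V: "\<And>V. valuation_ring V \<Longrightarrow> R \<subseteq> V \<Longrightarrow> x \<in> V"
  shows "integral_over R x"
proof (rule ccontr)
  assume not_int: "\<not> integral_over R x"
  interpret unital_subring R by fact
  define R' where "R' = adjoin (inverse x)"
  have R': "unital_subring R'" "R \<subseteq> R'" "inverse x \<in> R'"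
    unfolding R'_def by (rule unital_subring_adjoin subset_adjoin generator_mem_adjoin)+
  have x_notin: "x \<notin> R'"
    using not_int integral_over_if_mem_adjoin_inverse[of x] unfolding R'_def by blast
  define F where "F = {C. unital_subring C \<and> R' \<subseteq> C \<and> x \<notin> C}"
  have "\<exists>M\<in>F. \<forall>D\<in>F. M \<subseteq> D \<longrightarrow> D = M"
  proof (rule subset_Zorn_nonempty)
    show "F \<noteq> {}"
      using R'(1) x_notin unfolding F_def by blast
  next
    fix C assume C: "C \<noteq> {}" "subset.chain F C"
    have sub: "\<And>c. c \<in> C \<Longrightarrow> unital_subring c"
      using C unfolding subset_chain_def F_def by blast
    have two: "\<exists>c\<in>C. a \<in> c \<and> b \<in> c" if ab: "a \<in> \<Union>C" "b \<in> \<Union>C" for a b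
    proof -
      obtain c d where "c \<in> C" "d \<in> C" "a \<in> c" "b \<in> d"
        using ab by blast
      moreover from this C have "c \<subseteq> d \<or> d \<subseteq> c"
        by (simp add: subset_chain_def)
      ultimately show ?thesis by blast
    qed
    have "unital_subring (\<Union>C)"
    proof
      show "1 \<in> \<Union>C"
        using C(1) unital_subring.one_mem[OF sub] by (meson UnionI all_not_in_conv)
    next
      fix a b assume "a \<in> \<Union>C" "b \<in> \<Union>C"
      then obtain c where c: "c \<in> C" "a \<in> c" "b \<in> c"
        using two[of a b] by blast
      then have "a - b \<in> c" "a * b \<in> c"
        using unital_subring.diff_mem[OF sub[OF c(1)]] unital_subring.mult_mem[OF sub[OF c(1)]]
        by simp_all
      with c(1) show "a - b \<in> \<Union>C" "a * b \<in> \<Union>C"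
        by (metis UnionI)+
    qed
    moreover have "R' \<subseteq> \<Union>C" "x \<notin> \<Union>C"
      using C unfolding F_def subset_chain_def by blast+
    ultimately show "\<Union>C \<in> F"
      unfolding F_def by blast
  qed
  then obtain M where M: "M \<in> F" and max: "\<And>D. D \<in> F \<Longrightarrow> M \<subseteq> D \<Longrightarrow> D = M"
    by blast
  then have M': "unital_subring M" "R' \<subseteq> M" "x \<notin> M"
    unfolding F_def by blast+
  have "subring_maximal_avoiding M x"
    unfolding subring_maximal_avoiding_def subring_maximal_avoiding_axioms_def
  proof (intro conjI allI impI)
    show "unital_subring M" "x \<notin> M" "inverse x \<in> M"
      using M' R' by blast+
    show "C = M" if "unital_subring C" "M \<subseteq> C" "x \<notin> C" for C
    proof (rule max)
      show "C \<in> F"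
        unfolding F_def using that M' by blast
    qed (fact that)
  qed
  then have "valuation_ring M"
    by (rule subring_maximal_avoiding.valuation_ring)
  moreover have "R \<subseteq> M"
    using R'(2) M'(2) by (rule subset_trans)
  ultimately have "x \<in> M"
    by (rule V)
  then show False
    using M'(3) by contradiction
qed

section \<open>Simplices over a valuation ring\<close>

text \<open>
  The Heron form: sixteen times the squared area of a triangle whose squared sides are \<open>x\<close>, \<open>y\<close>, \<open>z\<close>.
  It occurs in two roles, applied to squared lengths and applied to squared areas.
\<close>

definition heron3 :: "'a :: comm_ring_1 \<Rightarrow> 'a \<Rightarrow> 'a \<Rightarrow> 'a" where
  "heron3 x y z = 2 * x * y + 2 * y * z + 2 * z * x - x\<^sup>2 - y\<^sup>2 - z\<^sup>2"

context unital_subring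
begin

lemma of_nat_mem [simp]: "of_nat n \<in> B"
  by (induction n) simp_all

lemma numeral_mem [simp]: "numeral n \<in> B"
  using of_nat_mem[of "numeral n"] by simp

lemma heron3_mem: "x \<in> B \<Longrightarrow> y \<in> B \<Longrightarrow> z \<in> B \<Longrightarrow> heron3 x y z \<in> B"
  by (simp add: heron3_def)

text \<open>
  The Heron form is quadratic, so its values at two finite points differ by a combination of the three
  coordinate differences with finite coefficients.  If \<open>E\<close> is infinite, the assumptions say that the points agree up to
  an error of order \<open>1 / E\<close>.
\<close>

lemma heron3_perturb:
  assumes mem: "x' \<in> B" "y' \<in> B" "z' \<in> B" "x \<in> B" "y \<in> B" "z \<in> B"
    and close: "E * (x' - x) \<in> B" "E * (y' - y) \<in> B" "E * (z' - z) \<in> B"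
    and zero: "heron3 x y z = 0"
  shows "E * heron3 x' y' z' \<in> B"
proof -
  have "heron3 x' y' z' - heron3 x y z
      = (x' - x) * (- (x' + x) + (y' + y) + (z' + z)) + (y' - y) * ((x' + x) - (y' + y) + (z' + z))
      + (z' - z) * ((x' + x) + (y' + y) - (z' + z))"
    unfolding heron3_def by (simp add: algebra_simps power2_eq_square)
  then have "E * (heron3 x' y' z' - heron3 x y z)
      = E * (x' - x) * (- (x' + x) + (y' + y) + (z' + z)) + E * (y' - y) * ((x' + x) - (y' + y) + (z' + z))
      + E * (z' - z) * ((x' + x) + (y' + y) - (z' + z))"
    by (simp only: distrib_left mult.assoc)
  then show ?thesis
    using mem close zero by simp
qed

end

lemma heron3_scaled_squares: "heron3 (n * r\<^sup>2) (n * s\<^sup>2) (n * (r + s)\<^sup>2) = 0"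
  for n :: "'a :: comm_ring_1"
  unfolding heron3_def by (simp add: algebra_simps power2_eq_square)

context valuation_ring
begin

text \<open>
  A valuation ring is local, so \<open>t\<close> and \<open>1 - t\<close> cannot both be non-units.
\<close>

lemma unit_or_unit_complement:
  assumes "t \<in> V"
  shows "(t \<noteq> 0 \<and> inverse t \<in> V) \<or> (1 - t \<noteq> 0 \<and> inverse (1 - t) \<in> V)"
proof (cases "t = 0 \<or> t = 1")
  case True
  then show ?thesis by auto
next
  case False
  show ?thesis
  proof (cases "t / (1 - t) \<in> V")
    case True
    moreover have "inverse (1 - t) = 1 + t / (1 - t)"
      using False by (simp add: field_simps)
    ultimately have "inverse (1 - t) \<in> V"
      by simp
    then show ?thesis
      using False by simp
  next
    assume "t / (1 - t) \<notin> V"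
    then have "inverse (t / (1 - t)) \<in> V"
      by (rule inverse_mem)
    moreover have "inverse t = 1 + inverse (t / (1 - t))"
      using False by (simp add: field_simps)
    ultimately have "inverse t \<in> V"
      by simp
    then show ?thesis
      using False by simp
  qed
qed

lemma mult_left_unit_mem:
  assumes "u * x \<in> V" "u \<noteq> 0" "inverse u \<in> V"
  shows "x \<in> V"
proof -
  have "inverse u * (u * x) \<in> V"
    using assms by simp
  then show ?thesis
    using assms(2) by (simp add: mult.assoc[symmetric])
qed

lemma dvd_total: "(\<exists>r\<in>V. x = r * y) \<or> (\<exists>r\<in>V. y = r * x)"
proof (cases "x = 0 \<or> y = 0")
  case True
  then show ?thesis
    using zero_mem by (metis mult_zero_left)
next
  case False
  then have "x = x / y * y" "y = inverse (x / y) * x"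
    by (simp_all add: field_simps)
  then show ?thesis
    using inverse_mem[of "x / y"] by blast
qed

end

text \<open>
  A simplex with vertices \<open>p\<close>, \<open>o\<close>, \<open>0\<close>, \<open>1\<close>, \<open>2\<close>, seen from its longest edge \<open>po\<close> of squared length \<open>\<sigma>\<close>.
  The vertex \<open>k\<close> projects to the point of the line \<open>po\<close> with coordinate \<open>t\<^sub>k\<close>, where \<open>p\<close> is at \<open>0\<close> and \<open>o\<close>
  at \<open>1\<close>.  The matrix with diagonal \<open>n\<^sub>0, n\<^sub>1, n\<^sub>2\<close> and entries \<open>c\<close>, \<open>b\<close>, \<open>a\<close> in the places \<open>01\<close>, \<open>02\<close>, \<open>12\<close> is \<open>\<sigma>\<close>
  times the Gram matrix of the components orthogonal to \<open>po\<close>, and \<open>w = 1 / \<sigma>\<^sup>2\<close>.  In these coordinates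
  \<open>n\<^sub>k\<close>, \<open>P01\<close>, \<open>O01\<close>, \<open>F012\<close> are four times the squared areas of the triangles \<open>pok\<close>, \<open>p01\<close>, \<open>o01\<close>, \<open>012\<close>, and \<open>vol\<close>
  is \<open>576 W\<close>.
\<close>

locale simplex_in_valuation_ring = valuation_ring V for V :: "'a :: field set" +
  fixes n0 n1 n2 a b c t0 t1 t2 w :: 'a
  assumes half: "inverse 2 \<in> V" and third: "inverse 3 \<in> V"
    and two_nz: "(2 :: 'a) \<noteq> 0" and three_nz: "(3 :: 'a) \<noteq> 0"
    and n_mem [simp]: "n0 \<in> V" "n1 \<in> V" "n2 \<in> V"
    and t_mem [simp]: "t0 \<in> V" "t1 \<in> V" "t2 \<in> V"
    and w_mem [simp]: "w \<in> V" "a * w \<in> V" "b * w \<in> V" "c * w \<in> V"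
begin

definition "P01 = t0\<^sup>2 * n1 + t1\<^sup>2 * n0 - 2 * t0 * t1 * c + (n0 * n1 - c\<^sup>2) * w"
definition "P02 = t0\<^sup>2 * n2 + t2\<^sup>2 * n0 - 2 * t0 * t2 * b + (n0 * n2 - b\<^sup>2) * w"
definition "P12 = t1\<^sup>2 * n2 + t2\<^sup>2 * n1 - 2 * t1 * t2 * a + (n1 * n2 - a\<^sup>2) * w"
definition "O01 = (1 - t0)\<^sup>2 * n1 + (1 - t1)\<^sup>2 * n0 - 2 * (1 - t0) * (1 - t1) * c + (n0 * n1 - c\<^sup>2) * w"
definition "O02 = (1 - t0)\<^sup>2 * n2 + (1 - t2)\<^sup>2 * n0 - 2 * (1 - t0) * (1 - t2) * b + (n0 * n2 - b\<^sup>2) * w"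
definition "O12 = (1 - t1)\<^sup>2 * n2 + (1 - t2)\<^sup>2 * n1 - 2 * (1 - t1) * (1 - t2) * a + (n1 * n2 - a\<^sup>2) * w"
definition "F012 = (t2 - t1)\<^sup>2 * n0 + (t0 - t2)\<^sup>2 * n1 + (t1 - t0)\<^sup>2 * n2
  + 2 * ((t2 - t1) * (t0 - t2) * c + (t2 - t1) * (t1 - t0) * b + (t0 - t2) * (t1 - t0) * a)
  + ((n0 * n1 - c\<^sup>2) + (n0 * n2 - b\<^sup>2) + (n1 * n2 - a\<^sup>2)
     + 2 * (c * a - n1 * b) + 2 * (a * b - n2 * c) + 2 * (b * c - n0 * a)) * w"
definition "vol = (n0 * n1 * n2 + 2 * a * b * c - n0 * a\<^sup>2 - n1 * b\<^sup>2 - n2 * c\<^sup>2) * w"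

text \<open>
  The terms of second order in the off-diagonal entry \<open>g\<close> are the same in the areas of \<open>pkl\<close> and \<open>okl\<close>; the
  difference of the two areas is therefore linear in \<open>g\<close>.
\<close>

lemma pair_bounds:
  assumes "n \<in> V" "n' \<in> V" "t \<in> V" "t' \<in> V" "g * w \<in> V"
    and P: "t\<^sup>2 * n' + t'\<^sup>2 * n - 2 * t * t' * g + (n * n' - g\<^sup>2) * w \<in> V" (is "?P \<in> V")
    and O: "(1 - t)\<^sup>2 * n' + (1 - t')\<^sup>2 * n - 2 * (1 - t) * (1 - t') * g + (n * n' - g\<^sup>2) * w \<in> V"
      (is "?O \<in> V")
  shows "g * (2 * t * t' + g * w) \<in> V" "g * (t + t' - 1) \<in> V"
proof -
  define p q where pq: "p = ?P" "q = ?O"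
  have pq_mem [simp]: "p \<in> V" "q \<in> V"
    using P O by (simp_all only: pq)
  have "g * (2 * t * t' + g * w) = t\<^sup>2 * n' + t'\<^sup>2 * n + n * n' * w - p"
    unfolding pq by (simp add: algebra_simps power2_eq_square)
  also have "\<dots> \<in> V"
    using assms by simp
  finally show "g * (2 * t * t' + g * w) \<in> V" .
  have "2 * (g * (t + t' - 1)) = q - p - (1 - 2 * t) * n' - (1 - 2 * t') * n"
    unfolding pq by (simp add: algebra_simps power2_eq_square)
  also have "\<dots> \<in> V"
    using assms by simp
  finally show "g * (t + t' - 1) \<in> V"
    using two_nz half by (rule mult_left_unit_mem)
qed

text \<open>
  The bounds for \<open>c\<close> from the triangles \<open>p01\<close> and \<open>o01\<close> reduce \<open>F012\<close> to \<open>2 c t\<^sub>2 (1 - t\<^sub>2)\<close>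
  up to finite terms.  If \<open>c\<close> is infinite, the vertex \<open>2\<close> is therefore near \<open>p\<close> or near \<open>o\<close>.
\<close>

lemma third_vertex:
  assumes a: "a \<in> V" and \<beta>: "b = \<beta> * c" "\<beta> \<in> V"
    and bg: "b * (c * w) \<in> V" and bt: "b * (t2 - t1) \<in> V"
    and K: "c * (2 * t0 * t1 + c * w) \<in> V" and L: "c * (t0 + t1 - 1) \<in> V"
    and F: "F012 \<in> V"
  shows "c * t2 \<in> V \<or> c * (1 - t2) \<in> V"
proof -
  have "2 * (c * t2 * (1 - t2)) = F012 - ((t2 - t1)\<^sup>2 * n0 + (t0 - t2)\<^sup>2 * n1 + (t1 - t0)\<^sup>2 * n2)
      + c * (2 * t0 * t1 + c * w) - 2 * t2 * (c * (t0 + t1 - 1)) - 2 * (t1 - t0) * (b * (t2 - t1))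
      - 2 * ((t0 - t2) * (t1 - t0)) * a - w * (n0 * n1 + n0 * n2 + n1 * n2 - a\<^sup>2)
      + \<beta> * (b * (c * w)) - 2 * (a * (c * w) - n1 * (b * w)) - 2 * (a * (b * w) - n2 * (c * w))
      - 2 * (b * (c * w)) + 2 * n0 * (a * w)"
    unfolding F012_def unfolding \<beta>(1) by (simp add: algebra_simps power2_eq_square)
  also have "\<dots> \<in> V"
    using a \<beta>(2) bg bt K L F by simp
  finally have *: "c * t2 * (1 - t2) \<in> V"
    using two_nz half by (rule mult_left_unit_mem)
  from unit_or_unit_complement[OF t_mem(3)] show ?thesis
  proof (elim disjE conjE)
    assume "t2 \<noteq> 0" "inverse t2 \<in> V"
    then have "c * (1 - t2) \<in> V"
      using * mult_left_unit_mem[of t2 "c * (1 - t2)"] by (simp add: mult_ac)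
    then show ?thesis ..
  next
    assume "1 - t2 \<noteq> 0" "inverse (1 - t2) \<in> V"
    then have "c * t2 \<in> V"
      using * mult_left_unit_mem[of "1 - t2" "c * t2"] by (simp add: mult_ac)
    then show ?thesis ..
  qed
qed

text \<open>
  The vertex \<open>2\<close> near \<open>p\<close>; with \<open>1 - t\<^sub>k\<close> in place of \<open>r\<^sub>k\<close> this is also the case of \<open>2\<close> near \<open>o\<close>.  Up to finite
  terms the volume is a multiple of \<open>E = c\<^sup>2 w\<close>, and up to an error of order \<open>1 / E\<close> the squared areas on the edge \<open>p2\<close> are in the
  proportion \<open>1 : r\<^sub>0\<^sup>2 : (1 - r\<^sub>0)\<^sup>2\<close>, where the Heron form vanishes.
\<close>

lemma vol_isolated_pair:
  assumes a: "a \<in> V" and \<beta>: "b = \<beta> * c" "\<beta> \<in> V" and bg: "b * (c * w) \<in> V"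
    and t: "r0 \<in> V" "r1 \<in> V" "r2 \<in> V"
    and L: "c * (r0 + r1 - 1) \<in> V" and T: "c * r2 \<in> V"
    and mem: "p \<in> V" "q \<in> V"
    and p: "p = r0\<^sup>2 * n2 + r2\<^sup>2 * n0 - 2 * r0 * r2 * b + (n0 * n2 - b\<^sup>2) * w"
    and q: "q = r1\<^sup>2 * n2 + r2\<^sup>2 * n1 - 2 * r1 * r2 * a + (n1 * n2 - a\<^sup>2) * w"
  shows "vol * heron3 n2 p q \<in> V"
proof -
  define E where "E = c * (c * w)"
  have "E * (p - r0\<^sup>2 * n2) = (c * w) * (c * r2) * r2 * n0 - 2 * r0 * (c * r2) * (b * (c * w))
      + n0 * n2 * (c * w) * (c * w) - (b * (c * w)) * (b * (c * w))"
    unfolding E_def p by (simp add: algebra_simps power2_eq_square)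
  also have "\<dots> \<in> V"
    using assms by simp
  finally have Ep: "E * (p - r0\<^sup>2 * n2) \<in> V" .
  have "E * (q - (1 - r0)\<^sup>2 * n2) = (c * w) * (c * (r0 + r1 - 1)) * (r1 + 1 - r0) * n2
      + (c * w) * (c * r2) * r2 * n1 - 2 * r1 * (c * w) * (c * r2) * a
      + (n1 * n2 - a\<^sup>2) * (c * w) * (c * w)"
    unfolding E_def q by (simp add: algebra_simps power2_eq_square)
  also have "\<dots> \<in> V"
    using assms by simp
  finally have Eq: "E * (q - (1 - r0)\<^sup>2 * n2) \<in> V" .
  have "heron3 n2 (r0\<^sup>2 * n2) ((1 - r0)\<^sup>2 * n2) = 0"
    unfolding heron3_def by (simp add: algebra_simps power2_eq_square)
  then have EH: "E * heron3 n2 p q \<in> V"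
    using heron3_perturb[OF n_mem(3) mem n_mem(3) _ _ _ Ep Eq] t by simp
  have "vol = (n0 * n1 * n2) * w + 2 * a * (b * (c * w)) - n0 * a * (a * w)
      - n1 * \<beta> * (b * (c * w)) - n2 * E"
    unfolding vol_def E_def unfolding \<beta>(1) by (simp add: algebra_simps power2_eq_square)
  then have "vol * heron3 n2 p q = ((n0 * n1 * n2) * w + 2 * a * (b * (c * w)) - n0 * a * (a * w)
      - n1 * \<beta> * (b * (c * w))) * heron3 n2 p q - n2 * (E * heron3 n2 p q)"
    by (simp only: left_diff_distrib mult.assoc)
  also have "\<dots> \<in> V"
    using assms EH by (simp add: heron3_mem)
  finally show ?thesis .
qed

text \<open>
  The vertices \<open>1\<close> and \<open>2\<close> near each other.  Again the volume is a multiple of \<open>E = c\<^sup>2 w\<close> up to finite terms.  The number \<open>n\<close> is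
  \<open>\<sigma>\<close> times the squared distance between the two projections, and the squared areas on the edge \<open>12\<close> are in
  the proportion \<open>t\<^sub>1\<^sup>2 : (1 - t\<^sub>1)\<^sup>2 : 1\<close> up to an error of order \<open>1 / E\<close>.
\<close>

lemma vol_close_pair:
  assumes a: "a \<in> V" and \<beta>: "b = \<beta> * c" "\<beta> \<in> V"
    and F: "c * (c * w) * (1 - \<beta>) \<in> V" and G: "c * (t2 - t1) \<in> V"
    and K: "c * (2 * t0 * t1 + c * w) \<in> V" and L: "c * (t0 + t1 - 1) \<in> V"
    and mem: "P12 \<in> V" "O12 \<in> V" "F012 \<in> V"
  shows "vol * heron3 P12 O12 F012 \<in> V"
proof -
  define E where "E = c * (c * w)"
  define n where "n = n1 + n2 - 2 * a"
  have n: "n \<in> V"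
    using a by (simp add: n_def)
  have "E * (P12 - n * t1\<^sup>2) = (c * w) * (c * (t2 - t1)) * (t2 + t1) * n1
      - 2 * t1 * a * (c * w) * (c * (t2 - t1)) + (n1 * n2 - a\<^sup>2) * (c * w) * (c * w)"
    unfolding E_def P12_def n_def by (simp add: algebra_simps power2_eq_square)
  also have "\<dots> \<in> V"
    using assms by simp
  finally have EP: "E * (P12 - n * t1\<^sup>2) \<in> V" .
  have "E * (O12 - n * (1 - t1)\<^sup>2) = - (c * w) * (c * (t2 - t1)) * (2 - t2 - t1) * n1
      + 2 * (1 - t1) * a * (c * w) * (c * (t2 - t1)) + (n1 * n2 - a\<^sup>2) * (c * w) * (c * w)"
    unfolding E_def O12_def n_def by (simp add: algebra_simps power2_eq_square)
  also have "\<dots> \<in> V"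
    using assms by simp
  finally have EO: "E * (O12 - n * (1 - t1)\<^sup>2) \<in> V" .
  have "E * (F012 - n) = (c * w) * (c * (t2 - t1)) * ((t2 - t1) * n0)
      + (c * w) * (c * (t2 - t1)) * ((t2 - t1 + 2 * (t1 - t0)) * n1 - 2 * (t1 - t0) * a)
      - 2 * (c * (t2 - t1)) * ((c * w) * (c * (t2 - t1)) + (t1 - t0) * (c * (c * w) * (1 - \<beta>)))
      - (c * (c * w) * (1 - \<beta>))\<^sup>2 + (c * w) * (c * (c * w) * (1 - \<beta>)) * (2 * n1 - 2 * a)
      + (c * w) * (c * w) * (n0 * n1 + n0 * n2 + n1 * n2 - a\<^sup>2 - 2 * n0 * a)
      + n * ((c * w) * (c * (t0 + t1 - 1)) * (t0 + t1 + 1)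
        - 2 * (c * w) * (c * (2 * t0 * t1 + c * w)))"
    unfolding E_def F012_def n_def unfolding \<beta>(1) by (simp add: algebra_simps power2_eq_square)
  also have "\<dots> \<in> V"
    using assms n by simp
  finally have EF: "E * (F012 - n) \<in> V" .
  have "heron3 (n * t1\<^sup>2) (n * (1 - t1)\<^sup>2) n = 0"
    using heron3_scaled_squares[of n t1 "1 - t1"] by simp
  then have EH: "E * heron3 P12 O12 F012 \<in> V"
    using heron3_perturb[OF mem _ _ n EP EO EF] n by simp
  have "vol = (n0 * n1 * n2) * w - n0 * a * (a * w)
      + (c * (c * w) * (1 - \<beta>)) * (n1 * (1 + \<beta>) - 2 * a) - n * E"
    unfolding vol_def E_def n_def unfolding \<beta>(1) by (simp add: algebra_simps power2_eq_square)
  then have "vol * heron3 P12 O12 F012 = ((n0 * n1 * n2) * w - n0 * a * (a * w)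
      + (c * (c * w) * (1 - \<beta>)) * (n1 * (1 + \<beta>) - 2 * a)) * heron3 P12 O12 F012
      - n * (E * heron3 P12 O12 F012)"
    by (simp only: left_diff_distrib mult.assoc)
  also have "\<dots> \<in> V"
    using assms EH n by (simp add: heron3_mem)
  finally show ?thesis .
qed

text \<open>
  Suppose that the smallest of the three off-diagonal entries is infinite.  Modulo its inverse \<open>u\<close> the
  triangles at \<open>p\<close> and \<open>o\<close> force \<open>t\<^sub>0 = t\<^sub>1 = t\<^sub>2 = 1 / 2\<close> and \<open>a w = b w = c w = - 1 / 2\<close>.  Then \<open>w F012\<close>
  is \<open>heron3 (- 1 / 2) (- 1 / 2) (- 1 / 2) = 3 / 4\<close> modulo \<open>u\<close>.  This is a unit, whereas \<open>w\<close> is divisible by \<open>u\<close>.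
\<close>

lemma not_all_infinite:
  assumes \<alpha>: "a = \<alpha> * b" "\<alpha> \<in> V" and \<beta>: "b = \<beta> * c" "\<beta> \<in> V"
    and mem: "P01 \<in> V" "P02 \<in> V" "P12 \<in> V" "O01 \<in> V" "O02 \<in> V" "O12 \<in> V" "F012 \<in> V"
  shows "a \<in> V"
proof (rule ccontr)
  assume a: "a \<notin> V"
  define u where "u = inverse a"
  have "a \<noteq> 0"
    using a by auto
  then have ua: "u * a = 1"
    by (simp add: u_def)
  then have ub: "u * \<alpha> * b = 1"
    by (simp only: \<alpha>(1) mult.assoc)
  then have uc: "u * \<alpha> * \<beta> * c = 1"
    by (simp only: \<beta>(1) mult.assoc)
  have u: "u \<in> V"
    using inverse_mem[OF a] by (simp add: u_def)
  define Kc Kb Ka Lc Lb La where defs: "Kc = c * (2 * t0 * t1 + c * w)"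
    "Kb = b * (2 * t0 * t2 + b * w)" "Ka = a * (2 * t1 * t2 + a * w)"
    "Lc = c * (t0 + t1 - 1)" "Lb = b * (t0 + t2 - 1)" "La = a * (t1 + t2 - 1)"
  have KL [simp]: "Kc \<in> V" "Kb \<in> V" "Ka \<in> V" "Lc \<in> V" "Lb \<in> V" "La \<in> V"
    using pair_bounds[OF n_mem(1,2) t_mem(1,2) w_mem(4)] pair_bounds[OF n_mem(1,3) t_mem(1,3) w_mem(3)]
      pair_bounds[OF n_mem(2,3) t_mem(2,3) w_mem(2)] mem
    by (simp_all add: defs P01_def P02_def P12_def O01_def O02_def O12_def)
  define h :: 'a where "h = inverse 2"
  have h [simp]: "h \<in> V" "2 * h = 1"
    using half two_nz by (simp_all add: h_def)
  define v0 v1 v2 where v_def: "v0 = h * (\<alpha> * \<beta> * Lc + \<alpha> * Lb - La)"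
    "v1 = h * (\<alpha> * \<beta> * Lc + La - \<alpha> * Lb)" "v2 = h * (\<alpha> * Lb + La - \<alpha> * \<beta> * Lc)"
  have v [simp]: "v0 \<in> V" "v1 \<in> V" "v2 \<in> V"
    using \<alpha> \<beta> by (simp_all add: v_def)
  have e: "t0 + t1 - 1 = u * (\<alpha> * \<beta> * Lc)" "t0 + t2 - 1 = u * (\<alpha> * Lb)" "t1 + t2 - 1 = u * La"
    using ua ub uc unfolding defs by Groebner_Basis.algebra+
  have t: "t0 = h + u * v0" "t1 = h + u * v1" "t2 = h + u * v2"
    using e h(2) unfolding v_def by Groebner_Basis.algebra+
  define g k l where gkl_def: "g = \<alpha> * \<beta> * Kc - v0 - v1 - 2 * u * v0 * v1"
    "k = \<alpha> * Kb - v0 - v2 - 2 * u * v0 * v2" "l = Ka - v1 - v2 - 2 * u * v1 * v2"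
  have gkl [simp]: "g \<in> V" "k \<in> V" "l \<in> V"
    using \<alpha> \<beta> u by (simp_all add: gkl_def)
  have "c * w = u * (\<alpha> * \<beta> * Kc) - 2 * t0 * t1" "b * w = u * (\<alpha> * Kb) - 2 * t0 * t2"
    "a * w = u * Ka - 2 * t1 * t2"
    using ua ub uc unfolding defs by Groebner_Basis.algebra+
  then have s: "c * w = u * g - h" "b * w = u * k - h" "a * w = u * l - h"
    using h(2) unfolding gkl_def t by Groebner_Basis.algebra+
  define m where "m = \<alpha> * \<beta> * (c * w)"
  have m [simp]: "m \<in> V" and w: "w = u * m"
    using \<alpha> \<beta> uc by (simp_all add: m_def mult_ac)
  have "heron3 (c * w) (b * w) (a * w)
      = w * F012 - w * ((t2 - t1)\<^sup>2 * n0 + (t0 - t2)\<^sup>2 * n1 + (t1 - t0)\<^sup>2 * n2)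
        - 2 * ((t2 - t1) * (t0 - t2) * (c * w) + (t2 - t1) * (t1 - t0) * (b * w)
          + (t0 - t2) * (t1 - t0) * (a * w))
        - w * (w * (n0 * n1 + n0 * n2 + n1 * n2) - 2 * n1 * (b * w) - 2 * n2 * (c * w) - 2 * n0 * (a * w))"
    unfolding heron3_def F012_def by (simp add: algebra_simps power2_eq_square)
  also have "\<dots> = u * (m * F012 - m * ((t2 - t1)\<^sup>2 * n0 + (t0 - t2)\<^sup>2 * n1 + (t1 - t0)\<^sup>2 * n2)
        - 2 * ((v2 - v1) * (t0 - t2) * (c * w) + (v2 - v1) * (t1 - t0) * (b * w)
          + (v0 - v2) * (t1 - t0) * (a * w))
        - m * (w * (n0 * n1 + n0 * n2 + n1 * n2) - 2 * n1 * (b * w) - 2 * n2 * (c * w) - 2 * n0 * (a * w)))"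
    (is "_ = u * ?R")
  proof -
    have d: "t2 - t1 = u * (v2 - v1)" "t0 - t2 = u * (v0 - v2)"
      by (simp_all add: t algebra_simps)
    have "(t2 - t1) * (t0 - t2) * (c * w) = u * ((v2 - v1) * (t0 - t2) * (c * w))"
      "(t2 - t1) * (t1 - t0) * (b * w) = u * ((v2 - v1) * (t1 - t0) * (b * w))"
      by (simp_all only: d(1) mult.assoc)
    moreover have "(t0 - t2) * (t1 - t0) * (a * w) = u * ((v0 - v2) * (t1 - t0) * (a * w))"
      by (simp only: d(2) mult.assoc)
    moreover have "w * x = u * (m * x)" for x
      by (simp only: w mult.assoc)
    moreover have "u * p - u * q - 2 * (u * r1 + u * r2 + u * r3) - u * s
        = u * (p - q - 2 * (r1 + r2 + r3) - s)" for p q r1 r2 r3 s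
      by (simp add: algebra_simps)
    ultimately show ?thesis
      by (simp only:)
  qed
  finally have R: "heron3 (c * w) (b * w) (a * w) = u * ?R" .
  have R_mem: "?R \<in> V"
    using mem by simp
  have "heron3 (c * w) (b * w) (a * w) = 3 * h * h
      + u * (g * (k * u + l * u - g * u - 2 * h) + k * (g * u + l * u - k * u - 2 * h)
        + l * (g * u + k * u - l * u - 2 * h))" (is "_ = _ + u * ?S")
    unfolding s heron3_def by (simp add: algebra_simps power2_eq_square)
  moreover define D where "D = ?R - ?S"
  ultimately have "3 * h * h = u * D"
    using R by (simp add: right_diff_distrib)
  then have "4 * (3 * h * h) * a = 4 * D * (u * a)"
    by (simp only: mult_ac)
  then have "4 * (3 * h * h) * a = 4 * D"
    by (simp add: ua)
  moreover have "4 * (3 * h * h) * a = 3 * a"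
    using h(2) by Groebner_Basis.algebra
  moreover have "?S \<in> V"
    using u by simp
  then have D: "D \<in> V"
    using R_mem by (simp add: D_def)
  ultimately have "3 * a \<in> V"
    using mult_mem[OF numeral_mem D] by metis
  then show False
    using a mult_left_unit_mem[of 3 a] third three_nz by simp
qed

text \<open>
  With \<open>c\<close> the largest and \<open>a\<close> the smallest of the three entries, \<open>a\<close> is finite, and the ratio \<open>\<beta> = b / c\<close>
  decides: if \<open>1 - \<beta>\<close> is a unit, then the vertex \<open>2\<close> is near an end of the long edge; if \<open>\<beta>\<close> is a unit, then \<open>1\<close> and \<open>2\<close>
  are near each other.
\<close>

theorem vol_bounded:
  assumes order: "\<exists>r\<in>V. a = r * b" "\<exists>r\<in>V. b = r * c"
    and mem: "P01 \<in> V" "P02 \<in> V" "P12 \<in> V" "O01 \<in> V" "O02 \<in> V" "O12 \<in> V" "F012 \<in> V"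
  shows "vol \<in> V \<or> vol * heron3 n2 P02 P12 \<in> V \<or> vol * heron3 n2 O02 O12 \<in> V
    \<or> vol * heron3 P12 O12 F012 \<in> V"
proof -
  obtain \<alpha> \<beta> where \<alpha>: "a = \<alpha> * b" "\<alpha> \<in> V" and \<beta>: "b = \<beta> * c" "\<beta> \<in> V"
    using order by auto
  have a: "a \<in> V"
    using not_all_infinite[OF \<alpha> \<beta> mem] .
  have Kc: "c * (2 * t0 * t1 + c * w) \<in> V" and Lc: "c * (t0 + t1 - 1) \<in> V"
    using pair_bounds[OF n_mem(1,2) t_mem(1,2) w_mem(4)] mem
    by (simp_all add: P01_def O01_def)
  have Kb: "b * (2 * t0 * t2 + b * w) \<in> V" and Lb: "b * (t0 + t2 - 1) \<in> V"
    using pair_bounds[OF n_mem(1,3) t_mem(1,3) w_mem(3)] mem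
    by (simp_all add: P02_def O02_def)
  have "b * (t2 - t1) = b * (t0 + t2 - 1) - \<beta> * (c * (t0 + t1 - 1))"
    unfolding \<beta>(1) by (simp add: algebra_simps)
  then have bt: "b * (t2 - t1) \<in> V"
    using Lb Lc \<beta>(2) by simp
  have "(1 - \<beta>) * (b * (c * w))
      = \<beta> * (c * (2 * t0 * t1 + c * w)) - b * (2 * t0 * t2 + b * w) + 2 * t0 * (b * (t2 - t1))"
    unfolding \<beta>(1) by (simp add: algebra_simps)
  then have bg: "(1 - \<beta>) * (b * (c * w)) \<in> V"
    using Kc Kb bt \<beta>(2) by simp
  from unit_or_unit_complement[OF \<beta>(2)] show ?thesis
  proof (elim disjE conjE)
    assume unit: "\<beta> \<noteq> 0" "inverse \<beta> \<in> V"
    have "\<beta> * (c * (c * w) * (1 - \<beta>)) \<in> V" "\<beta> * (c * (t2 - t1)) \<in> V"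
      using bg bt unfolding \<beta>(1) by (simp_all add: mult_ac)
    then have "c * (c * w) * (1 - \<beta>) \<in> V" "c * (t2 - t1) \<in> V"
      using unit by (blast intro: mult_left_unit_mem)+
    then show ?thesis
      using vol_close_pair[OF a \<beta> _ _ Kc Lc] mem by blast
  next
    assume unit: "1 - \<beta> \<noteq> 0" "inverse (1 - \<beta>) \<in> V"
    then have bg': "b * (c * w) \<in> V"
      using bg by (blast intro: mult_left_unit_mem)
    from third_vertex[OF a \<beta> bg' bt Kc Lc mem(7)] show ?thesis
    proof
      assume "c * t2 \<in> V"
      then show ?thesis
        using vol_isolated_pair[OF a \<beta> bg' t_mem Lc _ mem(2,3)] by (simp add: P02_def P12_def)
    next
      assume "c * (1 - t2) \<in> V"
      moreover have "c * ((1 - t0) + (1 - t1) - 1) = - (c * (t0 + t1 - 1))"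
        by (simp add: algebra_simps)
      ultimately show ?thesis
        using vol_isolated_pair[OF a \<beta> bg', of "1 - t0" "1 - t1" "1 - t2" O02 O12] mem Lc
        by (simp add: O02_def O12_def)
    qed
  qed
qed

end

section \<open>Areas and volume of a 4-simplex\<close>

text \<open>
  The Heron form as a symmetric function of a family, which makes areas and the factors of \<open>Q\<close>
  independent of the order of the vertices.
\<close>

definition hero :: "('b \<Rightarrow> 'a :: comm_ring_1) \<Rightarrow> 'b set \<Rightarrow> 'a" where
  "hero f I = (\<Sum>i\<in>I. f i)\<^sup>2 - 2 * (\<Sum>i\<in>I. (f i)\<^sup>2)"

lemma hero_three: "distinct [x, y, z] \<Longrightarrow> hero f {x, y, z} = heron3 (f x) (f y) (f z)"
  by (simp add: hero_def heron3_def algebra_simps power2_eq_square)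

text \<open>
  Lengths are functions of two-element sets; \<open>T - {v}\<close> is the side of the triangle \<open>T\<close> opposite to \<open>v\<close>.
\<close>

definition sqarea :: "(nat set \<Rightarrow> 'a :: field) \<Rightarrow> nat set \<Rightarrow> 'a" where
  "sqarea L T = hero (\<lambda>v. L (T - {v})) T / 16"

lemma sqarea_three:
  assumes "distinct [i, j, k]"
  shows "sqarea L {i, j, k} = heron3 (L {i, j}) (L {i, k}) (L {j, k}) / 16"
proof -
  have "{i, j, k} - {i} = {j, k}" "{i, j, k} - {j} = {i, k}" "{i, j, k} - {k} = {i, j}"
    using assms by auto
  then show ?thesis
    using assms by (simp add: sqarea_def hero_three heron3_def algebra_simps)
qed

lemma four_sqarea:
  fixes L :: "nat set \<Rightarrow> 'a :: field_char_0"
  assumes "distinct [i, j, k]" "heron3 (L {i, j}) (L {i, k}) (L {j, k}) = 4 * d"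
  shows "4 * sqarea L {i, j, k} = d"
  using assms by (simp add: sqarea_three)

definition edge_heron :: "(nat set \<Rightarrow> 'a :: comm_ring_1) \<Rightarrow> nat set \<Rightarrow> 'a" where
  "edge_heron y e = hero (\<lambda>v. y (insert v e)) ({..4} - e)"

definition labelling :: "nat \<Rightarrow> nat \<Rightarrow> nat \<Rightarrow> nat \<Rightarrow> nat \<Rightarrow> bool" where
  "labelling i j k l m \<longleftrightarrow> {i, j, k, l, m} = {..4} \<and> distinct [i, j, k, l, m]"

lemma vertices_eq: "{..4} = {0, 1, 2, 3, 4 :: nat}"
  by auto

lemma exists_labelling:
  assumes "p \<le> 4" "q \<le> 4" "p \<noteq> q"
  shows "\<exists>x y z. labelling p q x y z"
proof -
  have "card ({..4 :: nat} - {p, q}) = 3"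
    using assms by (subst card_Diff_subset) auto
  then obtain x y z where xyz: "{..4} - {p, q} = {x, y, z}" "distinct [x, y, z]"
    by (auto simp: card_3_iff)
  have "{p, q, x, y, z} = {p, q} \<union> ({..4} - {p, q})"
    unfolding xyz by auto
  also have "\<dots> = {..4}"
    using assms by auto
  finally have "labelling p q x y z"
    using xyz assms unfolding labelling_def by auto
  then show ?thesis by blast
qed

lemma edge_heron_labelled:
  assumes "labelling i j k l m"
  shows "edge_heron y {i, j} = heron3 (y {i, j, k}) (y {i, j, l}) (y {i, j, m})"
proof -
  have "{..4} - {i, j} = {k, l, m}"
    using assms unfolding labelling_def by auto
  moreover have "insert v {i, j} = {i, j, v}" for v
    by auto
  ultimately show ?thesis
    using assms by (simp add: edge_heron_def hero_three labelling_def)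
qed

text \<open>
  The determinant of the symmetric matrix with first row \<open>d, e0, e1, e2\<close>, whose remaining block has diagonal
  \<open>g0, g1, g2\<close> and entries \<open>c\<close>, \<open>b\<close>, \<open>a\<close> in the places \<open>01\<close>, \<open>02\<close>, \<open>12\<close>.
\<close>

definition gram4 :: "'a \<Rightarrow> 'a \<Rightarrow> 'a \<Rightarrow> 'a \<Rightarrow> 'a \<Rightarrow> 'a \<Rightarrow> 'a \<Rightarrow> 'a \<Rightarrow> 'a \<Rightarrow> 'a \<Rightarrow> 'a :: comm_ring_1" where
  "gram4 d e0 e1 e2 g0 g1 g2 a b c =
     d * (g0 * g1 * g2 + 2 * a * b * c - g0 * a\<^sup>2 - g1 * b\<^sup>2 - g2 * c\<^sup>2)
     - (e0\<^sup>2 * (g1 * g2 - a\<^sup>2) + e1\<^sup>2 * (g0 * g2 - b\<^sup>2) + e2\<^sup>2 * (g0 * g1 - c\<^sup>2)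
       + 2 * e0 * e1 * (a * b - c * g2) + 2 * e0 * e2 * (a * c - b * g1) + 2 * e1 * e2 * (b * c - a * g0))"

text \<open>
  The determinant of twice the Gram matrix of the vectors from \<open>p\<close> to the other four vertices.  It is
  \<open>- 1\<close> times the Cayley-Menger determinant, and \<open>16 * 576\<close> times the squared volume.
\<close>

definition cm :: "(nat set \<Rightarrow> 'a :: comm_ring_1) \<Rightarrow> nat \<Rightarrow> nat \<Rightarrow> nat \<Rightarrow> nat \<Rightarrow> nat \<Rightarrow> 'a" where
  "cm L p q x y z = gram4 (2 * L {p, q})
     (L {p, q} + L {p, x} - L {q, x}) (L {p, q} + L {p, y} - L {q, y}) (L {p, q} + L {p, z} - L {q, z})
     (2 * L {p, x}) (2 * L {p, y}) (2 * L {p, z})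
     (L {p, y} + L {p, z} - L {y, z}) (L {p, x} + L {p, z} - L {x, z}) (L {p, x} + L {p, y} - L {x, y})"

lemma gram4_swap:
  "gram4 d e1 e0 e2 g1 g0 g2 b a c = gram4 d e0 e1 e2 g0 g1 g2 a b c"
  "gram4 d e0 e2 e1 g0 g2 g1 a c b = gram4 d e0 e1 e2 g0 g1 g2 a b c"
  "gram4 g0 e0 c b d g1 g2 a e2 e1 = gram4 d e0 e1 e2 g0 g1 g2 a b c"
  unfolding gram4_def by (simp_all add: algebra_simps power2_eq_square)

text \<open>
  The change of the Gram matrix when the base point moves to the end of the first vector.
\<close>

lemma gram4_shift:
  "gram4 d (d - e0) (d - e1) (d - e2) (g0 - 2 * e0 + d) (g1 - 2 * e1 + d) (g2 - 2 * e2 + d)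
     (a - e1 - e2 + d) (b - e0 - e2 + d) (c - e0 - e1 + d) = gram4 d e0 e1 e2 g0 g1 g2 a b c"
  unfolding gram4_def by (simp add: algebra_simps power2_eq_square)

lemma cm_swap:
  "cm L q p x y z = cm L p q x y z"
  "cm L p x q y z = cm L p q x y z"
  "cm L p q y x z = cm L p q x y z"
  "cm L p q x z y = cm L p q x y z"
proof -
  show "cm L p x q y z = cm L p q x y z" "cm L p q y x z = cm L p q x y z" "cm L p q x z y = cm L p q x y z"
    unfolding cm_def
    by (subst gram4_swap [symmetric], simp add: insert_commute add.commute)+
  show "cm L q p x y z = cm L p q x y z"
    unfolding cm_def
    by (subst (2) gram4_shift [symmetric]) (simp add: insert_commute algebra_simps)
qed

lemma cm_labelled:
  assumes "labelling p q x y z"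
  shows "cm L p q x y z = cm L 0 1 2 3 4"
proof -
  define N where "N = {0, 1, 2, 3, 4 :: nat}"
  have all: "\<forall>p\<in>N. \<forall>q\<in>N - {p}. \<forall>x\<in>N - {p, q}. \<forall>y\<in>N - {p, q, x}. \<forall>z\<in>N - {p, q, x, y}.
      cm L p q x y z = cm L 0 1 2 3 4"
    by (simp add: N_def insert_Diff_if cm_swap)
  have N: "N = {p, q, x, y, z}" and dist: "distinct [p, q, x, y, z]"
    using assms by (simp_all only: labelling_def N_def vertices_eq)
  have mem: "p \<in> N" "q \<in> N - {p}" "x \<in> N - {p, q}" "y \<in> N - {p, q, x}" "z \<in> N - {p, q, x, y}"
    unfolding N using dist by simp_all
  show ?thesis
    by (rule all[rule_format, OF mem])
qed

lemma (in unital_subring) cm_mem: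
  assumes "\<And>e. L e \<in> B"
  shows "cm L p q x y z \<in> B"
  using assms by (simp add: cm_def gram4_def)

lemma (in valuation_ring) largest_exists:
  assumes "finite E" "E \<noteq> {}"
  shows "\<exists>m\<in>E. \<forall>e\<in>E. \<exists>r\<in>V. f e = r * f m"
  using assms
proof (induction E rule: finite_ne_induct)
  case (singleton e)
  have "f e = 1 * f e" by simp
  then show ?case by (metis one_mem singletonD singletonI)
next
  case (insert x E)
  then obtain m where m: "m \<in> E" "\<forall>e\<in>E. \<exists>r\<in>V. f e = r * f m"
    by blast
  from dvd_total[of "f x" "f m"] show ?case
  proof
    assume "\<exists>r\<in>V. f x = r * f m"
    then show ?thesis
      using m by blast
  next
    assume "\<exists>r\<in>V. f m = r * f x"
    then obtain r where r: "r \<in> V" "f m = r * f x" by blast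
    have *: "\<exists>s\<in>V. f e = s * f x" if e: "e \<in> insert x E" for e
    proof (cases "e = x")
      case True
      then show ?thesis
        by (intro bexI[of _ 1]) simp_all
    next
      case False
      then obtain s where "s \<in> V" "f e = s * f m"
        using e m(2) by blast
      then show ?thesis
        using r by (intro bexI[of _ "s * r"]) (simp_all add: mult.assoc)
    qed
    show ?thesis
      by (intro bexI[of _ x] ballI *) simp_all
  qed
qed

locale rational_valuation_ring = valuation_ring V for V :: "'a :: field_char_0 set" +
  assumes inverse_numeral_mem: "inverse (numeral n) \<in> V"
begin

lemma divide_numeral_mem [simp]: "x \<in> V \<Longrightarrow> x / numeral n \<in> V"
  by (simp only: divide_inverse mult_mem inverse_numeral_mem)

end

lemma heron3_scale: "heron3 (4 * x) (4 * y) (4 * z) = 16 * heron3 x y z" for x :: "'a :: comm_ring_1"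
  by (simp add: heron3_def algebra_simps power2_eq_square)

text \<open>
  The passage from squared lengths to the coordinates relative to the longest edge \<open>pq\<close>.
\<close>

locale simplex_with_long_edge = rational_valuation_ring V for V :: "'a :: field_char_0 set" +
  fixes L :: "nat set \<Rightarrow> 'a" and p q x y z :: nat
  assumes lab: "labelling p q x y z"
    and long: "\<And>e. \<exists>r\<in>V. L e = r * L {p, q}"
    and infinite: "L {p, q} \<notin> V"
    and area_mem: "\<And>i j k. i \<le> 4 \<Longrightarrow> j \<le> 4 \<Longrightarrow> k \<le> 4 \<Longrightarrow> distinct [i, j, k] \<Longrightarrow> sqarea L {i, j, k} \<in> V"
begin

definition "s = L {p, q}"
definition "t v = (L {p, v} + s - L {q, v}) / (2 * s)"
definition "g u v = (L {p, u} + L {p, v} - L {u, v}) / 2"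
definition "n v = s * L {p, v} - (s * t v)\<^sup>2"
definition "f u v = s * g u v - (s * t u) * (s * t v)"

lemma s_nz: "s \<noteq> 0" and inverse_s_mem: "1 / s \<in> V"
  using infinite inverse_mem[OF infinite] by (auto simp: s_def divide_inverse)

lemma quotient_mem: "L e / s \<in> V"
proof -
  obtain r where "r \<in> V" "L e = r * s"
    using long unfolding s_def by blast
  then show ?thesis
    using s_nz by simp
qed

lemma t_mem: "t v \<in> V"
proof -
  have "t v = (L {p, v} / s + 1 - L {q, v} / s) / 2"
    using s_nz by (simp add: t_def field_simps)
  also have "\<dots> \<in> V"
    using quotient_mem by simp
  finally show ?thesis .
qed

lemma f_mem: "f u v * (1 / s\<^sup>2) \<in> V"
proof -
  have "f u v * (1 / s\<^sup>2) = (L {p, u} / s + L {p, v} / s - L {u, v} / s) / 2 - t u * t v"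
    using s_nz by (simp add: f_def g_def field_simps power2_eq_square)
  also have "\<dots> \<in> V"
    using quotient_mem t_mem by simp
  finally show ?thesis .
qed

lemma f_sym: "f u v = f v u"
  by (simp add: f_def g_def insert_commute add.commute mult.commute)

lemma L_q: "L {q, v} = L {p, v} + s - 2 * s * t v"
  using s_nz by (simp add: t_def)

lemma L_uv: "L {u, v} = L {p, u} + L {p, v} - 2 * g u v"
  by (simp add: g_def field_simps)

lemma n_eq:
  assumes "distinct [p, q, v]"
  shows "n v = 4 * sqarea L {p, q, v}"
  using assms s_nz
  by (simp add: sqarea_three L_q[of v] s_def[symmetric] n_def heron3_def field_simps power2_eq_square)

lemma minor_eq:
  "(n u * n v - (f u v)\<^sup>2) * (1 / s\<^sup>2)
    = (L {p, u} - s * (t u)\<^sup>2) * (L {p, v} - s * (t v)\<^sup>2) - (g u v - s * t u * t v)\<^sup>2"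
proof -
  have "n v = s * (L {p, v} - s * (t v)\<^sup>2)" for v
    by (simp add: n_def algebra_simps power2_eq_square)
  moreover have "f u v = s * (g u v - s * t u * t v)"
    by (simp add: f_def algebra_simps)
  moreover have "(s * a * (s * b) - (s * c)\<^sup>2) * (1 / s\<^sup>2) = a * b - c\<^sup>2" for a b c
  proof -
    have "s * a * (s * b) - (s * c)\<^sup>2 = s\<^sup>2 * (a * b - c\<^sup>2)"
      by (simp add: algebra_simps power2_eq_square)
    then show ?thesis
      using s_nz by simp
  qed
  ultimately show ?thesis
    by (simp only:)
qed

lemma P_eq:
  assumes "distinct [p, u, v]"
  shows "(t u)\<^sup>2 * n v + (t v)\<^sup>2 * n u - 2 * t u * t v * f u v + (n u * n v - (f u v)\<^sup>2) * (1 / s\<^sup>2)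
    = 4 * sqarea L {p, u, v}"
proof -
  have "4 * sqarea L {p, u, v} = L {p, u} * L {p, v} - (g u v)\<^sup>2"
    using assms(1)
    by (rule four_sqarea) (simp add: L_uv[of u v] heron3_def algebra_simps power2_eq_square)
  then show ?thesis
    unfolding minor_eq by (simp add: n_def f_def algebra_simps power2_eq_square)
qed

lemma O_eq:
  assumes "distinct [q, u, v]"
  shows "(1 - t u)\<^sup>2 * n v + (1 - t v)\<^sup>2 * n u - 2 * (1 - t u) * (1 - t v) * f u v
      + (n u * n v - (f u v)\<^sup>2) * (1 / s\<^sup>2) = 4 * sqarea L {q, u, v}"
proof -
  have "4 * sqarea L {q, u, v} = L {q, u} * L {q, v} - (g u v + s - s * t u - s * t v)\<^sup>2"
    using assms(1)
    by (rule four_sqarea) (simp add: L_uv[of u v] L_q heron3_def algebra_simps power2_eq_square)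
  then show ?thesis
    unfolding minor_eq by (simp add: L_q n_def f_def algebra_simps power2_eq_square)
qed

lemma F_eq:
  assumes "distinct [u, v, v']"
  shows "(t v' - t v)\<^sup>2 * n u + (t u - t v')\<^sup>2 * n v + (t v - t u)\<^sup>2 * n v'
    + 2 * ((t v' - t v) * (t u - t v') * f u v + (t v' - t v) * (t v - t u) * f u v'
      + (t u - t v') * (t v - t u) * f v v')
    + ((n u * n v - (f u v)\<^sup>2) + (n u * n v' - (f u v')\<^sup>2) + (n v * n v' - (f v v')\<^sup>2)
       + 2 * (f u v * f v v' - n v * f u v') + 2 * (f v v' * f u v' - n v' * f u v)
       + 2 * (f u v' * f u v - n u * f v v')) * (1 / s\<^sup>2)
    = 4 * sqarea L {u, v, v'}"
proof -
  define N where "N = (\<lambda>v. L {p, v} - s * (t v)\<^sup>2)"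
  define f' where "f' = (\<lambda>u v. g u v - s * t u * t v)"
  have n: "n v = s * N v" for v
    by (simp add: n_def N_def algebra_simps power2_eq_square)
  have f: "f u v = s * f' u v" for u v
    by (simp add: f_def f'_def algebra_simps)
  have "((n u * n v - (f u v)\<^sup>2) + (n u * n v' - (f u v')\<^sup>2) + (n v * n v' - (f v v')\<^sup>2)
       + 2 * (f u v * f v v' - n v * f u v') + 2 * (f v v' * f u v' - n v' * f u v)
       + 2 * (f u v' * f u v - n u * f v v'))
     = s\<^sup>2 * ((N u * N v - (f' u v)\<^sup>2) + (N u * N v' - (f' u v')\<^sup>2) + (N v * N v' - (f' v v')\<^sup>2)
       + 2 * (f' u v * f' v v' - N v * f' u v') + 2 * (f' v v' * f' u v' - N v' * f' u v)
       + 2 * (f' u v' * f' u v - N u * f' v v'))"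
    unfolding n f by (simp add: algebra_simps power2_eq_square)
  moreover have "s\<^sup>2 * x * (1 / s\<^sup>2) = x" for x
    using s_nz by simp
  moreover have "4 * sqarea L {u, v, v'}
      = (L {p, u} + L {p, v} - 2 * g u v) * (L {p, u} + L {p, v'} - 2 * g u v')
        - (L {p, u} - g u v - g u v' + g v v')\<^sup>2"
    using assms(1)
    by (rule four_sqarea) (simp add: L_uv[of u] L_uv[of v v'] heron3_def algebra_simps power2_eq_square)
  ultimately show ?thesis
    by (simp only:) (simp add: n_def f_def N_def f'_def algebra_simps power2_eq_square)
qed

lemma vol_eq:
  "16 * ((n u * n v * n v' + 2 * f v v' * f u v' * f u v - n u * (f v v')\<^sup>2 - n v * (f u v')\<^sup>2
    - n v' * (f u v)\<^sup>2) * (1 / s\<^sup>2)) = cm L p q u v v'"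
proof -
  have "n u * n v * n v' + 2 * f v v' * f u v' * f u v - n u * (f v v')\<^sup>2 - n v * (f u v')\<^sup>2
      - n v' * (f u v)\<^sup>2 = s\<^sup>2 * gram4 s (s * t u) (s * t v) (s * t v') (L {p, u}) (L {p, v}) (L {p, v'})
        (g v v') (g u v') (g u v)"
    unfolding n_def f_def gram4_def by (simp add: algebra_simps power2_eq_square)
  moreover have "cm L p q u v v' = gram4 (2 * s) (2 * (s * t u)) (2 * (s * t v)) (2 * (s * t v'))
        (2 * L {p, u}) (2 * L {p, v}) (2 * L {p, v'}) (2 * g v v') (2 * g u v') (2 * g u v)"
  proof -
    have "2 * (s * t w) = s + L {p, w} - L {q, w}" for w
      using s_nz by (simp add: t_def)
    moreover have "2 * g w w' = L {p, w} + L {p, w'} - L {w, w'}" for w w'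
      by (simp add: g_def)
    ultimately show ?thesis
      by (simp only: cm_def s_def)
  qed
  moreover have "gram4 (2 * d) (2 * e0) (2 * e1) (2 * e2) (2 * g0) (2 * g1) (2 * g2) (2 * a) (2 * b) (2 * c)
      = 16 * gram4 d e0 e1 e2 g0 g1 g2 a b c" for d e0 e1 e2 g0 g1 g2 a b c :: 'a
    unfolding gram4_def by (simp add: algebra_simps power2_eq_square)
  ultimately show ?thesis
    using s_nz by simp
qed

text \<open>
  The three pairs of vertices off the edge \<open>pq\<close> can be permuted arbitrarily by relabelling these vertices.
\<close>

lemma exists_ordered_labels:
  "\<exists>u v v'. {u, v, v'} = {x, y, z} \<and> distinct [u, v, v']
    \<and> (\<exists>r\<in>V. f v v' = r * f u v') \<and> (\<exists>r\<in>V. f u v' = r * f u v)"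
proof -
  define le where "le a b \<longleftrightarrow> (\<exists>r\<in>V. a = r * b)" for a b
  have total: "le a b \<or> le b a" for a b
    using dvd_total[of a b] by (auto simp: le_def)
  have ex: ?thesis if "{u, v, v'} = {x, y, z}" "distinct [u, v, v']" "le (f v v') (f u v')" "le (f u v') (f u v)"
    for u v v'
    using that unfolding le_def by blast
  have xyz: "x \<noteq> y" "y \<noteq> z" "x \<noteq> z"
    using lab by (auto simp: labelling_def)
  consider "le (f y z) (f x z)" "le (f x z) (f x y)" | "le (f y z) (f x y)" "le (f x y) (f x z)"
    | "le (f x z) (f y z)" "le (f y z) (f x y)" | "le (f x z) (f x y)" "le (f x y) (f y z)"
    | "le (f x y) (f x z)" "le (f x z) (f y z)" | "le (f x y) (f y z)" "le (f y z) (f x z)"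
    using total[of "f y z" "f x z"] total[of "f y z" "f x y"] total[of "f x z" "f x y"] by argo
  then show ?thesis
  proof cases
    case 1 then show ?thesis using ex[of x y z] xyz by simp
  next
    case 2 then show ?thesis using ex[of x z y] xyz f_sym[of z y] by auto
  next
    case 3 then show ?thesis using ex[of y x z] xyz f_sym[of y x] by auto
  next
    case 4 then show ?thesis using ex[of y z x] xyz f_sym[of z x] f_sym[of y x] by auto
  next
    case 5 then show ?thesis using ex[of z y x] xyz f_sym[of y x] f_sym[of z x] f_sym[of z y] by auto
  next
    case 6 then show ?thesis using ex[of z x y] xyz f_sym[of z x] f_sym[of z y] by auto
  qed
qed

lemma short_edge_bounds_volume:
  "cm L 0 1 2 3 4 \<in> V \<or> (\<exists>e. e \<subseteq> {..4} \<and> card e = 2 \<and> cm L 0 1 2 3 4 * edge_heron (sqarea L) e \<in> V)"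
proof -
  obtain u v v' where uv: "{u, v, v'} = {x, y, z}" "distinct [u, v, v']"
    and ord: "\<exists>r\<in>V. f v v' = r * f u v'" "\<exists>r\<in>V. f u v' = r * f u v"
    using exists_ordered_labels by blast
  have "{p, q, u, v, v'} = {..4}" "p \<noteq> q" "p \<notin> {u, v, v'}" "q \<notin> {u, v, v'}"
    using lab uv(1) by (auto simp: labelling_def)
  then have lab': "labelling p q u v v'"
    using uv(2) by (auto simp: labelling_def)
  then have le4: "p \<le> 4" "q \<le> 4" "u \<le> 4" "v \<le> 4" "v' \<le> 4"
    by (auto simp: labelling_def)
  have dist: "distinct [p, q, u, v, v']"
    using lab' by (simp add: labelling_def)
  have areas: "n v' = 4 * sqarea L {p, q, v'}" "n u = 4 * sqarea L {p, q, u}" "n v = 4 * sqarea L {p, q, v}"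
    using dist by (simp_all add: n_eq)
  have mem4: "4 * sqarea L {i, j, k} \<in> V" if "i \<le> 4" "j \<le> 4" "k \<le> 4" "distinct [i, j, k]" for i j k
    using area_mem[OF that] by simp
  interpret simplex_in_valuation_ring V "n u" "n v" "n v'" "f v v'" "f u v'" "f u v" "t u" "t v" "t v'" "1 / s\<^sup>2"
  proof
    show "n u \<in> V" "n v \<in> V" "n v' \<in> V"
      unfolding areas using dist le4 by (auto intro!: mem4)
    have "1 / s * (1 / s) \<in> V"
      using inverse_s_mem by (intro mult_mem)
    then show "1 / s\<^sup>2 \<in> V"
      by (simp add: power2_eq_square)
  qed (simp_all add: t_mem f_mem[simplified] inverse_numeral_mem)
  have d: "distinct [p, u, v]" "distinct [p, u, v']" "distinct [p, v, v']" "distinct [q, u, v]"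
    "distinct [q, u, v']" "distinct [q, v, v']" "distinct [u, v, v']"
    using dist by auto
  have eqs: "P01 = 4 * sqarea L {p, u, v}" "P02 = 4 * sqarea L {p, u, v'}" "P12 = 4 * sqarea L {p, v, v'}"
    "O01 = 4 * sqarea L {q, u, v}" "O02 = 4 * sqarea L {q, u, v'}" "O12 = 4 * sqarea L {q, v, v'}"
    "F012 = 4 * sqarea L {u, v, v'}"
    unfolding P01_def P02_def P12_def O01_def O02_def O12_def F012_def
    by (simp_all only: P_eq[OF d(1)] P_eq[OF d(2)] P_eq[OF d(3)]
        O_eq[OF d(4)] O_eq[OF d(5)] O_eq[OF d(6)] F_eq[OF d(7)])
  have vol_cm: "16 * vol = cm L 0 1 2 3 4"
    unfolding vol_def vol_eq using cm_labelled[OF lab'] .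
  have labs: "labelling p v' q u v" "labelling q v' p u v" "labelling v v' p q u"
    using lab' by (auto simp: labelling_def)
  have h: "edge_heron (sqarea L) {p, v'} = heron3 (sqarea L {p, q, v'}) (sqarea L {p, u, v'}) (sqarea L {p, v, v'})"
    "edge_heron (sqarea L) {q, v'} = heron3 (sqarea L {p, q, v'}) (sqarea L {q, u, v'}) (sqarea L {q, v, v'})"
    "edge_heron (sqarea L) {v, v'} = heron3 (sqarea L {p, v, v'}) (sqarea L {q, v, v'}) (sqarea L {u, v, v'})"
  proof -
    have "{p, v', q} = {p, q, v'}" "{p, v', u} = {p, u, v'}" "{p, v', v} = {p, v, v'}"
      "{q, v', p} = {p, q, v'}" "{q, v', u} = {q, u, v'}" "{q, v', v} = {q, v, v'}"
      "{v, v', p} = {p, v, v'}" "{v, v', q} = {q, v, v'}" "{v, v', u} = {u, v, v'}"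
      by auto
    then show "edge_heron (sqarea L) {p, v'} = heron3 (sqarea L {p, q, v'}) (sqarea L {p, u, v'}) (sqarea L {p, v, v'})"
      "edge_heron (sqarea L) {q, v'} = heron3 (sqarea L {p, q, v'}) (sqarea L {q, u, v'}) (sqarea L {q, v, v'})"
      "edge_heron (sqarea L) {v, v'} = heron3 (sqarea L {p, v, v'}) (sqarea L {q, v, v'}) (sqarea L {u, v, v'})"
      by (simp_all only: edge_heron_labelled[OF labs(1)] edge_heron_labelled[OF labs(2)]
        edge_heron_labelled[OF labs(3)])
  qed
  have hs: "heron3 (n v') P02 P12 = 16 * edge_heron (sqarea L) {p, v'}"
    "heron3 (n v') O02 O12 = 16 * edge_heron (sqarea L) {q, v'}"
    "heron3 P12 O12 F012 = 16 * edge_heron (sqarea L) {v, v'}"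
    unfolding eqs unfolding areas h heron3_scale by (rule refl)+
  have "P01 \<in> V" "P02 \<in> V" "P12 \<in> V" "O01 \<in> V" "O02 \<in> V" "O12 \<in> V" "F012 \<in> V"
    unfolding eqs using dist le4 by (auto intro!: mem4)
  from vol_bounded[OF ord this]
  have "vol \<in> V \<or> (\<exists>e. e \<subseteq> {..4} \<and> card e = 2 \<and> vol * (16 * edge_heron (sqarea L) e) \<in> V)"
    unfolding hs
  proof (elim disjE)
    assume "vol * (16 * edge_heron (sqarea L) {p, v'}) \<in> V"
    then show ?thesis using le4 dist by (intro disjI2 exI[of _ "{p, v'}"]) simp
  next
    assume "vol * (16 * edge_heron (sqarea L) {q, v'}) \<in> V"
    then show ?thesis using le4 dist by (intro disjI2 exI[of _ "{q, v'}"]) simp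
  next
    assume "vol * (16 * edge_heron (sqarea L) {v, v'}) \<in> V"
    then show ?thesis using le4 dist by (intro disjI2 exI[of _ "{v, v'}"]) simp
  qed simp
  moreover have "vol * (16 * h') = cm L 0 1 2 3 4 * h'" for h'
    unfolding vol_cm[symmetric] by (simp add: mult_ac)
  moreover have "vol \<in> V \<Longrightarrow> cm L 0 1 2 3 4 \<in> V"
    unfolding vol_cm[symmetric] by simp
  ultimately show ?thesis
    by (simp only:) blast
qed

end

text \<open>
  If all squared lengths are finite, then so is the volume; otherwise the estimates apply to a longest edge.
\<close>

theorem (in rational_valuation_ring) some_edge_bounds_volume:
  fixes L :: "nat set \<Rightarrow> 'a"
  assumes area_mem: "\<And>i j k. i \<le> 4 \<Longrightarrow> j \<le> 4 \<Longrightarrow> k \<le> 4 \<Longrightarrow> distinct [i, j, k] \<Longrightarrow> sqarea L {i, j, k} \<in> V"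
  shows "cm L 0 1 2 3 4 \<in> V \<or> (\<exists>e. e \<subseteq> {..4} \<and> card e = 2 \<and> cm L 0 1 2 3 4 * edge_heron (sqarea L) e \<in> V)"
proof -
  define E where "E = {e :: nat set. e \<subseteq> {..4} \<and> card e = 2}"
  \<comment> \<open>Only the values on edges matter; the others are made \<open>0\<close> so that a largest value is attained on an edge.\<close>
  define L' where "L' e = (if e \<in> E then L e else 0)" for e
  have pair: "{i, j} \<in> E \<longleftrightarrow> i \<le> 4 \<and> j \<le> 4 \<and> i \<noteq> j" for i j
    by (auto simp: E_def card_insert_if)
  have cm: "cm L' 0 1 2 3 4 = cm L 0 1 2 3 4"
    by (simp add: cm_def L'_def pair)
  have area: "sqarea L' {i, j, k} = sqarea L {i, j, k}"
    if "i \<le> 4" "j \<le> 4" "k \<le> 4" "distinct [i, j, k]" for i j k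
    using that by (simp add: sqarea_three L'_def pair)
  have heron: "edge_heron (sqarea L') e = edge_heron (sqarea L) e" if "e \<in> E" for e
  proof -
    obtain i j where e: "e = {i, j}" "i \<noteq> j"
      using \<open>e \<in> E\<close> by (auto simp: E_def card_2_iff)
    have "sqarea L' (insert v e) = sqarea L (insert v e)" if "v \<in> {..4} - e" for v
      using area[of v i j] that e \<open>e \<in> E\<close> pair by auto
    then show ?thesis
      by (simp add: edge_heron_def hero_def cong: sum.cong_simp)
  qed
  have "finite E"
    by (simp add: E_def)
  moreover have "{0, 1} \<in> E"
    by (simp add: pair)
  ultimately obtain m where m: "m \<in> E" "\<forall>e\<in>E. \<exists>r\<in>V. L' e = r * L' m"
    using largest_exists[of E L'] by blast
  then obtain p q where pq: "m = {p, q}" "p \<noteq> q" "p \<le> 4" "q \<le> 4"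
    using pair by (auto simp: E_def card_2_iff)
  have long: "\<exists>r\<in>V. L' e = r * L' {p, q}" for e
  proof (cases "e \<in> E")
    case True
    then show ?thesis using m pq by auto
  next
    case False
    then show ?thesis by (intro bexI[of _ 0]) (simp_all add: L'_def)
  qed
  show ?thesis
  proof (cases "L' {p, q} \<in> V")
    case True
    have "L' e \<in> V" for e
      using long[of e] True by auto
    then show ?thesis
      using cm_mem[of L' 0 1 2 3 4] cm by auto
  next
    case False
    obtain x y z where "labelling p q x y z"
      using exists_labelling[OF pq(3,4,2)] by blast
    then interpret simplex_with_long_edge V L' p q x y z
      using False long area_mem area by unfold_locales auto
    have "\<And>e. e \<subseteq> {..4} \<and> card e = 2 \<Longrightarrow> edge_heron (sqarea L') e = edge_heron (sqarea L) e"
      using heron by (simp add: E_def)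
    then show ?thesis
      using short_edge_bounds_volume unfolding cm by metis
  qed
qed

section \<open>The Cayley-Menger determinant\<close>

lemma det_mat_Suc:
  fixes f :: "nat \<times> nat \<Rightarrow> 'a :: comm_ring_1"
  shows "det (mat (Suc n) (Suc n) f) =
    (\<Sum>j<Suc n. f (0, j) * ((-1) ^ j * det (mat n n (\<lambda>(a, b). f (Suc a, if b < j then b else Suc b)))))"
proof -
  define A where "A = mat (Suc n) (Suc n) f"
  have A: "A \<in> carrier_mat (Suc n) (Suc n)"
    by (simp add: A_def)
  have "mat_delete A 0 j = mat n n (\<lambda>(a, b). f (Suc a, if b < j then b else Suc b))" if "j < Suc n" for j
    using that by (intro eq_matI) (auto simp: mat_delete_def A_def)
  moreover have "A $$ (0, j) = f (0, j)" if "j < Suc n" for j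
    using that by (simp add: A_def)
  ultimately show ?thesis
    unfolding A_def[symmetric] laplace_expansion_row[OF A zero_less_Suc]
    by (intro sum.cong) (simp_all add: cofactor_def)
qed

lemma det_mat_single_row_entry:
  fixes f :: "nat \<times> nat \<Rightarrow> 'a :: comm_ring_1"
  assumes "\<And>j. j < Suc n \<Longrightarrow> j \<noteq> c \<Longrightarrow> f (0, j) = 0" "c < Suc n"
  shows "det (mat (Suc n) (Suc n) f)
    = f (0, c) * ((-1) ^ c * det (mat n n (\<lambda>(a, b). f (Suc a, if b < c then b else Suc b))))"
proof -
  have "(\<Sum>j<Suc n. f (0, j) * ((-1) ^ j * det (mat n n (\<lambda>(a, b). f (Suc a, if b < j then b else Suc b)))))
    = (\<Sum>j\<in>{c}. f (0, j) * ((-1) ^ j * det (mat n n (\<lambda>(a, b). f (Suc a, if b < j then b else Suc b)))))"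
    using assms by (intro sum.mono_neutral_right) auto
  then show ?thesis
    unfolding det_mat_Suc by simp
qed

lemma det_mat_transpose:
  fixes f :: "nat \<times> nat \<Rightarrow> 'a :: comm_ring_1"
  shows "det (mat n n f) = det (mat n n (\<lambda>(a, b). f (b, a)))"
proof -
  have "transpose_mat (mat n n f) = mat n n (\<lambda>(a, b). f (b, a))"
    by (intro eq_matI) auto
  then show ?thesis
    using det_transpose[of "mat n n f" n] by simp
qed

lemma det_mat_4:
  fixes f :: "nat \<times> nat \<Rightarrow> 'a :: comm_ring_1"
  assumes sym: "\<And>a b. f (a, b) = f (b, a)"
  shows "det (mat 4 4 f) = gram4 (f (0, 0)) (f (0, 1)) (f (0, 2)) (f (0, 3)) (f (1, 1)) (f (2, 2)) (f (3, 3))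
    (f (2, 3)) (f (1, 3)) (f (1, 2))"
proof -
  have numerals: "4 = Suc (Suc (Suc (Suc 0)))" "3 = Suc (Suc (Suc 0))" "2 = Suc (Suc 0)" "1 = Suc 0"
    by simp_all
  have "f (Suc 0, 0) = f (0, Suc 0)" "f (Suc (Suc 0), 0) = f (0, Suc (Suc 0))"
    "f (Suc (Suc (Suc 0)), 0) = f (0, Suc (Suc (Suc 0)))"
    "f (Suc (Suc 0), Suc 0) = f (Suc 0, Suc (Suc 0))"
    "f (Suc (Suc (Suc 0)), Suc 0) = f (Suc 0, Suc (Suc (Suc 0)))"
    "f (Suc (Suc (Suc 0)), Suc (Suc 0)) = f (Suc (Suc 0), Suc (Suc (Suc 0)))"
    by (rule sym)+
  then show ?thesis
    unfolding numerals(1)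
    by (simp add: det_mat_Suc sum.lessThan_Suc gram4_def numerals(2,3) algebra_simps power2_eq_square)
qed

text \<open>
  Subtracting the row and the column of the vertex \<open>0\<close> from those of the other vertices is the congruence by
  the unipotent matrix \<open>E\<close>.  It leaves the matrix \<open>M\<close>, whose border splits off and whose remaining block is
  \<open>- 2\<close> times the Gram matrix at the vertex \<open>0\<close>.
\<close>

lemma det_cayley_menger:
  fixes L :: "nat set \<Rightarrow> 'a :: idom"
  assumes s: "\<And>i j. s i j = L {i, j}"
  shows "det (mat 6 6 (\<lambda>(a, b). if a = b then 0 else if a = 0 \<or> b = 0 then 1 else s (a - 1) (b - 1)))
    = - cm L 0 1 2 3 4" (is "det ?A = _")
proof -
  have sym: "s i j = s j i" for i j
    by (simp add: s insert_commute)
  define m where "m = (\<lambda>(a, b). if a = 0 \<or> b = 0 then (if a + b = 1 then 1 else 0)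
    else if a = 1 \<or> b = 1 then (if a = b then 0 else s (a - 1) (b - 1))
    else if a = b then - 2 * s 0 (a - 1) else s (a - 1) (b - 1) - s 0 (a - 1) - s 0 (b - 1) :: 'a)"
  define M where "M = mat 6 6 m"
  define E :: "'a mat" where "E = mat 6 6 (\<lambda>(a, b). if a = b \<or> b = 1 \<and> 2 \<le> a then 1 else 0)"
  have carr: "E \<in> carrier_mat 6 6" "M \<in> carrier_mat 6 6" "transpose_mat E \<in> carrier_mat 6 6"
    by (simp_all add: E_def M_def)
  have six: "6 = Suc (Suc (Suc (Suc (Suc (Suc 0)))))" "5 = Suc (Suc (Suc (Suc (Suc 0))))"
    by simp_all
  have EM: "E * M = mat 6 6 (\<lambda>(a, b). m (a, b) + (if 2 \<le> a then m (1, b) else 0))"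
  proof (rule eq_matI)
    fix a b :: nat assume "a < dim_row (mat 6 6 (\<lambda>(a, b). m (a, b) + (if 2 \<le> a then m (1, b) else 0)))"
      "b < dim_col (mat 6 6 (\<lambda>(a, b). m (a, b) + (if 2 \<le> a then m (1, b) else 0)))"
    then have ab: "a < 6" "b < 6" by simp_all
    have "(E * M) $$ (a, b) = (\<Sum>k<6. (if a = k \<or> k = 1 \<and> 2 \<le> a then 1 else 0) * m (k, b))"
      using ab by (simp add: E_def M_def scalar_prod_def atLeast0LessThan)
    also have "\<dots> = (\<Sum>k\<in>(if 2 \<le> a then {a, 1} else {a}). m (k, b))"
      using ab by (intro sum.mono_neutral_cong_right) (auto split: if_splits)
    also have "\<dots> = m (a, b) + (if 2 \<le> a then m (1, b) else 0)"
      by auto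
    finally show "(E * M) $$ (a, b) = mat 6 6 (\<lambda>(a, b). m (a, b) + (if 2 \<le> a then m (1, b) else 0)) $$ (a, b)"
      using ab by simp
  qed (simp_all add: E_def M_def)
  have "?A = E * M * transpose_mat E"
  proof (rule eq_matI)
    fix a b :: nat assume "a < dim_row (E * M * transpose_mat E)" "b < dim_col (E * M * transpose_mat E)"
    then have ab: "a < 6" "b < 6" by (simp_all add: E_def)
    define m' where "m' a b = m (a, b) + (if 2 \<le> a then m (1, b) else 0)" for a b
    have "(E * M * transpose_mat E) $$ (a, b) = (\<Sum>k<6. m' a k * (if b = k \<or> k = 1 \<and> 2 \<le> b then 1 else 0))"
      unfolding EM m'_def using ab by (simp add: E_def scalar_prod_def atLeast0LessThan)
    also have "\<dots> = (\<Sum>k\<in>(if 2 \<le> b then {b, 1} else {b}). m' a k)"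
      using ab by (intro sum.mono_neutral_cong_right) (auto split: if_splits)
    also have "\<dots> = m' a b + (if 2 \<le> b then m' a 1 else 0)"
      by auto
    also have "\<dots> = (if a = b then 0 else if a = 0 \<or> b = 0 then 1 else s (a - 1) (b - 1))"
      using sym[of 0] by (auto simp: m'_def m_def)
    finally show "?A $$ (a, b) = (E * M * transpose_mat E) $$ (a, b)"
      using ab by simp
  qed (simp_all add: E_def)
  moreover have "det E = 1"
    by (subst det_lower_triangular[OF _ carr(1)]) (auto simp: E_def prod_list_diag_prod)
  ultimately have "det ?A = det M"
    using carr by (simp add: det_mult[of _ 6] det_transpose[OF carr(1)])
  also have "det M = - det (mat 5 5 (\<lambda>(a, b). m (Suc a, if b < 1 then b else Suc b)))"
    unfolding M_def six by (subst det_mat_single_row_entry[of _ 1]) (auto simp: m_def)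
  also have "\<dots> = - det (mat 5 5 (\<lambda>(a, b). m (Suc b, if a < 1 then a else Suc a)))"
    by (subst det_mat_transpose) simp
  also have "\<dots> = - det (mat 4 4 (\<lambda>(a, b). m (Suc (Suc b), Suc (Suc a))))"
  proof -
    have five: "5 = Suc 4" by simp
    have "det (mat 5 5 (\<lambda>(a, b). m (Suc b, if a < 1 then a else Suc a)))
      = det (mat 4 4 (\<lambda>(a, b). (\<lambda>(a, b). m (Suc b, if a < 1 then a else Suc a)) (Suc a, if b < 0 then b else Suc b)))"
      unfolding five by (subst det_mat_single_row_entry[of _ 0]) (auto simp: m_def)
    also have "mat 4 4 (\<lambda>(a, b). (\<lambda>(a, b). m (Suc b, if a < 1 then a else Suc a)) (Suc a, if b < 0 then b else Suc b))
      = mat 4 4 (\<lambda>(a, b). m (Suc (Suc b), Suc (Suc a)))"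
      by (intro eq_matI) auto
    finally show ?thesis
      by simp
  qed
  also have "mat 4 4 (\<lambda>(a, b). m (Suc (Suc b), Suc (Suc a)))
      = (-1) \<cdot>\<^sub>m mat 4 4 (\<lambda>(a, b). - m (Suc (Suc b), Suc (Suc a)))"
    by (intro eq_matI) auto
  also have "det \<dots> = det (mat 4 4 (\<lambda>(a, b). - m (Suc (Suc b), Suc (Suc a))))"
    by simp
  also have "\<dots> = cm L 0 1 2 3 4"
    using sym unfolding cm_def
    by (subst det_mat_4) (auto simp: m_def s[symmetric] numeral_eq_Suc algebra_simps)
  finally show ?thesis .
qed
section \<open>Polynomial functions\<close>

text \<open>
  Polynomials with rational coefficients in the variables from \<open>I\<close>, represented by the functions that they
  define.  Over a field of characteristic \<open>0\<close> the function determines the polynomial, and specialization of the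
  variables is evaluation.
\<close>

inductive_set polyfun :: "'v set \<Rightarrow> (('v \<Rightarrow> 'a :: field_char_0) \<Rightarrow> 'a) set" for I where
  const: "(\<lambda>x. of_rat c) \<in> polyfun I"
| var: "v \<in> I \<Longrightarrow> (\<lambda>x. x v) \<in> polyfun I"
| add: "f \<in> polyfun I \<Longrightarrow> g \<in> polyfun I \<Longrightarrow> (\<lambda>x. f x + g x) \<in> polyfun I"
| mult: "f \<in> polyfun I \<Longrightarrow> g \<in> polyfun I \<Longrightarrow> (\<lambda>x. f x * g x) \<in> polyfun I"

lemma polyfun_zero: "(\<lambda>x. 0) \<in> polyfun I"
  using polyfun.const[of 0] by simp

lemma polyfun_one: "(\<lambda>x. 1) \<in> polyfun I"
  using polyfun.const[of 1] by simp

lemma polyfun_numeral: "(\<lambda>x. numeral n) \<in> polyfun I"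
  using polyfun.const[of "numeral n"] by simp

lemma polyfun_uminus: "f \<in> polyfun I \<Longrightarrow> (\<lambda>x. - f x) \<in> polyfun I"
  using polyfun.mult[OF polyfun.const[of "-1"], of f I] by (simp add: of_rat_minus)

lemma polyfun_diff: "f \<in> polyfun I \<Longrightarrow> g \<in> polyfun I \<Longrightarrow> (\<lambda>x. f x - g x) \<in> polyfun I"
  using polyfun.add[OF _ polyfun_uminus, of f I g] by simp

lemma polyfun_power: "f \<in> polyfun I \<Longrightarrow> (\<lambda>x. f x ^ n) \<in> polyfun I"
  by (induction n) (auto intro: polyfun_one polyfun.mult)

lemma polyfun_sum: "(\<And>i. i \<in> J \<Longrightarrow> f i \<in> polyfun I) \<Longrightarrow> (\<lambda>x. \<Sum>i\<in>J. f i x) \<in> polyfun I"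
  by (induction J rule: infinite_finite_induct) (auto intro: polyfun_zero polyfun.add)

lemma polyfun_prod: "(\<And>i. i \<in> J \<Longrightarrow> f i \<in> polyfun I) \<Longrightarrow> (\<lambda>x. \<Prod>i\<in>J. f i x) \<in> polyfun I"
  by (induction J rule: infinite_finite_induct) (auto intro: polyfun_one polyfun.mult)

lemmas polyfun_intros = polyfun.intros polyfun_zero polyfun_one polyfun_numeral polyfun_uminus
  polyfun_diff polyfun_power polyfun_sum polyfun_prod

lemma polyfun_heron3:
  "f \<in> polyfun I \<Longrightarrow> g \<in> polyfun I \<Longrightarrow> h \<in> polyfun I \<Longrightarrow> (\<lambda>x. heron3 (f x) (g x) (h x)) \<in> polyfun I"
  unfolding heron3_def by (intro polyfun_intros)

lemma polyfun_cong:
  assumes "f \<in> polyfun I" "\<And>v. v \<in> I \<Longrightarrow> x v = y v"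
  shows "f x = f y"
  using assms by (induction) auto

lemma polyfun_mono:
  assumes "f \<in> polyfun I" "I \<subseteq> Y"
  shows "f \<in> polyfun Y"
  using assms by (induction) (auto intro: polyfun.intros)

lemma polyfun_subst:
  assumes "f \<in> polyfun I" "\<And>v. v \<in> I \<Longrightarrow> (\<lambda>x. \<phi> x v) \<in> polyfun Y"
  shows "(\<lambda>x. f (\<phi> x)) \<in> polyfun Y"
  using assms by (induction) (auto intro: polyfun.intros)

lemma polyfun_subst_poly:
  assumes "f \<in> polyfun I"
  shows "\<exists>h. \<forall>t. f (\<lambda>v. poly (P v) t) = poly h t"
  using assms
proof induction
  case (const c)
  show ?case by (intro exI[of _ "[:of_rat c:]"]) simp
next
  case (var v)
  show ?case by (intro exI[of _ "P v"]) simp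
next
  case (add f g)
  then obtain h k where "\<forall>t. f (\<lambda>v. poly (P v) t) = poly h t" "\<forall>t. g (\<lambda>v. poly (P v) t) = poly k t"
    by blast
  then show ?case by (intro exI[of _ "h + k"]) simp
next
  case (mult f g)
  then obtain h k where "\<forall>t. f (\<lambda>v. poly (P v) t) = poly h t" "\<forall>t. g (\<lambda>v. poly (P v) t) = poly k t"
    by blast
  then show ?case by (intro exI[of _ "h * k"]) simp
qed

text \<open>Restriction to the line through a non-zero of \<open>f\<close> and a non-zero of \<open>g\<close> reduces this to one variable.\<close>

lemma polyfun_mult_eq_zero:
  assumes f: "f \<in> polyfun I" and g: "g \<in> polyfun I" and zero: "\<And>x. f x * g x = 0"
  shows "(\<forall>x. f x = 0) \<or> (\<forall>x. g x = 0)"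
proof (rule ccontr)
  assume "\<not> ?thesis"
  then obtain a b where ab: "f a \<noteq> 0" "g b \<noteq> 0"
    by blast
  define P where "P v = [:a v, b v - a v:]" for v
  obtain h k where hk: "\<And>t. f (\<lambda>v. poly (P v) t) = poly h t" "\<And>t. g (\<lambda>v. poly (P v) t) = poly k t"
    using polyfun_subst_poly[OF f] polyfun_subst_poly[OF g] by metis
  have "\<forall>t. poly (h * k) t = 0"
    using zero by (simp add: hk[symmetric])
  then have "h * k = 0"
    by (simp only: poly_all_0_iff_0)
  moreover have "poly h 0 \<noteq> 0" "poly k 1 \<noteq> 0"
    using ab by (simp_all add: hk[symmetric] P_def)
  ultimately show False
    by auto
qed

text \<open>
  The Heron form is, up to the sign, monic of degree two in each of its variables.
\<close>

lemma polyfun_divide_heron3: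
  fixes f :: "('v \<Rightarrow> 'a :: field_char_0) \<Rightarrow> 'a"
  assumes f: "f \<in> polyfun I" and u: "u \<in> I - {w}" "v \<in> I - {w}" and w: "w \<in> I"
  shows "\<exists>g\<in>polyfun I. \<exists>r0\<in>polyfun (I - {w}). \<exists>r1\<in>polyfun (I - {w}).
    \<forall>x :: 'v \<Rightarrow> 'a. f x = heron3 (x u) (x v) (x w) * g x + r0 x + x w * r1 x"
  using f
proof induction
  case (const c)
  show ?case
    by (intro bexI[of _ "\<lambda>x. 0"] bexI[of _ "\<lambda>x. of_rat c"]) (auto intro: polyfun_intros)
next
  case (var z)
  show ?case
  proof (cases "z = w")
    case True
    then show ?thesis
      by (intro bexI[of _ "\<lambda>x. 0"] bexI[of _ "\<lambda>x. 1"]) (auto intro: polyfun_intros)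
  next
    case False
    then show ?thesis
      using var by (intro bexI[of _ "\<lambda>x. 0"] bexI[of _ "\<lambda>x. x z"]) (auto intro: polyfun_intros)
  qed
next
  case (add f f')
  obtain g r0 r1 where *: "g \<in> polyfun I" "r0 \<in> polyfun (I - {w})" "r1 \<in> polyfun (I - {w})"
    "\<And>x. f x = heron3 (x u) (x v) (x w) * g x + r0 x + x w * r1 x"
    using add.IH(1) by blast
  obtain g' r0' r1' where **: "g' \<in> polyfun I" "r0' \<in> polyfun (I - {w})" "r1' \<in> polyfun (I - {w})"
    "\<And>x. f' x = heron3 (x u) (x v) (x w) * g' x + r0' x + x w * r1' x"
    using add.IH(2) by blast
  show ?case
  proof (intro bexI allI)
    show "f x + f' x = heron3 (x u) (x v) (x w) * (g x + g' x) + (r0 x + r0' x) + x w * (r1 x + r1' x)" for x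
      by (simp add: *(4) **(4) algebra_simps)
  qed (intro polyfun_intros * **)+
next
  case (mult f f')
  obtain g r0 r1 where *: "g \<in> polyfun I" "r0 \<in> polyfun (I - {w})" "r1 \<in> polyfun (I - {w})"
    "\<And>x. f x = heron3 (x u) (x v) (x w) * g x + r0 x + x w * r1 x"
    using mult.IH(1) by blast
  obtain g' r0' r1' where **: "g' \<in> polyfun I" "r0' \<in> polyfun (I - {w})" "r1' \<in> polyfun (I - {w})"
    "\<And>x. f' x = heron3 (x u) (x v) (x w) * g' x + r0' x + x w * r1' x"
    using mult.IH(2) by blast
  have up: "h \<in> polyfun I" if "h \<in> polyfun (I - {w})" for h :: "('v \<Rightarrow> 'a) \<Rightarrow> 'a"
    using that by (rule polyfun_mono) auto
  have uvw: "u \<in> I" "v \<in> I"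
    using u by auto
  show ?case
  proof (intro bexI allI)
    fix x :: "'v \<Rightarrow> 'a"
    have sq: "x w * x w = 2 * (x u + x v) * x w - (x u - x v)\<^sup>2 - heron3 (x u) (x v) (x w)"
      by (simp add: heron3_def algebra_simps power2_eq_square)
    define H where "H = heron3 (x u) (x v) (x w)"
    have "f x * f' x = H * (g x * (H * g' x + r0' x + x w * r1' x) + (r0 x + x w * r1 x) * g' x)
        + r0 x * r0' x + x w * (r0 x * r1' x + r1 x * r0' x) + (x w * x w) * (r1 x * r1' x)"
      by (simp add: *(4) **(4) H_def[symmetric] algebra_simps)
    also have "\<dots> = H * (g x * (H * g' x + r0' x + x w * r1' x) + (r0 x + x w * r1 x) * g' x - r1 x * r1' x)
        + (r0 x * r0' x - (x u - x v)\<^sup>2 * (r1 x * r1' x))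
        + x w * (r0 x * r1' x + r1 x * r0' x + 2 * (x u + x v) * (r1 x * r1' x))"
      unfolding sq H_def[symmetric] by (simp add: algebra_simps)
    finally show "f x * f' x = heron3 (x u) (x v) (x w) *
        (g x * (heron3 (x u) (x v) (x w) * g' x + r0' x + x w * r1' x) + (r0 x + x w * r1 x) * g' x - r1 x * r1' x)
        + (r0 x * r0' x - (x u - x v)\<^sup>2 * (r1 x * r1' x))
        + x w * (r0 x * r1' x + r1 x * r0' x + 2 * (x u + x v) * (r1 x * r1' x))"
      unfolding H_def .
  qed (intro polyfun_intros polyfun_heron3 * ** up u uvw w)+
qed

text \<open>
  The zeros of the Heron form \<open>heron3 (x u) (x v) (x w)\<close>, parametrized by square roots of \<open>x u\<close> and \<open>x v\<close>.
\<close>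

definition heron3_zero :: "'v \<Rightarrow> 'v \<Rightarrow> 'v \<Rightarrow> ('v \<Rightarrow> 'a :: comm_ring_1) \<Rightarrow> 'v \<Rightarrow> 'a" where
  "heron3_zero u v w y = y(u := (y u)\<^sup>2, v := (y v)\<^sup>2, w := (y u + y v)\<^sup>2)"

lemma polyfun_heron3_zero:
  assumes "f \<in> polyfun I" "u \<in> I" "v \<in> I" "w \<in> I"
  shows "(\<lambda>y. f (heron3_zero u v w y)) \<in> polyfun I"
proof (rule polyfun_subst[OF assms(1)])
  fix z assume z: "z \<in> I"
  have "(\<lambda>y. (y u)\<^sup>2) \<in> polyfun I" "(\<lambda>y. (y v)\<^sup>2) \<in> polyfun I" "(\<lambda>y. (y u + y v)\<^sup>2) \<in> polyfun I"
    "(\<lambda>y. y z) \<in> polyfun I"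
    using assms z by (intro polyfun_intros; simp)+
  then show "(\<lambda>y. heron3_zero u v w y z) \<in> polyfun I"
    unfolding heron3_zero_def fun_upd_apply
    by (cases "z = w"; cases "z = v"; cases "z = u") (simp_all only: if_True if_False simp_thms)
qed

text \<open>
  The remainder \<open>r0 + x w * r1\<close> of the division vanishes both for \<open>x w = (\<alpha> + \<beta>)\<^sup>2\<close> and for \<open>x w = (\<alpha> - \<beta>)\<^sup>2\<close>,
  whereas \<open>r0\<close> and \<open>r1\<close> depend on \<open>\<alpha>\<^sup>2\<close> and \<open>\<beta>\<^sup>2\<close> only.
\<close>

lemma polyfun_dvd_if_vanishes:
  fixes f :: "('v \<Rightarrow> 'a :: {alg_closed_field, field_char_0}) \<Rightarrow> 'a"
  assumes f: "f \<in> polyfun I" and uvw: "u \<in> I" "v \<in> I" "w \<in> I" "distinct [u, v, w]"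
    and zero: "\<And>y. f (heron3_zero u v w y) = 0"
  shows "\<exists>g\<in>polyfun I. \<forall>x. f x = heron3 (x u) (x v) (x w) * g x"
proof -
  obtain g r0 r1 where g: "g \<in> polyfun I" and r: "r0 \<in> polyfun (I - {w})" "r1 \<in> polyfun (I - {w})"
    and eq: "\<And>x. f x = heron3 (x u) (x v) (x w) * g x + r0 x + x w * r1 x"
    using polyfun_divide_heron3[OF f, of u w v] uvw by auto
  have key: "r1 y * (y u * y v) = 0 \<and> (r1 y = 0 \<longrightarrow> r0 y = 0)" for y
  proof -
    obtain \<alpha> \<beta> where ab: "\<alpha>\<^sup>2 = y u" "\<beta>\<^sup>2 = y v"
      using nth_root_exists[of 2 "y u"] nth_root_exists[of 2 "y v"] by auto
    have rel: "r0 y + (\<alpha> + \<gamma>)\<^sup>2 * r1 y = 0" if \<gamma>: "\<gamma>\<^sup>2 = y v" for \<gamma>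
    proof -
      define x where "x = heron3_zero u v w (y(u := \<alpha>, v := \<gamma>))"
      have x: "x u = \<alpha>\<^sup>2" "x v = \<gamma>\<^sup>2" "x w = (\<alpha> + \<gamma>)\<^sup>2" "\<And>z. z \<in> I - {w} \<Longrightarrow> x z = y z"
        using uvw ab \<gamma> by (auto simp: x_def heron3_zero_def)
      have "heron3 (x u) (x v) (x w) = 0"
        using heron3_scaled_squares[of 1 \<alpha> \<gamma>] by (simp add: x)
      moreover have "f x = 0"
        using zero by (simp add: x_def)
      moreover have "r0 x = r0 y" "r1 x = r1 y"
        using polyfun_cong[OF r(1) x(4)] polyfun_cong[OF r(2) x(4)] by simp_all
      ultimately show ?thesis
        using eq[of x] by (simp add: x)
    qed
    have plus: "r0 y + (\<alpha> + \<beta>)\<^sup>2 * r1 y = 0" and minus: "r0 y + (\<alpha> + - \<beta>)\<^sup>2 * r1 y = 0"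
      using ab by (intro rel; simp)+
    have "4 * (\<alpha> * \<beta> * r1 y) = (r0 y + (\<alpha> + \<beta>)\<^sup>2 * r1 y) - (r0 y + (\<alpha> + - \<beta>)\<^sup>2 * r1 y)"
      by (simp add: algebra_simps power2_eq_square)
    then have "\<alpha> * \<beta> * r1 y = 0"
      unfolding plus minus by simp
    then show ?thesis
      using plus ab by auto
  qed
  have up: "h \<in> polyfun I" if "h \<in> polyfun (I - {w})" for h :: "('v \<Rightarrow> 'a) \<Rightarrow> 'a"
    using that by (rule polyfun_mono) auto
  have "(\<forall>y. r1 y = 0) \<or> (\<forall>y :: 'v \<Rightarrow> 'a. y u * y v = 0)"
    using key uvw by (intro polyfun_mult_eq_zero[of _ I] up[OF r(2)] polyfun_intros) auto
  moreover have "\<not> (\<forall>y :: 'v \<Rightarrow> 'a. y u * y v = 0)"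
    by (auto intro!: exI[of _ "\<lambda>_. 1"])
  ultimately have "r1 y = 0" for y
    by blast
  then have "f x = heron3 (x u) (x v) (x w) * g x" for x
    using key[of x] eq[of x] by simp
  then show ?thesis
    using g by blast
qed

text \<open>
  The substitution by \<^const>\<open>heron3_zero\<close> is a ring homomorphism into an integral domain, so its kernel is
  prime, and by the previous lemma it is generated by the Heron form.  The factors \<open>q e\<close> can therefore be split
  off one after the other: none of them lies in the kernel that belongs to another one.
\<close>

lemma polyfun_prod_dvd:
  fixes f :: "('v \<Rightarrow> 'a :: {alg_closed_field, field_char_0}) \<Rightarrow> 'a" and q :: "'e \<Rightarrow> ('v \<Rightarrow> 'a) \<Rightarrow> 'a"
  assumes fin: "finite E" and f: "f \<in> polyfun I"
    and uvw: "\<And>e. e \<in> E \<Longrightarrow> u e \<in> I \<and> v e \<in> I \<and> w e \<in> I \<and> distinct [u e, v e, w e]"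
    and q: "\<And>e x. e \<in> E \<Longrightarrow> q e x = heron3 (x (u e)) (x (v e)) (x (w e))"
    and coprime: "\<And>e e'. e \<in> E \<Longrightarrow> e' \<in> E \<Longrightarrow> e \<noteq> e' \<Longrightarrow> \<exists>y. q e' (heron3_zero (u e) (v e) (w e) y) \<noteq> 0"
    and zero: "\<And>e y. e \<in> E \<Longrightarrow> f (heron3_zero (u e) (v e) (w e) y) = 0"
  shows "\<exists>g\<in>polyfun I. \<forall>x. f x = (\<Prod>e\<in>E. q e x) * g x"
  using fin uvw q coprime zero
proof (induction E rule: finite_induct)
  case empty
  then show ?case
    using f by auto
next
  case (insert e E)
  then obtain g where g: "g \<in> polyfun I" "\<And>x. f x = (\<Prod>e\<in>E. q e x) * g x"
    by (smt (verit) insertI2)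
  define \<sigma> where "\<sigma> = (heron3_zero (u e) (v e) (w e) :: ('v \<Rightarrow> 'a) \<Rightarrow> _)"
  have e: "u e \<in> I" "v e \<in> I" "w e \<in> I" "distinct [u e, v e, w e]"
    using insert.prems(1) by auto
  have pull: "(\<lambda>y. h (\<sigma> y)) \<in> polyfun I" if "h \<in> polyfun I" for h :: "('v \<Rightarrow> 'a) \<Rightarrow> 'a"
    unfolding \<sigma>_def by (rule polyfun_heron3_zero[OF that e(1-3)])
  have q_poly: "(\<lambda>y. q e' (\<sigma> y)) \<in> polyfun I" if "e' \<in> E" for e'
  proof -
    have "(\<lambda>x :: 'v \<Rightarrow> 'a. heron3 (x (u e')) (x (v e')) (x (w e'))) \<in> polyfun I"
      using insert.prems(1)[of e'] that by (intro polyfun_heron3 polyfun.var) auto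
    from pull[OF this] show ?thesis
      using insert.prems(2)[of e'] that by simp
  qed
  have coprime_e: "\<exists>y. q e' (heron3_zero (u e) (v e) (w e) y) \<noteq> 0" if "e' \<in> E" for e'
    using insert.prems(3)[of e e'] insert.hyps that by auto
  have prod: "(\<lambda>y. \<Prod>e'\<in>F. q e' (\<sigma> y)) \<in> polyfun I \<and> \<not> (\<forall>y. (\<Prod>e'\<in>F. q e' (\<sigma> y)) = 0)"
    if "F \<subseteq> E" for F
    using finite_subset[OF that insert.hyps(1)] that
  proof (induction F rule: finite_induct)
    case empty
    then show ?case by (simp add: polyfun_one)
  next
    case (insert e' F)
    have ne: "\<not> (\<forall>y. q e' (\<sigma> y) = 0)"
      using coprime_e[of e'] insert.prems by (auto simp: \<sigma>_def)
    have IH: "(\<lambda>y. \<Prod>e'\<in>F. q e' (\<sigma> y)) \<in> polyfun I" "\<not> (\<forall>y. (\<Prod>e'\<in>F. q e' (\<sigma> y)) = 0)"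
      using insert.IH insert.prems by auto
    have qe: "(\<lambda>y. q e' (\<sigma> y)) \<in> polyfun I"
      using q_poly insert.prems by simp
    show ?case
      using polyfun.mult[OF qe IH(1)] polyfun_mult_eq_zero[OF qe IH(1)] ne IH(2) insert.hyps
      by auto
  qed
  have "(\<Prod>e'\<in>E. q e' (\<sigma> y)) * g (\<sigma> y) = 0" for y
    using insert.prems(4)[of e y] g(2) by (simp add: \<sigma>_def)
  then have "(\<forall>y. (\<Prod>e'\<in>E. q e' (\<sigma> y)) = 0) \<or> (\<forall>y. g (\<sigma> y) = 0)"
    using prod[of E] pull[OF g(1)] by (intro polyfun_mult_eq_zero[of _ I]) auto
  then have "\<And>y. g (heron3_zero (u e) (v e) (w e) y) = 0"
    using prod[of E] by (auto simp: \<sigma>_def)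
  then obtain g' where "g' \<in> polyfun I" "\<And>x. g x = heron3 (x (u e)) (x (v e)) (x (w e)) * g' x"
    using polyfun_dvd_if_vanishes[OF g(1) e] by blast
  then show ?case
    using insert.prems(2)[of e] insert.hyps by (intro bexI[of _ g']) (simp_all add: g(2) mult_ac)
qed

section \<open>A degenerating family of simplices\<close>

lemma exists_edge_function:
  assumes "labelling p q x y z"
  shows "\<exists>L :: nat set \<Rightarrow> 'b. L {p, q} = a1 \<and> L {p, x} = a2 \<and> L {p, y} = a3 \<and> L {p, z} = a4
    \<and> L {q, x} = a5 \<and> L {q, y} = a6 \<and> L {q, z} = a7 \<and> L {x, y} = a8 \<and> L {x, z} = a9 \<and> L {y, z} = a10"
  using assms unfolding labelling_def
  by (intro exI[of _ "(\<lambda>_. a1)({p, x} := a2, {p, y} := a3, {p, z} := a4, {q, x} := a5, {q, y} := a6,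
      {q, z} := a7, {x, y} := a8, {x, z} := a9, {y, z} := a10)"]) (auto simp: doubleton_eq_iff)

lemma exists_triangle_function:
  assumes "labelling p q x y z"
  shows "\<exists>P :: nat set \<Rightarrow> 'b. P {p, q, x} = a1 \<and> P {p, q, y} = a2 \<and> P {p, q, z} = a3 \<and> P {p, x, y} = a4
    \<and> P {p, x, z} = a5 \<and> P {p, y, z} = a6 \<and> P {q, x, y} = a7 \<and> P {q, x, z} = a8 \<and> P {q, y, z} = a9
    \<and> P {x, y, z} = a10"
proof -
  obtain L :: "nat set \<Rightarrow> 'b" where L: "L {p, q} = a10 \<and> L {p, x} = a9 \<and> L {p, y} = a8 \<and> L {p, z} = a7
    \<and> L {q, x} = a6 \<and> L {q, y} = a5 \<and> L {q, z} = a4 \<and> L {x, y} = a3 \<and> L {x, z} = a2 \<and> L {y, z} = a1"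
    using exists_edge_function[OF assms, of a10 a9 a8 a7 a6 a5 a4 a3 a2 a1] by blast
  have V: "{..4} = {p, q, x, y, z}" and dist: "distinct [p, q, x, y, z]"
    using assms by (simp_all only: labelling_def)
  have "{..4} - {p, q, x} = {y, z}" "{..4} - {p, q, y} = {x, z}" "{..4} - {p, q, z} = {x, y}"
    "{..4} - {p, x, y} = {q, z}" "{..4} - {p, x, z} = {q, y}" "{..4} - {p, y, z} = {q, x}"
    "{..4} - {q, x, y} = {p, z}" "{..4} - {q, x, z} = {p, y}" "{..4} - {q, y, z} = {p, x}"
    "{..4} - {x, y, z} = {p, q}"
    unfolding V using dist by auto
  then show ?thesis
    using L by (intro exI[of _ "\<lambda>T. L ({..4} - T)"]) simp
qed

lemma labelled_triangles:
  assumes "labelling p q x y z" "i \<le> 4" "j \<le> 4" "k \<le> 4" "distinct [i, j, k]"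
  shows "{i, j, k} \<in> {{p, q, x}, {p, q, y}, {p, q, z}, {p, x, y}, {p, x, z}, {p, y, z}, {q, x, y}, {q, x, z},
    {q, y, z}, {x, y, z}}"
proof -
  have "i \<in> {p, q, x, y, z}" "j \<in> {p, q, x, y, z}" "k \<in> {p, q, x, y, z}"
    using assms by (simp_all add: labelling_def)
  then show ?thesis
    using assms(5) by (elim insertE emptyE; simp add: insert_commute)
qed

text \<open>
  For \<open>r = 1 / t\<close> this isolates the pole: on the right hand side \<open>t\<close> occurs with non-negative exponents only.
\<close>

lemma gram4_rescale:
  assumes "r * t = 1"
  shows "gram4 (2 * (t * d)) (2 * (t * e0)) (2 * (t * e1)) (2 * (t * e2)) (2 * (r * g0)) (2 * (r * g1))
      (2 * (r * g2)) (2 * (r * a)) (2 * (r * b)) (2 * (r * c)) * t\<^sup>2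
    = 16 * gram4 d (t * e0) (t * e1) (t * e2) g0 g1 g2 a b c"
proof -
  have cancel: "r * (t * u) = u" for u
    using assms by (simp add: mult.assoc[symmetric])
  show ?thesis
    unfolding gram4_def by (simp add: assms cancel algebra_simps power2_eq_square)
qed

text \<open>
  The Gram matrix of the vectors from \<open>p\<close> to \<open>x\<close>, \<open>y\<close>, \<open>z\<close> is \<open>G\<^sub>0 / t + t G\<^sub>1\<close>, where \<open>G\<^sub>0\<close> has the entries
  \<open>- x\<^sub>k\<^sup>2\<close> on the diagonal and \<open>x\<^sub>k x\<^sub>l\<close> off it.  The principal minors of \<open>G\<^sub>0\<close> of size two vanish, and so does the sum of
  the entries of its adjugate, because \<open>x\<^sub>0 + x\<^sub>1 + x\<^sub>2 = 0\<close>; hence the faces \<open>pxy\<close>, \<open>pxz\<close>, \<open>pyz\<close>, \<open>xyz\<close> have no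
  pole.  But \<open>det G\<^sub>0 = 4 (x\<^sub>0 x\<^sub>1 x\<^sub>2)\<^sup>2\<close> is not zero, and this makes the volume infinite at \<open>t = 0\<close>.
  The vector from \<open>p\<close> to \<open>q\<close> has squared length \<open>- 4 t\<close> and the inner products \<open>t x\<^sub>k f\<^sub>k\<close> with the other three,
  so that the squared areas on the edge \<open>pq\<close> tend to \<open>x\<^sub>k\<^sup>2\<close>.  The entries \<open>b01\<close>, \<open>b02\<close>, \<open>b12\<close> and \<open>c\<close> of \<open>G\<^sub>1\<close>
  and the numbers \<open>f\<^sub>k\<close> are free, and they control the seven other areas.
\<close>

locale degenerate_simplex =
  fixes L :: "nat set \<Rightarrow> 'a :: field_char_0" and p q x y z :: nat
    and x0 x1 x2 b01 b02 b12 c f0 f1 f2 r t :: 'a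
  assumes lab: "labelling p q x y z" and sum_zero: "x2 = - x0 - x1" and rt: "r * t = 1"
    and pq: "L {p, q} = - 4 * t"
    and px: "L {p, x} = t * c - r * x0\<^sup>2" and py: "L {p, y} = - r * x1\<^sup>2" and pz: "L {p, z} = - r * x2\<^sup>2"
    and qx: "L {q, x} = L {p, x} - 4 * t - 2 * t * x0 * f0"
    and qy: "L {q, y} = L {p, y} - 4 * t - 2 * t * x1 * f1"
    and qz: "L {q, z} = L {p, z} - 4 * t - 2 * t * x2 * f2"
    and xy: "L {x, y} = L {p, x} + L {p, y} - 2 * (r * x0 * x1 + t * b01)"
    and xz: "L {x, z} = L {p, x} + L {p, z} - 2 * (r * x0 * x2 + t * b02)"
    and yz: "L {y, z} = L {p, y} + L {p, z} - 2 * (r * x1 * x2 + t * b12)"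
begin

lemmas edges = pq px py pz qx qy qz xy xz yz

lemma rt_cancel: "r * (t * u) = u"
  using rt by (simp add: mult.assoc[symmetric])

lemma dist: "distinct [p, q, x]" "distinct [p, q, y]" "distinct [p, q, z]" "distinct [p, x, y]" "distinct [p, x, z]"
  "distinct [p, y, z]" "distinct [q, x, y]" "distinct [q, x, z]" "distinct [q, y, z]" "distinct [x, y, z]"
  using lab by (auto simp: labelling_def)

lemma areas_pq:
  "4 * sqarea L {p, q, x} = 4 * x0\<^sup>2 + t\<^sup>2 * (- 4 * c - (x0 * f0)\<^sup>2)"
  "4 * sqarea L {p, q, y} = 4 * x1\<^sup>2 + t\<^sup>2 * (- (x1 * f1)\<^sup>2)"
  "4 * sqarea L {p, q, z} = 4 * x2\<^sup>2 + t\<^sup>2 * (- (x2 * f2)\<^sup>2)"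
  by (rule four_sqarea[OF dist(1)] four_sqarea[OF dist(2)] four_sqarea[OF dist(3)];
      simp add: edges heron3_def algebra_simps power2_eq_square rt rt_cancel)+

lemma areas_p:
  "4 * sqarea L {p, x, y} = - x1\<^sup>2 * c - 2 * x0 * x1 * b01 + t\<^sup>2 * (- b01\<^sup>2)"
  "4 * sqarea L {p, x, z} = - x2\<^sup>2 * c - 2 * x0 * x2 * b02 + t\<^sup>2 * (- b02\<^sup>2)"
  "4 * sqarea L {p, y, z} = - (2 * x1 * x2 * b12) + t\<^sup>2 * (- b12\<^sup>2)"
  by (rule four_sqarea[OF dist(4)] four_sqarea[OF dist(5)] four_sqarea[OF dist(6)];
      simp add: edges heron3_def algebra_simps power2_eq_square rt rt_cancel)+

lemma areas_q:
  "4 * sqarea L {q, x, y} = - x1\<^sup>2 * c - 2 * x0 * x1 * b01 - 2 * x0 * x1 * x2 * (f0 + f1) + 4 * x2\<^sup>2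
     + t\<^sup>2 * (- b01\<^sup>2 + 2 * x0 * f0 * b01 - 2 * x1 * f1 * (c - b01) - 4 * (c - 2 * b01) - (x1 * f1 - x0 * f0)\<^sup>2)"
  "4 * sqarea L {q, x, z} = - x2\<^sup>2 * c - 2 * x0 * x2 * b02 - 2 * x0 * x1 * x2 * (f0 + f2) + 4 * x1\<^sup>2
     + t\<^sup>2 * (- b02\<^sup>2 + 2 * x0 * f0 * b02 - 2 * x2 * f2 * (c - b02) - 4 * (c - 2 * b02) - (x2 * f2 - x0 * f0)\<^sup>2)"
  "4 * sqarea L {q, y, z} = - (2 * x1 * x2 * b12) - 2 * x0 * x1 * x2 * (f1 + f2) + 4 * x0\<^sup>2
     + t\<^sup>2 * (- b12\<^sup>2 + 2 * x1 * f1 * b12 + 2 * x2 * f2 * b12 + 8 * b12 - (x2 * f2 - x1 * f1)\<^sup>2)"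
  by (rule four_sqarea[OF dist(7)] four_sqarea[OF dist(8)] four_sqarea[OF dist(9)];
      simp add: edges sum_zero heron3_def algebra_simps power2_eq_square rt rt_cancel)+

lemma area_opposite:
  "4 * sqarea L {x, y, z} = (- x1\<^sup>2 * c - 2 * x0 * x1 * b01) + (- x2\<^sup>2 * c - 2 * x0 * x2 * b02)
     - 2 * x1 * x2 * b12 - 2 * x1 * x2 * c
     + t\<^sup>2 * (- b12\<^sup>2 - b02\<^sup>2 - b01\<^sup>2 + 2 * (b02 * b12 + b01 * b12 + b01 * b02 - b12 * c))"
  by (rule four_sqarea[OF dist(10)])
    (simp add: edges sum_zero heron3_def algebra_simps power2_eq_square rt rt_cancel)

lemma volume:
  "cm L 0 1 2 3 4 * t\<^sup>2 = 16 * gram4 (- 4) (t * (x0 * f0)) (t * (x1 * f1)) (t * (x2 * f2))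
     (t\<^sup>2 * c - x0\<^sup>2) (- x1\<^sup>2) (- x2\<^sup>2) (x1 * x2 + t\<^sup>2 * b12) (x0 * x2 + t\<^sup>2 * b02) (x0 * x1 + t\<^sup>2 * b01)"
proof -
  have "cm L p q x y z = gram4 (2 * (t * - 4)) (2 * (t * (x0 * f0))) (2 * (t * (x1 * f1))) (2 * (t * (x2 * f2)))
    (2 * (r * (t\<^sup>2 * c - x0\<^sup>2))) (2 * (r * - x1\<^sup>2)) (2 * (r * - x2\<^sup>2)) (2 * (r * (x1 * x2 + t\<^sup>2 * b12)))
    (2 * (r * (x0 * x2 + t\<^sup>2 * b02))) (2 * (r * (x0 * x1 + t\<^sup>2 * b01)))"
    unfolding cm_def
    by (rule arg_cong2[of _ _ _ _ gram4, THEN cong, THEN cong, THEN cong, THEN cong, THEN cong, THEN cong, THEN cong, THEN cong];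
      simp add: edges algebra_simps power2_eq_square rt rt_cancel)
  then show ?thesis
    using gram4_rescale[OF rt] cm_labelled[OF lab, of L] by metis
qed

end

text \<open>
  The seven parameters of the family are determined by the seven prescribed limits through linear equations.
\<close>

theorem degenerating_family:
  fixes H :: "nat set \<Rightarrow> 'a :: field_char_0"
  assumes lab: "labelling p q x y z"
    and nz: "x0 \<noteq> 0" "x1 \<noteq> 0" "x0 + x1 \<noteq> 0"
    and H: "H {p, q, x} = x0\<^sup>2" "H {p, q, y} = x1\<^sup>2" "H {p, q, z} = (x0 + x1)\<^sup>2"
  shows "\<exists>P w. poly w 0 \<noteq> 0 \<and>
    (\<forall>i j k. i \<le> 4 \<longrightarrow> j \<le> 4 \<longrightarrow> k \<le> 4 \<longrightarrow> distinct [i, j, k] \<longrightarrow> poly (P {i, j, k}) 0 = H {i, j, k}) \<and>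
    (\<forall>t. t \<noteq> 0 \<longrightarrow> (\<exists>L. cm L 0 1 2 3 4 * t\<^sup>2 = poly w t \<and>
      (\<forall>i j k. i \<le> 4 \<longrightarrow> j \<le> 4 \<longrightarrow> k \<le> 4 \<longrightarrow> distinct [i, j, k] \<longrightarrow>
        sqarea L {i, j, k} = poly (P {i, j, k}) t)))"
proof -
  define x2 where "x2 = - x0 - x1"
  have x2: "x2 \<noteq> 0" "x2\<^sup>2 = (x0 + x1)\<^sup>2"
    using nz by (auto simp: x2_def power2_eq_square algebra_simps add_eq_0_iff)
  define h01 h02 h12 where h: "h01 = 4 * H {p, x, y}" "h02 = 4 * H {p, x, z}" "h12 = 4 * H {p, y, z}"
  define c where "c = (h01 + h02 + h12 - 4 * H {x, y, z}) / (2 * x1 * x2)"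
  define b01 b02 b12 where b: "b01 = (- h01 - x1\<^sup>2 * c) / (2 * x0 * x1)" "b02 = (- h02 - x2\<^sup>2 * c) / (2 * x0 * x2)"
    "b12 = - h12 / (2 * x1 * x2)"
  define m where "m = x0 * x1 * x2"
  define d01 d02 d12 where d: "d01 = (h01 + 4 * x2\<^sup>2 - 4 * H {q, x, y}) / (2 * m)"
    "d02 = (h02 + 4 * x1\<^sup>2 - 4 * H {q, x, z}) / (2 * m)" "d12 = (h12 + 4 * x0\<^sup>2 - 4 * H {q, y, z}) / (2 * m)"
  define f0 f1 f2 where f: "f0 = (d01 + d02 - d12) / 2" "f1 = (d01 + d12 - d02) / 2" "f2 = (d02 + d12 - d01) / 2"
  have m: "m \<noteq> 0"
    using nz x2 by (simp add: m_def)
  have c_eq: "2 * x1 * x2 * c = h01 + h02 + h12 - 4 * H {x, y, z}"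
    using nz x2 by (simp add: c_def)
  have b_eq: "2 * x0 * x1 * b01 = - h01 - x1\<^sup>2 * c" "2 * x0 * x2 * b02 = - h02 - x2\<^sup>2 * c" "2 * x1 * x2 * b12 = - h12"
    using nz x2 by (simp_all add: b)
  have "f0 + f1 = d01" "f0 + f2 = d02" "f1 + f2 = d12"
    by (simp_all add: f field_simps)
  then have f_eq: "2 * x0 * x1 * x2 * (f0 + f1) = h01 + 4 * x2\<^sup>2 - 4 * H {q, x, y}"
    "2 * x0 * x1 * x2 * (f0 + f2) = h02 + 4 * x1\<^sup>2 - 4 * H {q, x, z}"
    "2 * x0 * x1 * x2 * (f1 + f2) = h12 + 4 * x0\<^sup>2 - 4 * H {q, y, z}"
    using m by (simp_all add: d m_def)
  obtain P :: "nat set \<Rightarrow> 'a poly" where P: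
    "P {p, q, x} = [:H {p, q, x}, 0, (- 4 * c - (x0 * f0)\<^sup>2) / 4:]"
    "P {p, q, y} = [:H {p, q, y}, 0, (- (x1 * f1)\<^sup>2) / 4:]"
    "P {p, q, z} = [:H {p, q, z}, 0, (- (x2 * f2)\<^sup>2) / 4:]"
    "P {p, x, y} = [:H {p, x, y}, 0, (- b01\<^sup>2) / 4:]"
    "P {p, x, z} = [:H {p, x, z}, 0, (- b02\<^sup>2) / 4:]"
    "P {p, y, z} = [:H {p, y, z}, 0, (- b12\<^sup>2) / 4:]"
    "P {q, x, y} = [:H {q, x, y}, 0,
      (- b01\<^sup>2 + 2 * x0 * f0 * b01 - 2 * x1 * f1 * (c - b01) - 4 * (c - 2 * b01) - (x1 * f1 - x0 * f0)\<^sup>2) / 4:]"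
    "P {q, x, z} = [:H {q, x, z}, 0,
      (- b02\<^sup>2 + 2 * x0 * f0 * b02 - 2 * x2 * f2 * (c - b02) - 4 * (c - 2 * b02) - (x2 * f2 - x0 * f0)\<^sup>2) / 4:]"
    "P {q, y, z} = [:H {q, y, z}, 0,
      (- b12\<^sup>2 + 2 * x1 * f1 * b12 + 2 * x2 * f2 * b12 + 8 * b12 - (x2 * f2 - x1 * f1)\<^sup>2) / 4:]"
    "P {x, y, z} = [:H {x, y, z}, 0,
      (- b12\<^sup>2 - b02\<^sup>2 - b01\<^sup>2 + 2 * (b02 * b12 + b01 * b12 + b01 * b02 - b12 * c)) / 4:]"
    by (rule exE[OF exists_triangle_function[OF lab]], elim conjE, rule that; assumption)
  define w where "w = 16 * gram4 [:- 4:] [:0, x0 * f0:] [:0, x1 * f1:] [:0, x2 * f2:] [:- x0\<^sup>2, 0, c:] [:- x1\<^sup>2:]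
    [:- x2\<^sup>2:] [:x1 * x2, 0, b12:] [:x0 * x2, 0, b02:] [:x0 * x1, 0, b01:]"
  have w: "poly w t = 16 * gram4 (- 4) (t * (x0 * f0)) (t * (x1 * f1)) (t * (x2 * f2))
     (t\<^sup>2 * c - x0\<^sup>2) (- x1\<^sup>2) (- x2\<^sup>2) (x1 * x2 + t\<^sup>2 * b12) (x0 * x2 + t\<^sup>2 * b02) (x0 * x1 + t\<^sup>2 * b01)" for t
    unfolding w_def gram4_def by (simp add: power2_eq_square algebra_simps)
  have "poly w 0 = - 256 * m\<^sup>2"
    unfolding w m_def gram4_def by (simp add: power2_eq_square algebra_simps)
  then have "poly w 0 \<noteq> 0"
    using m by simp
  moreover have "poly (P {i, j, k}) 0 = H {i, j, k}" if "i \<le> 4" "j \<le> 4" "k \<le> 4" "distinct [i, j, k]" for i j k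
    using labelled_triangles[OF lab that] by (elim insertE emptyE; simp only:) (simp_all add: P)
  moreover have "\<exists>L. cm L 0 1 2 3 4 * t\<^sup>2 = poly w t \<and> (\<forall>i j k. i \<le> 4 \<longrightarrow> j \<le> 4 \<longrightarrow> k \<le> 4 \<longrightarrow> distinct [i, j, k] \<longrightarrow>
        sqarea L {i, j, k} = poly (P {i, j, k}) t)" if t: "t \<noteq> 0" for t
  proof -
    define r where "r = 1 / t"
    obtain L :: "nat set \<Rightarrow> 'a" where L: "L {p, q} = - 4 * t" "L {p, x} = t * c - r * x0\<^sup>2" "L {p, y} = - r * x1\<^sup>2"
      "L {p, z} = - r * x2\<^sup>2" "L {q, x} = t * c - r * x0\<^sup>2 - 4 * t - 2 * t * x0 * f0"
      "L {q, y} = - r * x1\<^sup>2 - 4 * t - 2 * t * x1 * f1" "L {q, z} = - r * x2\<^sup>2 - 4 * t - 2 * t * x2 * f2"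
      "L {x, y} = t * c - r * x0\<^sup>2 + - r * x1\<^sup>2 - 2 * (r * x0 * x1 + t * b01)"
      "L {x, z} = t * c - r * x0\<^sup>2 + - r * x2\<^sup>2 - 2 * (r * x0 * x2 + t * b02)"
      "L {y, z} = - r * x1\<^sup>2 + - r * x2\<^sup>2 - 2 * (r * x1 * x2 + t * b12)"
      by (rule exE[OF exists_edge_function[OF lab]], elim conjE, rule that; assumption)
    interpret degenerate_simplex L p q x y z x0 x1 x2 b01 b02 b12 c f0 f1 f2 r t
      using lab t by unfold_locales (simp_all only: L x2_def r_def, simp)
    have quarter: "s = poly [:a, 0, e / 4:] t" if "4 * s = 4 * a + t\<^sup>2 * e" for s a e
    proof -
      have "s = (4 * s) / 4"
        by simp
      also have "\<dots> = (4 * a + t\<^sup>2 * e) / 4"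
        by (simp only: that)
      also have "\<dots> = poly [:a, 0, e / 4:] t"
        by (simp add: add_divide_distrib power2_eq_square)
      finally show ?thesis .
    qed
    have "sqarea L {p, q, x} = poly (P {p, q, x}) t" "sqarea L {p, q, y} = poly (P {p, q, y}) t"
      "sqarea L {p, q, z} = poly (P {p, q, z}) t"
      unfolding P by (rule quarter, simp only: areas_pq H x2(2))+
    moreover have "sqarea L {p, x, y} = poly (P {p, x, y}) t" "sqarea L {p, x, z} = poly (P {p, x, z}) t"
      "sqarea L {p, y, z} = poly (P {p, y, z}) t"
      unfolding P by (rule quarter, simp only: areas_p b_eq h, simp)+
    moreover have "sqarea L {q, x, y} = poly (P {q, x, y}) t" "sqarea L {q, x, z} = poly (P {q, x, z}) t"
      "sqarea L {q, y, z} = poly (P {q, y, z}) t"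
      unfolding P by (rule quarter, simp only: areas_q b_eq f_eq, simp)+
    moreover have "sqarea L {x, y, z} = poly (P {x, y, z}) t"
      unfolding P by (rule quarter, simp only: area_opposite b_eq c_eq, simp)
    ultimately have "sqarea L {i, j, k} = poly (P {i, j, k}) t"
      if "i \<le> 4" "j \<le> 4" "k \<le> 4" "distinct [i, j, k]" for i j k
      using labelled_triangles[OF lab that] by (elim insertE emptyE; simp only:)
    then show ?thesis
      using volume unfolding w by blast
  qed
  ultimately show ?thesis
    by blast
qed

section \<open>Functions of the areas that cancel the pole of the volume\<close>

definition edges :: "nat set set" where
  "edges = {e. e \<subseteq> {..4} \<and> card e = 2}"

definition triangles :: "nat set set" where
  "triangles = {T. T \<subseteq> {..4} \<and> card T = 3}"

lemma finite_edges: "finite edges"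
  by (simp add: edges_def)

lemma pair_in_edges: "{i, j} \<in> edges \<longleftrightarrow> i \<le> 4 \<and> j \<le> 4 \<and> i \<noteq> j"
  by (auto simp: edges_def card_insert_if)

lemma triple_in_triangles: "distinct [i, j, k] \<Longrightarrow> {i, j, k} \<in> triangles \<longleftrightarrow> i \<le> 4 \<and> j \<le> 4 \<and> k \<le> 4"
  by (auto simp: triangles_def)

lemma triangles_cases:
  assumes "T \<in> triangles"
  obtains i j k where "T = {i, j, k}" "distinct [i, j, k]" "i \<le> 4" "j \<le> 4" "k \<le> 4"
  using assms unfolding triangles_def by (auto simp: card_3_iff)

lemma edges_cases:
  assumes "e \<in> edges"
  obtains i j k l m where "labelling i j k l m" "e = {i, j}"
proof -
  obtain i j where ij: "e = {i, j}" "i \<noteq> j"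
    using assms unfolding edges_def by (auto simp: card_2_iff)
  then show thesis
    using assms exists_labelling[of i j] pair_in_edges[of i j] that by blast
qed

lemma labelling_le:
  assumes "labelling i j k l m"
  shows "i \<le> 4" "j \<le> 4" "k \<le> 4" "l \<le> 4" "m \<le> 4"
proof -
  have "{i, j, k, l, m} \<subseteq> {..4}"
    using assms by (simp add: labelling_def)
  then show "i \<le> 4" "j \<le> 4" "k \<le> 4" "l \<le> 4" "m \<le> 4"
    by simp_all
qed

lemma labelling_triangles:
  assumes "labelling i j k l m"
  shows "{i, j, k} \<in> triangles" "{i, j, l} \<in> triangles" "{i, j, m} \<in> triangles"
  using assms labelling_le[OF assms] by (auto simp: labelling_def triple_in_triangles)

lemma labelling_triangles_distinct:
  assumes "labelling i j k l m"
  shows "distinct [{i, j, k}, {i, j, l}, {i, j, m}]"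
proof -
  have "k \<notin> {i, j, l}" "k \<notin> {i, j, m}" "l \<notin> {i, j, m}"
    using assms by (auto simp: labelling_def)
  then show ?thesis
    by (metis distinct_length_2_or_more distinct_singleton insertCI)
qed

text \<open>
  Two triangles on the edge \<open>e'\<close> meet in \<open>e'\<close> only, so at most one of the three contains another edge \<open>e\<close>.  The
  value \<open>3\<close> is chosen because \<open>heron3 a 3 3 = a * (12 - a)\<close> is not zero for \<open>a = 1, 4, 9\<close>, the squares of
  \<open>1\<close>, \<open>2\<close> and \<open>1 + 2\<close>.
\<close>

lemma edge_heron_ne_zero:
  fixes x :: "nat set \<Rightarrow> 'a :: field_char_0"
  assumes e: "e \<in> edges" "e' \<in> edges" "e \<noteq> e'"
    and x: "\<And>T. T \<in> triangles \<Longrightarrow> e \<subseteq> T \<Longrightarrow> x T \<in> {1, 4, 9}"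
      "\<And>T. T \<in> triangles \<Longrightarrow> \<not> e \<subseteq> T \<Longrightarrow> x T = 3"
  shows "edge_heron x e' \<noteq> 0"
proof -
  obtain i j k l m where lab: "labelling i j k l m" and e': "e' = {i, j}"
    using e(2) by (rule edges_cases)
  have ne: "heron3 a 3 3 \<noteq> 0" "heron3 3 a 3 \<noteq> 0" "heron3 3 3 a \<noteq> 0" if "a \<in> {1, 3, 4, 9 :: 'a}" for a
    using that by (auto simp: heron3_def)
  have card_e: "card e = 2" "card e' = 2"
    using e by (simp_all add: edges_def)
  have two: "\<not> e \<subseteq> T'" if "e \<subseteq> T" "T \<inter> T' = e'" for T T'
  proof
    assume "e \<subseteq> T'"
    then have "e \<subseteq> e'"
      using that by blast
    then have "e = e'"
      using card_e by (intro card_subset_eq) (auto intro: card_ge_0_finite)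
    then show False
      using e(3) by contradiction
  qed
  have int: "{i, j, k} \<inter> {i, j, l} = e'" "{i, j, k} \<inter> {i, j, m} = e'" "{i, j, l} \<inter> {i, j, m} = e'"
    "{i, j, l} \<inter> {i, j, k} = e'" "{i, j, m} \<inter> {i, j, k} = e'" "{i, j, m} \<inter> {i, j, l} = e'"
    using lab by (auto simp: labelling_def e')
  note tri = labelling_triangles[OF lab]
  have mem: "x T \<in> {1, 3, 4, 9}" if "T \<in> triangles" for T
    using x[OF that] by auto
  have "\<exists>a \<in> {1, 3, 4, 9}. heron3 (x {i, j, k}) (x {i, j, l}) (x {i, j, m}) \<in> {heron3 a 3 3, heron3 3 a 3, heron3 3 3 a}"
  proof -
    consider "\<not> e \<subseteq> {i, j, l}" "\<not> e \<subseteq> {i, j, m}" | "\<not> e \<subseteq> {i, j, k}" "\<not> e \<subseteq> {i, j, m}"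
      | "\<not> e \<subseteq> {i, j, k}" "\<not> e \<subseteq> {i, j, l}"
      using two int by meson
    then show ?thesis
    proof cases
      case 1
      then show ?thesis using x(2)[OF tri(2)] x(2)[OF tri(3)] mem[OF tri(1)] by auto
    next
      case 2
      then show ?thesis using x(2)[OF tri(1)] x(2)[OF tri(3)] mem[OF tri(2)] by auto
    next
      case 3
      then show ?thesis using x(2)[OF tri(1)] x(2)[OF tri(2)] mem[OF tri(3)] by auto
    qed
  qed
  then obtain a where a: "a \<in> {1, 3, 4, 9}"
    and *: "heron3 (x {i, j, k}) (x {i, j, l}) (x {i, j, m}) \<in> {heron3 a 3 3, heron3 3 a 3, heron3 3 3 a}"
    by (rule bexE)
  show ?thesis
    unfolding e' edge_heron_labelled[OF lab] using * ne[OF a] by (elim insertE emptyE) simp_all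
qed

theorem polyfun_edge_heron_dvd:
  fixes f :: "(nat set \<Rightarrow> 'a :: {alg_closed_field, field_char_0}) \<Rightarrow> 'a"
  assumes f: "f \<in> polyfun triangles"
    and zero: "\<And>i j k l m y. labelling i j k l m \<Longrightarrow> f (heron3_zero {i, j, k} {i, j, l} {i, j, m} y) = 0"
  shows "\<exists>g\<in>polyfun triangles. \<forall>x. f x = (\<Prod>e\<in>edges. edge_heron x e) * g x"
proof -
  define Lab where "Lab e h \<longleftrightarrow> (\<exists>i j k l m. labelling i j k l m \<and> e = {i, j}
    \<and> h = ({i, j, k}, {i, j, l}, {i, j, m}))" for e h
  have "\<forall>e\<in>edges. \<exists>h. Lab e h"
    unfolding Lab_def by (meson edges_cases)
  then obtain h where h: "\<forall>e\<in>edges. Lab e (h e)"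
    using bchoice by blast
  define u v w where uvw: "u e = fst (h e)" "v e = fst (snd (h e))" "w e = snd (snd (h e))" for e
  have lab: "\<exists>i j k l m. labelling i j k l m \<and> e = {i, j} \<and> u e = {i, j, k} \<and> v e = {i, j, l} \<and> w e = {i, j, m}"
    if "e \<in> edges" for e
  proof -
    have "Lab e (h e)"
      using h that by blast
    then obtain i j k l m where "labelling i j k l m" "e = {i, j}" "h e = ({i, j, k}, {i, j, l}, {i, j, m})"
      unfolding Lab_def by blast
    then show ?thesis
      unfolding uvw by (intro exI[of _ i] exI[of _ j] exI[of _ k] exI[of _ l] exI[of _ m]) simp
  qed
  show ?thesis
  proof (rule polyfun_prod_dvd[where u = u and v = v and w = w and q = "\<lambda>e x. edge_heron x e", OF finite_edges f])
    fix e assume e_edge: "e \<in> edges"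
    obtain i j k l m where l: "labelling i j k l m" and e: "e = {i, j}"
      and eqs: "u e = {i, j, k}" "v e = {i, j, l}" "w e = {i, j, m}"
      using lab[OF e_edge] by (elim exE conjE)
    show "u e \<in> triangles \<and> v e \<in> triangles \<and> w e \<in> triangles \<and> distinct [u e, v e, w e]"
      unfolding eqs using labelling_triangles[OF l] labelling_triangles_distinct[OF l] by blast
    show "edge_heron x e = heron3 (x (u e)) (x (v e)) (x (w e))" for x :: "nat set \<Rightarrow> 'a"
      unfolding eqs unfolding e by (rule edge_heron_labelled[OF l])
    show "f (heron3_zero (u e) (v e) (w e) y) = 0" for y
      unfolding eqs by (rule zero[OF l])
    fix e' assume e': "e' \<in> edges" "e \<noteq> e'"
    define y :: "nat set \<Rightarrow> 'a" where "y T = (if T = {i, j, k} then 1 else if T = {i, j, l} then 2 else 3)" for T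
    define x where "x = heron3_zero {i, j, k} {i, j, l} {i, j, m} y"
    note d = labelling_triangles_distinct[OF l]
    have x: "x {i, j, k} = 1" "x {i, j, l} = 4" "x {i, j, m} = 9"
      "\<And>T. T \<notin> {{i, j, k}, {i, j, l}, {i, j, m}} \<Longrightarrow> x T = 3"
      using d by (auto simp: x_def heron3_zero_def y_def)
    have "edge_heron x e' \<noteq> 0"
    proof (rule edge_heron_ne_zero[OF e_edge e'])
      fix T assume T: "T \<in> triangles" "e \<subseteq> T"
      have "card (T - e) = 1"
        using T l by (subst card_Diff_subset) (auto simp: triangles_def e labelling_def)
      then obtain n where n: "T - e = {n}"
        by (auto simp: card_1_singleton_iff)
      then have "T = {i, j, n}"
        using T e by blast
      moreover have "n \<in> {i, j, k, l, m}" "n \<notin> e"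
        using n T l by (auto simp: labelling_def triangles_def)
      ultimately have "T \<in> {{i, j, k}, {i, j, l}, {i, j, m}}"
        unfolding e by blast
      then show "x T \<in> {1, 4, 9}"
        using x by auto
    next
      fix T assume "\<not> e \<subseteq> T"
      then have "T \<notin> {{i, j, k}, {i, j, l}, {i, j, m}}"
        unfolding e by blast
      then show "x T = 3"
        by (rule x(4))
    qed
    then show "\<exists>y :: nat set \<Rightarrow> 'a. edge_heron (heron3_zero (u e) (v e) (w e) y) e' \<noteq> 0"
      unfolding eqs x_def by (rule exI[of _ y])
  qed
qed

text \<open>
  On the degenerating family the volume is \<open>w / t\<^sup>2\<close> with \<open>w\<close> not zero at \<open>t = 0\<close>.  After multiplication by
  \<open>(\<kappa> t\<^sup>2)\<^sup>n\<close> the relation becomes a polynomial identity in \<open>t\<close>, and only its leading term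
  \<open>(b w)\<^sup>n\<close> survives at \<open>t = 0\<close>.
\<close>

theorem integral_relation_vanishes:
  fixes b :: "(nat set \<Rightarrow> 'a :: field_char_0) \<Rightarrow> 'a" and c :: "nat \<Rightarrow> (nat set \<Rightarrow> 'a) \<Rightarrow> 'a"
  assumes b: "b \<in> polyfun triangles" and c: "\<And>i. c i \<in> polyfun triangles" and lead: "\<And>x. c n x = 1"
    and \<kappa>: "\<kappa> \<noteq> 0"
    and rel: "\<And>L. (\<Sum>i\<le>n. c i (sqarea L) * (b (sqarea L) * (cm L 0 1 2 3 4 / \<kappa>)) ^ i) = 0"
    and lab: "labelling p q x y z"
  shows "b (heron3_zero {p, q, x} {p, q, y} {p, q, z} v) = 0"
proof -
  define \<sigma> where "\<sigma> = (heron3_zero {p, q, x} {p, q, y} {p, q, z} :: (nat set \<Rightarrow> 'a) \<Rightarrow> _)"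
  have generic: "b (\<sigma> v) = 0"
    if nz: "v {p, q, x} \<noteq> 0" "v {p, q, y} \<noteq> 0" "v {p, q, x} + v {p, q, y} \<noteq> 0" for v
  proof -
    have H: "\<sigma> v {p, q, x} = (v {p, q, x})\<^sup>2" "\<sigma> v {p, q, y} = (v {p, q, y})\<^sup>2"
      "\<sigma> v {p, q, z} = (v {p, q, x} + v {p, q, y})\<^sup>2"
      using labelling_triangles_distinct[OF lab] by (auto simp: \<sigma>_def heron3_zero_def)
    obtain P w where w: "poly w 0 \<noteq> 0"
      and P0: "\<And>i j k. i \<le> 4 \<Longrightarrow> j \<le> 4 \<Longrightarrow> k \<le> 4 \<Longrightarrow> distinct [i, j, k] \<Longrightarrow> poly (P {i, j, k}) 0 = \<sigma> v {i, j, k}"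
      and fam: "\<And>t. t \<noteq> 0 \<Longrightarrow> \<exists>L. cm L 0 1 2 3 4 * t\<^sup>2 = poly w t \<and>
        (\<forall>i j k. i \<le> 4 \<longrightarrow> j \<le> 4 \<longrightarrow> k \<le> 4 \<longrightarrow> distinct [i, j, k] \<longrightarrow> sqarea L {i, j, k} = poly (P {i, j, k}) t)"
      using degenerating_family[OF lab nz H] by blast
    obtain hb where hb: "\<And>t. b (\<lambda>T. poly (P T) t) = poly hb t"
      using polyfun_subst_poly[OF b] by blast
    have "\<forall>i. \<exists>h. \<forall>t. c i (\<lambda>T. poly (P T) t) = poly h t"
      using polyfun_subst_poly[OF c] by blast
    then obtain hc where hc: "\<And>i t. c i (\<lambda>T. poly (P T) t) = poly (hc i) t"
      by metis
    \<comment> \<open>The relation multiplied by \<open>(\<kappa> t\<^sup>2)\<^sup>n\<close>.\<close>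
    define R where "R = (\<Sum>i\<le>n. hc i * [:0, 0, \<kappa>:] ^ (n - i) * (hb * w) ^ i)"
    have "poly R t = 0" if t: "t \<noteq> 0" for t
    proof -
      obtain L where vol: "cm L 0 1 2 3 4 * t\<^sup>2 = poly w t"
        and area: "\<forall>i j k. i \<le> 4 \<longrightarrow> j \<le> 4 \<longrightarrow> k \<le> 4 \<longrightarrow> distinct [i, j, k] \<longrightarrow> sqarea L {i, j, k} = poly (P {i, j, k}) t"
        using fam[OF t] by blast
      have agree: "sqarea L T = poly (P T) t" if "T \<in> triangles" for T
        using that area by (elim triangles_cases) blast
      have val: "b (sqarea L) = poly hb t" "\<And>i. c i (sqarea L) = poly (hc i) t"
        using polyfun_cong[OF b agree] polyfun_cong[OF c agree] by (simp_all add: hb hc)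
      have cm: "cm L 0 1 2 3 4 / \<kappa> = poly w t / (\<kappa> * t\<^sup>2)"
        using t \<kappa> by (simp only: vol[symmetric]) (simp add: field_simps)
      have "poly (hc i) t * (\<kappa> * t\<^sup>2) ^ (n - i) * (poly hb t * poly w t) ^ i
          = (\<kappa> * t\<^sup>2) ^ n * (poly (hc i) t * (poly hb t * (poly w t / (\<kappa> * t\<^sup>2))) ^ i)" if "i \<le> n" for i
      proof -
        have split: "(\<kappa> * t\<^sup>2) ^ n = (\<kappa> * t\<^sup>2) ^ (n - i) * (\<kappa> * t\<^sup>2) ^ i"
          using that by (simp add: power_add[symmetric])
        have merge: "(poly hb t * poly w t) ^ i = (\<kappa> * t\<^sup>2) ^ i * (poly hb t * (poly w t / (\<kappa> * t\<^sup>2))) ^ i"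
          using t \<kappa> by (simp add: power_mult_distrib[symmetric])
        show ?thesis
          unfolding split merge by (simp only: mult_ac)
      qed
      then have "(\<Sum>i\<le>n. poly (hc i) t * (\<kappa> * t\<^sup>2) ^ (n - i) * (poly hb t * poly w t) ^ i)
          = (\<kappa> * t\<^sup>2) ^ n * (\<Sum>i\<le>n. c i (sqarea L) * (b (sqarea L) * (cm L 0 1 2 3 4 / \<kappa>)) ^ i)"
        unfolding cm val sum_distrib_left by (intro sum.cong) simp_all
      moreover have "poly [:0, 0, \<kappa>:] t = \<kappa> * t\<^sup>2"
        by (simp add: power2_eq_square)
      ultimately have "poly R t = (\<kappa> * t\<^sup>2) ^ n * (\<Sum>i\<le>n. c i (sqarea L) * (b (sqarea L) * (cm L 0 1 2 3 4 / \<kappa>)) ^ i)"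
        unfolding R_def by (simp only: poly_sum poly_mult poly_power)
      then show ?thesis
        by (simp only: rel mult_zero_right)
    qed
    then have "\<forall>t. poly ([:0, 1:] * R) t = 0"
      by auto
    then have "[:0, 1:] * R = 0"
      by (simp only: poly_all_0_iff_0)
    then have "R = 0"
      by (metis mult_eq_0_iff pCons_eq_0_iff zero_neq_one)
    moreover have "poly R 0 = (poly hb 0 * poly w 0) ^ n"
    proof -
      have "poly R 0 = (\<Sum>i\<le>n. poly (hc i) 0 * 0 ^ (n - i) * (poly hb 0 * poly w 0) ^ i)"
        by (simp add: R_def poly_sum)
      also have "\<dots> = (\<Sum>i\<in>{n}. poly (hc i) 0 * 0 ^ (n - i) * (poly hb 0 * poly w 0) ^ i)"
        by (intro sum.mono_neutral_right) (auto simp: power_0_left)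
      also have "\<dots> = (poly hb 0 * poly w 0) ^ n"
        by (simp add: hc[symmetric] lead)
      finally show ?thesis .
    qed
    ultimately have "poly hb 0 = 0"
      using w by simp
    moreover have "b (\<sigma> v) = b (\<lambda>T. poly (P T) 0)"
      using P0 by (intro polyfun_cong[OF b]) (auto elim!: triangles_cases)
    ultimately show ?thesis
      by (simp add: hb)
  qed
  note tri = labelling_triangles[OF lab]
  \<comment> \<open>The family exists where the first factor is not zero; it can be cancelled because polynomial functions form a domain.\<close>
  have "(\<forall>v :: nat set \<Rightarrow> 'a. v {p, q, x} * v {p, q, y} * (v {p, q, x} + v {p, q, y}) = 0) \<or> (\<forall>v. b (\<sigma> v) = 0)"
    using generic unfolding \<sigma>_def
    by (intro polyfun_mult_eq_zero[of _ triangles] polyfun_heron3_zero[OF b] polyfun_intros tri) auto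
  moreover have "\<not> (\<forall>v :: nat set \<Rightarrow> 'a. v {p, q, x} * v {p, q, y} * (v {p, q, x} + v {p, q, y}) = 0)"
    by (auto intro!: exI[of _ "\<lambda>_. 1"])
  ultimately have "\<forall>v. b (\<sigma> v) = 0"
    by blast
  then show ?thesis
    by (simp add: \<sigma>_def)
qed

section \<open>Specialization of the edge lengths\<close>

definition monomial_value :: "('v \<Rightarrow> 'a :: field_char_0) \<Rightarrow> ('v \<Rightarrow>\<^sub>0 nat) \<Rightarrow> 'a" where
  "monomial_value \<xi> m = (\<Prod>a\<in>Poly_Mapping.keys m. \<xi> a ^ Poly_Mapping.lookup m a)"

text \<open>
  The evaluation homomorphism from \<open>\<rat>[\<xi>]\<close>, as a sum over the monomials of \<open>P\<close>.
\<close>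

definition insertion :: "('v \<Rightarrow> 'a :: field_char_0) \<Rightarrow> (('v \<Rightarrow>\<^sub>0 nat) \<Rightarrow>\<^sub>0 rat) \<Rightarrow> 'a" where
  "insertion \<xi> P = (\<Sum>m\<in>Poly_Mapping.keys P. of_rat (Poly_Mapping.lookup P m) * monomial_value \<xi> m)"

lemma monomial_value_superset:
  assumes "finite K" "Poly_Mapping.keys m \<subseteq> K"
  shows "monomial_value \<xi> m = (\<Prod>a\<in>K. \<xi> a ^ Poly_Mapping.lookup m a)"
  unfolding monomial_value_def using assms
  by (intro prod.mono_neutral_left) (auto simp: in_keys_iff)

lemma monomial_value_zero: "monomial_value \<xi> 0 = 1"
  by (simp add: monomial_value_def)

lemma monomial_value_add: "monomial_value \<xi> (m + n) = monomial_value \<xi> m * monomial_value \<xi> n"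
proof -
  define K where "K = Poly_Mapping.keys m \<union> Poly_Mapping.keys n"
  have "finite K" "Poly_Mapping.keys m \<subseteq> K" "Poly_Mapping.keys n \<subseteq> K" "Poly_Mapping.keys (m + n) \<subseteq> K"
    using keys_add[of m n] by (auto simp: K_def)
  then show ?thesis
    by (simp add: monomial_value_superset[of K] lookup_add power_add prod.distrib)
qed

lemma insertion_superset:
  assumes "finite K" "Poly_Mapping.keys P \<subseteq> K"
  shows "insertion \<xi> P = (\<Sum>m\<in>K. of_rat (Poly_Mapping.lookup P m) * monomial_value \<xi> m)"
  unfolding insertion_def using assms
  by (intro sum.mono_neutral_left) (auto simp: in_keys_iff)

lemma insertion_add: "insertion \<xi> (P + P') = insertion \<xi> P + insertion \<xi> P'"
proof -
  define K where "K = Poly_Mapping.keys P \<union> Poly_Mapping.keys P'"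
  have "finite K" "Poly_Mapping.keys P \<subseteq> K" "Poly_Mapping.keys P' \<subseteq> K" "Poly_Mapping.keys (P + P') \<subseteq> K"
    using keys_add[of P P'] by (auto simp: K_def)
  then show ?thesis
    by (simp add: insertion_superset[of K] lookup_add of_rat_add distrib_right sum.distrib)
qed

lemma insertion_zero: "insertion \<xi> 0 = 0"
  by (simp add: insertion_def)

lemma insertion_single: "insertion \<xi> (Poly_Mapping.single m c) = of_rat c * monomial_value \<xi> m"
  by (subst insertion_superset[of "{m}"]) (simp_all add: keys_single)

lemma poly_mapping_single_induct:
  fixes R :: "('k \<Rightarrow>\<^sub>0 'b :: monoid_add) \<Rightarrow> bool"
  assumes "R 0" "\<And>P m c. R P \<Longrightarrow> R (P + Poly_Mapping.single m c)"
  shows "R P"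
proof (induction P rule: update_induct)
  case const
  show ?case by fact
next
  case (update P m c)
  have "Poly_Mapping.update m c P = P + Poly_Mapping.single m c"
    using update(1)
    by (intro poly_mapping_eqI) (auto simp: lookup_update lookup_add lookup_single in_keys_iff when_def)
  then show ?case
    using update(3) assms(2) by simp
qed

lemma insertion_mult: "insertion \<xi> (P * P') = insertion \<xi> P * insertion \<xi> P'"
proof (induction P rule: poly_mapping_single_induct)
  case 1
  show ?case by (simp add: insertion_zero)
next
  case (2 P m c)
  have "insertion \<xi> (Poly_Mapping.single m c * P') = insertion \<xi> (Poly_Mapping.single m c) * insertion \<xi> P'"
  proof (induction P' rule: poly_mapping_single_induct)
    case 1
    show ?case by (simp add: insertion_zero)
  next
    case (2 P' n d)
    then show ?case
      by (simp add: distrib_left insertion_add mult_single insertion_single monomial_value_add of_rat_mult)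
  qed
  then show ?case
    using 2 by (simp add: distrib_right insertion_add)
qed

lemma of_rat_unique:
  fixes h :: "rat \<Rightarrow> 'a :: field_char_0"
  assumes one: "h 1 = 1" and add: "\<And>a b. h (a + b) = h a + h b" and mult: "\<And>a b. h (a * b) = h a * h b"
  shows "h c = of_rat c"
proof -
  have zero: "h 0 = 0"
    using add[of 0 0] by simp
  have nat: "h (of_nat n) = of_nat n" for n
    by (induction n) (simp_all add: zero one add)
  have "h (- a) = - h a" for a
    using add[of a "- a"] zero by (simp add: add_eq_0_iff)
  then have int: "h (of_int n) = of_int n" for n
    by (cases n rule: int_diff_cases) (simp add: diff_conv_add_uminus add nat del: add_uminus_conv_diff)
  obtain a b where c: "c = Rat.Fract a b" "b > 0"
    by (cases c rule: Rat_cases) auto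
  then have "of_int b * c = of_int a"
    by (simp add: Fract_of_int_quotient)
  then have "of_int b * h c = of_int a"
    using mult[of "of_int b" c] by (simp add: int)
  moreover have "of_int b * of_rat c = (of_int a :: 'a)"
    using \<open>of_int b * c = of_int a\<close> by (metis of_rat_mult of_rat_of_int_eq)
  ultimately have "of_int b * h c = of_int b * of_rat c"
    by simp
  then show ?thesis
    using c(2) by simp
qed

lemma of_rat_lfield: "(of_rat c :: lfield) = to_ac (to_fract (Poly_Mapping.single 0 c))"
proof (rule of_rat_unique[symmetric])
  fix a b :: rat
  have "Poly_Mapping.single (0 :: edge \<Rightarrow>\<^sub>0 nat) (a * b) = Poly_Mapping.single 0 a * Poly_Mapping.single 0 b"
    by (simp add: mult_single)
  then show "(to_ac (to_fract (Poly_Mapping.single 0 (a * b))) :: lfield)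
    = to_ac (to_fract (Poly_Mapping.single 0 a)) * to_ac (to_fract (Poly_Mapping.single 0 b))"
    by (simp only: to_fract_mult to_ac_mult)
qed (simp_all add: single_add)

definition generic_length :: "nat set \<Rightarrow> lfield" where
  "generic_length e = edge_length (Min e) (Max e)"

definition edge_of :: "nat set \<Rightarrow> edge" where
  "edge_of e = Abs_edge (Min e, Max e)"

lemma Rep_edge_of:
  assumes "e \<in> edges"
  shows "Rep_edge (edge_of e) = (Min e, Max e)" "{Min e, Max e} = e"
proof -
  obtain i j where e: "e = {i, j}" "i \<noteq> j"
    using assms unfolding edges_def by (auto simp: card_2_iff)
  then have "i \<le> 4" "j \<le> 4"
    using assms pair_in_edges by auto
  then have "(Min e, Max e) \<in> {(i, j). i < j \<and> j \<le> 4}"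
    using e by auto
  then show "Rep_edge (edge_of e) = (Min e, Max e)"
    unfolding edge_of_def by (rule Abs_edge_inverse)
  show "{Min e, Max e} = e"
    using e by (auto simp: min_def max_def)
qed

lemma generic_length_eq:
  assumes "e \<in> edges"
  shows "generic_length e = to_ac (to_fract (Poly_Mapping.single (Poly_Mapping.single (edge_of e) 1) 1))"
proof -
  have "Min e \<le> Max e"
    using assms by (intro Min_le) (auto simp: edges_def card_2_iff)
  then show ?thesis
    by (simp add: generic_length_def edge_length_def edge_of_def)
qed

text \<open>
  The generic lengths are variables, so a polynomial relation between them is the zero polynomial.
\<close>

lemma generic_relation_specializes:
  assumes f: "f \<in> polyfun edges" and zero: "f generic_length = 0"
  shows "f x = 0"
proof -
  have "\<exists>P. f generic_length = to_ac (to_fract P) \<and> (\<forall>\<xi> :: edge \<Rightarrow> lfield. f (\<lambda>e. \<xi> (edge_of e)) = insertion \<xi> P)"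
    using f
  proof induction
    case (const c)
    show ?case
      by (intro exI[of _ "Poly_Mapping.single 0 c"]) (simp add: of_rat_lfield insertion_single monomial_value_zero)
  next
    case (var e)
    have "monomial_value \<xi> (Poly_Mapping.single a (1 :: nat)) = \<xi> a" for \<xi> :: "edge \<Rightarrow> lfield" and a
      by (simp add: monomial_value_def keys_single)
    then show ?case
      by (intro exI[of _ "Poly_Mapping.single (Poly_Mapping.single (edge_of e) 1) 1"])
        (simp add: generic_length_eq[OF var] insertion_single)
  next
    case (add f g)
    then obtain P P' where "f generic_length = to_ac (to_fract P)" "g generic_length = to_ac (to_fract P')"
      "\<forall>\<xi>. f (\<lambda>e. \<xi> (edge_of e)) = insertion \<xi> P" "\<forall>\<xi>. g (\<lambda>e. \<xi> (edge_of e)) = insertion \<xi> P'"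
      by blast
    then show ?case
      by (intro exI[of _ "P + P'"]) (simp add: insertion_add)
  next
    case (mult f g)
    then obtain P P' where "f generic_length = to_ac (to_fract P)" "g generic_length = to_ac (to_fract P')"
      "\<forall>\<xi>. f (\<lambda>e. \<xi> (edge_of e)) = insertion \<xi> P" "\<forall>\<xi>. g (\<lambda>e. \<xi> (edge_of e)) = insertion \<xi> P'"
      by blast
    then show ?case
      by (intro exI[of _ "P * P'"]) (simp add: insertion_mult)
  qed
  then obtain P where P: "f generic_length = to_ac (to_fract P)"
    "\<And>\<xi> :: edge \<Rightarrow> lfield. f (\<lambda>e. \<xi> (edge_of e)) = insertion \<xi> P"
    by blast
  have "P = 0"
    using P(1) zero by simp
  define \<xi> where "\<xi> a = x {fst (Rep_edge a), snd (Rep_edge a)}" for a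
  have "f x = f (\<lambda>e. \<xi> (edge_of e))"
    by (intro polyfun_cong[OF f]) (simp add: \<xi>_def Rep_edge_of)
  also have "\<dots> = 0"
    by (simp add: P(2) \<open>P = 0\<close> insertion_zero)
  finally show ?thesis .
qed

section \<open>The denominator ideal\<close>

definition generic_sq :: "nat set \<Rightarrow> lfield" where
  "generic_sq e = (generic_length e)\<^sup>2"

lemma sq_length_eq: "sq_length i j = generic_sq {i, j}"
  by (simp add: sq_length_def generic_sq_def generic_length_def edge_length_def min_def max_def)

lemma S_eq: "distinct [i, j, k] \<Longrightarrow> S i j k = sqarea generic_sq {i, j, k}"
  by (simp add: S_def sq_length_eq sqarea_three heron3_def insert_commute algebra_simps)

lemma W_eq: "W = cm generic_sq 0 1 2 3 4 / 9216"
proof -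
  have "det cayley_menger = - cm generic_sq 0 1 2 3 4"
    unfolding cayley_menger_def by (rule det_cayley_menger) (rule sq_length_eq)
  then show ?thesis
    by (simp add: W_def fact_numeral)
qed

lemma sorted_triple:
  fixes i j k :: nat
  assumes "distinct [i, j, k]"
  obtains a b c where "a < b" "b < c" "{a, b, c} = {i, j, k}"
proof -
  consider "i < j" "j < k" | "i < k" "k < j" | "j < i" "i < k" | "j < k" "k < i" | "k < i" "i < j" | "k < j" "j < i"
    using assms by force
  then show thesis
  proof cases
    case 1 then show ?thesis using that[of i j k] by auto
  next
    case 2 then show ?thesis using that[of i k j] by auto
  next
    case 3 then show ?thesis using that[of j i k] by auto
  next
    case 4 then show ?thesis using that[of j k i] by auto
  next
    case 5 then show ?thesis using that[of k i j] by auto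
  next
    case 6 then show ?thesis using that[of k j i] by auto
  qed
qed

lemma edge_splits_iff: "(i, j, k, l, m) \<in> edge_splits \<longleftrightarrow> i < j \<and> k < l \<and> l < m \<and> labelling i j k l m"
proof -
  have "distinct [i, j, k, l, m]" if "{i, j, k, l, m} = {..4}"
    using that by (intro card_distinct) simp
  then show ?thesis
    unfolding edge_splits_def labelling_def vertices_eq by auto
qed

lemma bij_betw_edge_splits: "bij_betw (\<lambda>(i, j, k, l, m). {i, j}) edge_splits edges"
  unfolding bij_betw_def
proof (intro conjI inj_onI subset_antisym subsetI)
  fix s s' assume s: "s \<in> edge_splits" "s' \<in> edge_splits"
    and eq: "(case s of (i, j, k, l, m) \<Rightarrow> {i, j}) = (case s' of (i, j, k, l, m) \<Rightarrow> {i, j})"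
  obtain i j k l m where t: "s = (i, j, k, l, m)" by (cases s)
  obtain i' j' k' l' m' where t': "s' = (i', j', k', l', m')" by (cases s')
  have lt: "i < j" "k < l" "l < m" "labelling i j k l m" "i' < j'" "k' < l'" "l' < m'" "labelling i' j' k' l' m'"
    using s unfolding t t' edge_splits_iff by simp_all
  have ij: "i = i'" "j = j'"
    using eq lt unfolding t t' by (auto simp: doubleton_eq_iff)
  have "{k, l, m} = {..4} - {i, j}" "{k', l', m'} = {..4} - {i', j'}"
    using lt unfolding labelling_def by auto
  then have "set [k, l, m] = set [k', l', m']"
    by (simp add: ij)
  then have "[k, l, m] = [k', l', m']"
    using lt by (intro sorted_distinct_set_unique) auto
  then show "s = s'"
    by (simp add: t t' ij)
next
  fix e assume "e \<in> (\<lambda>(i, j, k, l, m). {i, j}) ` edge_splits"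
  then obtain i j k l m where "(i, j, k, l, m) \<in> edge_splits" "e = {i, j}"
    by auto
  then show "e \<in> edges"
    using labelling_le[of i j k l m] by (simp add: edge_splits_iff pair_in_edges)
next
  fix e assume "e \<in> edges"
  then obtain i j k l m where lab: "labelling i j k l m" "e = {i, j}"
    by (rule edges_cases)
  obtain a b c where abc: "a < b" "b < c" "{a, b, c} = {k, l, m}"
    using lab by (elim sorted_triple[of k l m, rotated]) (auto simp: labelling_def)
  define i' j' where "i' = min i j" "j' = max i j"
  have ij: "{i', j'} = {i, j}" "i' < j'"
    using lab by (auto simp: i'_j'_def labelling_def min_def max_def)
  have "{i', j', a, b, c} = {i', j'} \<union> {a, b, c}"
    by auto
  also have "\<dots> = {..4}"
    unfolding ij abc using lab by (auto simp: labelling_def)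
  finally have "{i', j', a, b, c} = {..4}" .
  moreover from this have "distinct [i', j', a, b, c]"
    by (intro card_distinct) simp
  ultimately have "(i', j', a, b, c) \<in> edge_splits"
    using ij abc by (simp add: edge_splits_iff labelling_def)
  then show "e \<in> (\<lambda>(i, j, k, l, m). {i, j}) ` edge_splits"
    using ij lab by (intro image_eqI[of _ _ "(i', j', a, b, c)"]) simp_all
qed

lemma edge_splits_heron:
  assumes "(i, j, k, l, m) \<in> edge_splits"
  shows "edge_heron (sqarea generic_sq) {i, j} = heron3 (S i j k) (S i j l) (S i j m)"
proof -
  have lab: "labelling i j k l m"
    using assms by (simp add: edge_splits_iff)
  then have "distinct [i, j, k]" "distinct [i, j, l]" "distinct [i, j, m]"
    by (auto simp: labelling_def)
  then show ?thesis
    by (simp only: edge_heron_labelled[OF lab] S_eq)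
qed

lemma Q_eq: "Q = (\<Prod>e\<in>edges. edge_heron (sqarea generic_sq) e)"
proof -
  have "(\<Prod>e\<in>edges. edge_heron (sqarea generic_sq) e)
    = (\<Prod>s\<in>edge_splits. edge_heron (sqarea generic_sq) (case s of (i, j, k, l, m) \<Rightarrow> {i, j}))"
    by (rule prod.reindex_bij_betw[OF bij_betw_edge_splits, symmetric])
  also have "\<dots> = Q"
    unfolding Q_def by (intro prod.cong) (auto simp: edge_splits_heron heron3_def)
  finally show ?thesis ..
qed

lemma area_ring_simps:
  "x \<otimes>\<^bsub>area_ring\<^esub> y = x * y"
  "carrier area_ring = generate_ring ring_of_type_algebra (\<rat> \<union> {S i j k | i j k. i < j \<and> j < k \<and> k \<le> 4})"
  by (simp_all add: area_ring_def ring_of_type_algebra_def)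

lemma carrier_area_ring: "carrier area_ring = {f (sqarea generic_sq) | f. f \<in> polyfun triangles}" (is "_ = ?P")
proof -
  interpret cring "ring_of_type_algebra :: lfield ring"
    by (rule cring_from_type_algebra)
  have ops: "x \<oplus>\<^bsub>ring_of_type_algebra\<^esub> y = x + y" "x \<otimes>\<^bsub>ring_of_type_algebra\<^esub> y = x * y"
    "\<one>\<^bsub>ring_of_type_algebra\<^esub> = (1 :: lfield)" "\<zero>\<^bsub>ring_of_type_algebra\<^esub> = (0 :: lfield)"
    "x \<in> carrier ring_of_type_algebra" for x y :: lfield
    by (simp_all add: ring_of_type_algebra_def)
  have uminus: "\<ominus>\<^bsub>ring_of_type_algebra\<^esub> x = - x" for x :: lfield
    by (rule minus_equality) (simp_all add: ops)
  have memI: "x \<in> ?P" if "f \<in> polyfun triangles" "x = f (sqarea generic_sq)" for f x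
    using that by blast
  show ?thesis
  proof (intro subset_antisym subsetI)
    fix x assume "x \<in> carrier area_ring"
    then show "x \<in> ?P"
      unfolding area_ring_simps
    proof induction
      case one
      show ?case
        by (rule memI[OF polyfun_one]) (simp add: ops)
    next
      case (incl x)
      then show ?case
      proof
        assume "x \<in> \<rat>"
        then obtain c where "x = of_rat c"
          by (rule Rats_cases)
        then show ?thesis
          by (rule memI[OF polyfun.const])
      next
        assume "x \<in> {S i j k | i j k. i < j \<and> j < k \<and> k \<le> 4}"
        then obtain i j k where x: "x = S i j k" "i < j" "j < k" "k \<le> 4"
          by blast
        then have "{i, j, k} \<in> triangles"
          by (simp add: triple_in_triangles)
        then show ?thesis
          by (rule memI[OF polyfun.var]) (use x in \<open>simp add: S_eq\<close>)
      qed
    next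
      case (a_inv x)
      then obtain f where f: "f \<in> polyfun triangles" "x = f (sqarea generic_sq)"
        by blast
      show ?case
        by (rule memI[OF polyfun_uminus[OF f(1)]]) (simp add: uminus f(2))
    next
      case (eng_add x y)
      then obtain f g where fg: "f \<in> polyfun triangles" "x = f (sqarea generic_sq)"
        "g \<in> polyfun triangles" "y = g (sqarea generic_sq)"
        by blast
      show ?case
        by (rule memI[OF polyfun.add[OF fg(1,3)]]) (simp add: ops fg(2,4))
    next
      case (eng_mult x y)
      then obtain f g where fg: "f \<in> polyfun triangles" "x = f (sqarea generic_sq)"
        "g \<in> polyfun triangles" "y = g (sqarea generic_sq)"
        by blast
      show ?case
        by (rule memI[OF polyfun.mult[OF fg(1,3)]]) (simp add: ops fg(2,4))
    qed
  next
    fix x assume "x \<in> ?P"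
    then obtain f where f: "f \<in> polyfun triangles" "x = f (sqarea generic_sq)"
      by blast
    from f(1) have "f (sqarea generic_sq) \<in> carrier area_ring"
    proof induction
      case (const c)
      show ?case
        unfolding area_ring_simps by (intro generate_ring.incl) simp
    next
      case (var T)
      obtain i j k where T: "T = {i, j, k}" "distinct [i, j, k]" "i \<le> 4" "j \<le> 4" "k \<le> 4"
        using var by (rule triangles_cases)
      obtain a b c where abc: "a < b" "b < c" "{a, b, c} = T"
        using T(1,2) sorted_triple by metis
      then have "c \<in> {i, j, k}"
        using T(1) by auto
      then have "c \<le> 4"
        using T by auto
      moreover have "sqarea generic_sq T = S a b c"
        using abc by (simp add: S_eq abc(3)[symmetric])
      ultimately show ?case
        unfolding area_ring_simps using abc by (intro generate_ring.incl) auto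
    next
      case (add f g)
      show ?case
        using generate_ring.eng_add[OF add.IH[unfolded area_ring_simps]] by (simp only: area_ring_simps ops)
    next
      case (mult f g)
      show ?case
        using generate_ring.eng_mult[OF mult.IH[unfolded area_ring_simps]] by (simp only: area_ring_simps ops)
    qed
    then show "x \<in> carrier area_ring"
      by (simp add: f)
  qed
qed

lemma carrier_area_ringI: "f \<in> polyfun triangles \<Longrightarrow> f (sqarea generic_sq) \<in> carrier area_ring"
  unfolding carrier_area_ring by blast

lemma unital_subring_area_ring: "unital_subring (carrier area_ring)"
proof
  show "1 \<in> carrier area_ring"
    by (rule carrier_area_ringI[OF polyfun_one])
next
  fix x y assume "x \<in> carrier area_ring" "y \<in> carrier area_ring"
  then obtain f g where fg: "f \<in> polyfun triangles" "g \<in> polyfun triangles"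
    "x = f (sqarea generic_sq)" "y = g (sqarea generic_sq)"
    unfolding carrier_area_ring by blast
  show "x - y \<in> carrier area_ring" "x * y \<in> carrier area_ring"
    unfolding fg(3,4) by (rule carrier_area_ringI polyfun_diff polyfun.mult fg)+
qed

lemma polyfun_edge_heron:
  assumes "e \<in> edges"
  shows "(\<lambda>x. edge_heron x e) \<in> polyfun triangles"
proof -
  obtain i j k l m where lab: "labelling i j k l m" "e = {i, j}"
    using assms by (rule edges_cases)
  show ?thesis
    unfolding lab(2) edge_heron_labelled[OF lab(1)]
    by (intro polyfun_heron3 polyfun.var labelling_triangles[OF lab(1)])
qed

lemma Q_mem: "Q \<in> carrier area_ring"
  unfolding Q_eq by (rule carrier_area_ringI) (intro polyfun_prod polyfun_edge_heron)

lemma polyfun_sqarea: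
  assumes "T \<in> triangles"
  shows "(\<lambda>x. sqarea (\<lambda>e. (x e)\<^sup>2) T) \<in> polyfun edges"
proof -
  obtain i j k where T: "T = {i, j, k}" "distinct [i, j, k]" "i \<le> 4" "j \<le> 4" "k \<le> 4"
    using assms by (rule triangles_cases)
  have "{i, j} \<in> edges" "{i, k} \<in> edges" "{j, k} \<in> edges"
    using T by (simp_all add: pair_in_edges)
  then have "(\<lambda>x. heron3 ((x {i, j})\<^sup>2) ((x {i, k})\<^sup>2) ((x {j, k})\<^sup>2) * of_rat (1 / 16)) \<in> polyfun edges"
    by (intro polyfun_heron3 polyfun_intros)
  then show ?thesis
    by (simp add: T(1) sqarea_three[OF T(2)] of_rat_divide)
qed

lemma polyfun_cm: "(\<lambda>x. cm (\<lambda>e. (x e)\<^sup>2) 0 1 2 3 4) \<in> polyfun edges"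
  unfolding cm_def gram4_def by (intro polyfun_intros; simp add: pair_in_edges)

text \<open>
  The equation for \<open>b W\<close> is a relation between the generic lengths; it is specialized to arbitrary squared lengths,
  which have square roots in the algebraically closed field, and then evaluated on the degenerating families.
\<close>

lemma denominator_dvd:
  assumes "b \<in> denominator_ideal"
  shows "\<exists>r\<in>carrier area_ring. b = r * Q"
proof -
  obtain f where f: "f \<in> polyfun triangles" and b: "b = f (sqarea generic_sq)"
    using assms unfolding denominator_ideal_def carrier_area_ring by blast
  obtain p where p: "Polynomial.lead_coeff p = 1" "\<And>i. Polynomial.coeff p i \<in> carrier area_ring" "poly p (b * W) = 0"
    using assms unfolding denominator_ideal_def integral_over_def by blast
  have "\<forall>i. \<exists>c. c \<in> polyfun triangles \<and> Polynomial.coeff p i = c (sqarea generic_sq)"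
    using p(2) unfolding carrier_area_ring by blast
  then obtain c' where c': "\<And>i. c' i \<in> polyfun triangles" "\<And>i. Polynomial.coeff p i = c' i (sqarea generic_sq)"
    by metis
  define n where "n = Polynomial.degree p"
  \<comment> \<open>The leading coefficient has to be the constant function \<open>1\<close>, not only \<open>1\<close> at the generic areas.\<close>
  define c where "c i = (if i = n then (\<lambda>_. 1) else c' i)" for i
  have c: "c i \<in> polyfun triangles" "Polynomial.coeff p i = c i (sqarea generic_sq)" for i
    using c' p(1) by (simp_all add: c_def n_def polyfun_one)
  define \<Phi> where "\<Phi> = (\<lambda>x :: nat set \<Rightarrow> lfield. \<Sum>i\<le>n. c i (sqarea (\<lambda>e. (x e)\<^sup>2)) *
    (f (sqarea (\<lambda>e. (x e)\<^sup>2)) * (cm (\<lambda>e. (x e)\<^sup>2) 0 1 2 3 4 * of_rat (1 / 9216))) ^ i)"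
  have "\<Phi> \<in> polyfun edges"
    unfolding \<Phi>_def
    by (intro polyfun_intros polyfun_cm polyfun_subst[OF c(1) polyfun_sqarea] polyfun_subst[OF f polyfun_sqarea])
  moreover have "\<Phi> generic_length = poly p (b * W)"
    unfolding \<Phi>_def poly_altdef n_def[symmetric] b W_eq c(2)
    by (simp add: generic_sq_def[abs_def] of_rat_divide)
  ultimately have \<Phi>: "\<Phi> x = 0" for x
    using generic_relation_specializes[of \<Phi>] p(3) by simp
  have rel: "(\<Sum>i\<le>n. c i (sqarea L) * (f (sqarea L) * (cm L 0 1 2 3 4 / 9216)) ^ i) = 0" for L
  proof -
    have "\<forall>e. \<exists>x. x\<^sup>2 = L e"
      using nth_root_exists[of 2] by auto
    then obtain x where "\<And>e. (x e)\<^sup>2 = L e"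
      by metis
    then show ?thesis
      using \<Phi>[of x] by (simp add: \<Phi>_def of_rat_divide)
  qed
  have "f (heron3_zero {i, j, k} {i, j, l} {i, j, m} y) = 0" if "labelling i j k l m" for i j k l m y
    by (rule integral_relation_vanishes[OF f c(1) _ _ rel that]) (simp_all add: c_def)
  then obtain g where "g \<in> polyfun triangles" "\<And>x. f x = (\<Prod>e\<in>edges. edge_heron x e) * g x"
    using polyfun_edge_heron_dvd[OF f] by blast
  then show ?thesis
    unfolding carrier_area_ring b Q_eq by (intro bexI[of _ "g (sqarea generic_sq)"]) auto
qed

text \<open>
  In every valuation ring one factor of \<open>Q\<close> compensates the volume, and the other factors are elements of the ring.
\<close>

lemma multiple_of_Q_integral:
  assumes r: "r \<in> carrier area_ring"
  shows "integral_over (carrier area_ring) (r * Q * W)"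
proof (rule integral_over_if_in_all_valuation_rings[OF unital_subring_area_ring])
  fix V :: "lfield set" assume V: "valuation_ring V" and sub: "carrier area_ring \<subseteq> V"
  interpret valuation_ring V by fact
  have mem: "f (sqarea generic_sq) \<in> V" if "f \<in> polyfun triangles" for f
    using sub carrier_area_ringI[OF that] by blast
  have rat: "of_rat c \<in> V" for c
    by (rule mem[OF polyfun.const])
  interpret rational_valuation_ring V
  proof
    show "inverse (numeral n) \<in> V" for n
      using rat[of "1 / numeral n"] by (simp add: of_rat_divide inverse_eq_divide)
  qed
  have "sqarea generic_sq {i, j, k} \<in> V" if "i \<le> 4" "j \<le> 4" "k \<le> 4" "distinct [i, j, k]" for i j k
    using that by (intro mem[OF polyfun.var]) (simp add: triple_in_triangles)
  from some_edge_bounds_volume[OF this] have "cm generic_sq 0 1 2 3 4 * Q \<in> V"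
  proof
    assume "cm generic_sq 0 1 2 3 4 \<in> V"
    then show ?thesis
      using Q_mem sub by (intro mult_mem) auto
  next
    assume "\<exists>e\<subseteq>{..4}. card e = 2 \<and> cm generic_sq 0 1 2 3 4 * edge_heron (sqarea generic_sq) e \<in> V"
    then obtain e where e: "e \<in> edges" "cm generic_sq 0 1 2 3 4 * edge_heron (sqarea generic_sq) e \<in> V"
      unfolding edges_def by blast
    have "edge_heron (sqarea generic_sq) e' \<in> V" if "e' \<in> edges" for e'
      by (rule mem[OF polyfun_edge_heron[OF that]])
    then have "(\<Prod>e'\<in>edges - {e}. edge_heron (sqarea generic_sq) e') \<in> V"
      by (intro prod_mem) simp
    then have "(cm generic_sq 0 1 2 3 4 * edge_heron (sqarea generic_sq) e)
        * (\<Prod>e'\<in>edges - {e}. edge_heron (sqarea generic_sq) e') \<in> V"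
      using e(2) by (rule mult_mem[rotated])
    then show ?thesis
      unfolding Q_eq prod.remove[OF finite_edges e(1)] by (simp only: mult.assoc)
  qed
  moreover have "r \<in> V"
    using r sub by blast
  ultimately have "r * (cm generic_sq 0 1 2 3 4 * Q) / 9216 \<in> V"
    by (intro divide_numeral_mem mult_mem[of r])
  then show "r * Q * W \<in> V"
    by (simp add: W_eq mult_ac)
qed

theorem theorem1p9:
  fixes A :: "nat set \<Rightarrow> lfield"
  assumes A: "\<And>i j k. i < j \<Longrightarrow> j < k \<Longrightarrow> k \<le> 4 \<Longrightarrow> (A {i, j, k})\<^sup>2 = S i j k"
  shows "denominator_ideal = PIdl\<^bsub>area_ring\<^esub> Q \<and>
    Q = (\<Prod>(i, j, k, l, m)\<in>edge_splits.
           (A {i, j, k} + A {i, j, l} + A {i, j, m}) *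
           (- A {i, j, k} + A {i, j, l} + A {i, j, m}) *
           (A {i, j, k} - A {i, j, l} + A {i, j, m}) *
           (A {i, j, k} + A {i, j, l} - A {i, j, m}))"
proof
  have "r * Q \<in> denominator_ideal" if "r \<in> carrier area_ring" for r
    using multiple_of_Q_integral[OF that] unital_subring.mult_mem[OF unital_subring_area_ring that Q_mem]
    by (simp add: denominator_ideal_def)
  then show "denominator_ideal = PIdl\<^bsub>area_ring\<^esub> Q"
    using denominator_dvd unfolding cgenideal_def area_ring_simps(1) by blast
next
  have square: "(A {i, j, k})\<^sup>2 = sqarea generic_sq {i, j, k}"
    if d: "distinct [i, j, k]" and le: "i \<le> 4" "j \<le> 4" "k \<le> 4" for i j k
  proof -
    obtain a b c where abc: "a < b" "b < c" "{a, b, c} = {i, j, k}"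
      using d by (rule sorted_triple)
    then have "c \<in> {i, j, k}"
      by auto
    then have "c \<le> 4"
      using le by auto
    have "(A {a, b, c})\<^sup>2 = S a b c"
      using abc \<open>c \<le> 4\<close> by (intro A)
    also have "\<dots> = sqarea generic_sq {a, b, c}"
      using abc(1,2) by (intro S_eq) simp
    finally show ?thesis
      unfolding abc(3) .
  qed
  have linear_factors: "heron3 (x\<^sup>2) (y\<^sup>2) (z\<^sup>2) = (x + y + z) * (- x + y + z) * (x - y + z) * (x + y - z)"
    for x y z :: lfield
    unfolding heron3_def by (simp add: algebra_simps power2_eq_square)
  have "edge_heron (sqarea generic_sq) {i, j} = (A {i, j, k} + A {i, j, l} + A {i, j, m}) *
      (- A {i, j, k} + A {i, j, l} + A {i, j, m}) * (A {i, j, k} - A {i, j, l} + A {i, j, m}) *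
      (A {i, j, k} + A {i, j, l} - A {i, j, m})" if "(i, j, k, l, m) \<in> edge_splits" for i j k l m
  proof -
    have lab: "labelling i j k l m"
      using that by (simp add: edge_splits_iff)
    then have d: "distinct [i, j, k]" "distinct [i, j, l]" "distinct [i, j, m]"
      by (auto simp: labelling_def)
    note le = labelling_le[OF lab]
    show ?thesis
      unfolding edge_heron_labelled[OF lab] linear_factors[symmetric]
      using square[OF d(1) le(1,2,3)] square[OF d(2) le(1,2,4)] square[OF d(3) le(1,2,5)] by simp
  qed
  then show "Q = (\<Prod>(i, j, k, l, m)\<in>edge_splits.
           (A {i, j, k} + A {i, j, l} + A {i, j, m}) *
           (- A {i, j, k} + A {i, j, l} + A {i, j, m}) *
           (A {i, j, k} - A {i, j, l} + A {i, j, m}) *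
           (A {i, j, k} + A {i, j, l} - A {i, j, m}))"
    unfolding Q_eq by (subst prod.reindex_bij_betw[OF bij_betw_edge_splits, symmetric]) (intro prod.cong, auto)
qed

end
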